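(* Let $d\ge 2$, $s\ge 1$, and let $\{r_n\}_{n\in\mathbb{N}}\subset(0,+\infty)$ with $r_n\to 0^+$. Then: (i) (Compactness) If $U\subset\mathbb{R}^d$ is open and bounded and $\{E_n\}$ are measurable sets with $E_n\subset U$ for all $n$ and $\tilde J^s_{r_n}(E_n)\le M\sigma^s(r_n)$ for all $n$, for some constant $M$ independent of $n$, then, up to a subsequence, $\chi_{E_n}\to\chi_E$ strongly in $L^1(\mathbb{R}^d)$ for some measurable set $E$ of finite measure with $\mathrm{Per}(E)<+\infty$. (ii) (Lower bound) If $E$ is measurable with finite measure and $\{E_n\}$ are measurable sets of finite measure with $\chi_{E_n}\to\chi_E$ strongly in $L^1(\mathbb{R}^d)$, then $\omega_{d-1}\mathrm{Per}(E)\le\liminf_{n\to\infty}\frac{\tilde J^s_{r_n}(E_n)}{\sigma^s(r_n)}$. (iii) (Upper bound) For every measurable $E$ of finite measure there exist measurable sets $E_n$ of finite measure with $\chi_{E_n}\to\chi_E$ strongly in $L^1(\mathbb{R}^d)$ and $\omega_{d-1}\mathrm{Per}(E)=\lim_{n\to\infty}\frac{\tilde J^s_{r_n}(E_n)}{\sigma^s(r_n)}$.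
   Context: For $s\ge 1$ and $r>0$ let $k^s_r(t)=r^{-d-s}$ for $0\le t\le r$ and $k^s_r(t)=t^{-d-s}$ for $t>r$. For measurable $E\subset\mathbb{R}^d$ of finite measure, $\tilde J_r^s(E):=\int_E\int_{\mathbb{R}^d\setminus E}k^s_r(|x-y|)\,dy\,dx$. $\sigma^s(r):=|\log r|$ if $s=1$ and $\sigma^s(r):=\frac{d+s}{d+1}\frac{r^{1-s}}{s-1}$ if $s>1$. $\omega_{d-1}$ is the $(d-1)$-dimensional measure of the unit ball of $\mathbb{R}^{d-1}$; $\mathrm{Per}$ is the De Giorgi perimeter (equal to $+\infty$ if $E$ does not have finite perimeter). *)

theory Defs
  imports "HOL-Analysis.Analysis"
begin

definition kern :: "nat \<Rightarrow> real \<Rightarrow> real \<Rightarrow> real \<Rightarrow> real" where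
  "kern d s r t = (if t \<le> r then r powr (- real d - s) else t powr (- real d - s))"

definition sigma :: "nat \<Rightarrow> real \<Rightarrow> real \<Rightarrow> real" where
  "sigma d s r = (if s = 1 then \<bar>ln r\<bar>
                  else (real d + s) / (real d + 1) * (r powr (1 - s) / (s - 1)))"

definition Jt :: "real \<Rightarrow> real \<Rightarrow> 'a::euclidean_space set \<Rightarrow> ennreal" where
  "Jt s r E = (\<integral>\<^sup>+ x. indicator E x *
      (\<integral>\<^sup>+ y. indicator (- E) y * ennreal (kern DIM('a) s r (dist x y)) \<partial>lebesgue) \<partial>lebesgue)"

definition divergence :: "('a::euclidean_space \<Rightarrow> 'a) \<Rightarrow> 'a \<Rightarrow> real" where
  "divergence \<phi> x = (\<Sum>b\<in>Basis. frechet_derivative \<phi> (at x) b \<bullet> b)"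

definition test_fields :: "('a::euclidean_space \<Rightarrow> 'a) set" where
  "test_fields = {\<phi>. (\<forall>x. \<phi> differentiable (at x))
       \<and> (\<forall>b\<in>Basis. continuous_on UNIV (\<lambda>x. frechet_derivative \<phi> (at x) b))
       \<and> compact (closure {x. \<phi> x \<noteq> 0})
       \<and> (\<forall>x. norm (\<phi> x) \<le> 1)}"

definition Per :: "'a::euclidean_space set \<Rightarrow> ennreal" where
  "Per E = (SUP \<phi>\<in>test_fields. ennreal (\<integral>x. indicator E x * divergence \<phi> x \<partial>lebesgue))"

definition chi_L1_conv :: "(nat \<Rightarrow> 'a::euclidean_space set) \<Rightarrow> 'a set \<Rightarrow> bool" where
  "chi_L1_conv En E \<longleftrightarrow>
     (\<lambda>n. \<integral>\<^sup>+ x. ennreal \<bar>indicator (En n) x - indicator E x\<bar> \<partial>lebesgue) \<longlonglongrightarrow> 0"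

end

theory Submission
  imports Defs "HOL-Complex_Analysis.Great_Picard"
begin

text \<open>
  Write \<open>G z\<close> for the \<open>L\<^sup>1\<close> distance between the indicator of \<open>E\<close> and its translate by \<open>z\<close>. Fubini turns twice
  the energy into the integral of \<open>kern (norm z) * G z\<close>. If \<open>W\<close> is the gradient of a mollification of the
  indicator of \<open>E\<close>, then \<open>G z\<close> is, for small \<open>z\<close>, comparable with the integral of \<open>\<bar>W y \<bullet> z\<bar>\<close> over \<open>y\<close>, and
  integrating \<open>kern (norm z) * \<bar>W y \<bullet> z\<bar>\<close> in polar coordinates gives \<open>2 \<omega> * norm (W y) * (sigma r + O(1))\<close>
  with \<open>\<omega>\<close> the volume of the unit ball in one dimension less. Since the integral of \<open>norm (W y)\<close> is at most
  \<open>Per E\<close> and recovers it as the mollification scale vanishes, this yields both bounds, the upper one with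
  the constant sequence.

  For compactness, \<open>G (2 z) \<le> 2 * G z\<close> shows that the contributions of the dyadic shells between the scales
  \<open>r\<close> and \<open>\<delta>\<close> to the energy are bounded below by the average of \<open>G\<close> over the ball of radius \<open>\<delta>\<close>. They add up to a
  multiple of \<open>sigma r\<close>, so an energy bound forces this average to be \<open>O(\<delta>)\<close>. Hence mollifying at scale \<open>\<delta>\<close>
  changes the sets by \<open>O(\<delta>)\<close> in \<open>L\<^sup>1\<close>, uniformly along the sequence, and mollified sets are precompact.
\<close>

subsection \<open>Integration of radial and homogeneous functions\<close>

text \<open>The normalisation \<open>sigma\<close> is more than asymptotic: the integral of
  \<open>kern\<close> times t^d over (0, \<rho>) equals \<open>sigma\<close> plus a constant free of
  \<open>r\<close>. The plateau below \<open>r\<close> contributes r^(1-s)/(d+1), the power law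
  above it r^(1-s)/(s-1) or, for s = 1, - ln r; adding the two for s > 1 produces the factor
  (d+s)/(d+1). As \<open>sigma\<close> tends to infinity, everything that stays bounded as
  \<open>r\<close> tends to 0 drops out. The order of limits shapes the estimates. The mass of the
  kernel blows up as \<open>r\<close> tends to 0, so an absolute error in \<open>G\<close> is
  affordable only with \<open>r\<close> fixed. The upper bound therefore sends the mollification
  scale to 0 first, and integrates increments along segments so that no Taylor remainder arises. The
  lower bound fixes the mollification scale; its error must be proportional to
  \<open>norm z\<close>, so that it integrates to a small multiple of \<open>sigma\<close>, and
  uniform over sets of bounded measure, because the sets vary with \<open>r\<close>. In the
  compactness part each doubling costs 2^(d+1), namely 2^d from volume and 2 from subadditivity,
  while the kernel gains 2^(d+s). For s = 1 all scales count equally, whence the logarithm; for s >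
  1 the finest one dominates.\<close>

lemma sets_borel_ball [measurable]: "ball a r \<in> sets borel" "cball a r \<in> sets borel"
  for a :: "'a::metric_space"
  by simp_all

lemma nn_integral_lborel_affine:
  fixes f :: "'a::euclidean_space \<Rightarrow> ennreal"
  assumes [measurable]: "f \<in> borel_measurable borel" and c: "c \<noteq> 0"
  shows "(\<integral>\<^sup>+x. f x \<partial>lborel) = ennreal (\<bar>c\<bar> ^ DIM('a)) * (\<integral>\<^sup>+x. f (t + c *\<^sub>R x) \<partial>lborel)"
  by (subst lborel_affine[OF c, of t])
     (simp add: nn_integral_density nn_integral_distr nn_integral_cmult)

lemma nn_integral_lborel_shift:
  fixes f :: "'a::euclidean_space \<Rightarrow> ennreal"
  assumes [measurable]: "f \<in> borel_measurable borel"
  shows "(\<integral>\<^sup>+x. f (t + x) \<partial>lborel) = (\<integral>\<^sup>+x. f x \<partial>lborel)"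
  using nn_integral_lborel_affine[of f 1 t] by simp

lemma nn_integral_lborel_reflect:
  fixes f :: "'a::euclidean_space \<Rightarrow> ennreal"
  assumes [measurable]: "f \<in> borel_measurable borel"
  shows "(\<integral>\<^sup>+x. f (t - x) \<partial>lborel) = (\<integral>\<^sup>+x. f x \<partial>lborel)"
  using nn_integral_lborel_affine[of f "-1" t] by simp

text \<open>The image measure is translation invariant; comparing it with \<open>lborel\<close> by Fubini, as in the proof of the
  uniqueness of Haar measure, gives proportionality, and the unit ball fixes the factor.\<close>

lemma lborel_distr_isometry:
  fixes T :: "'a::euclidean_space \<Rightarrow> 'a"
  assumes lin: "linear T" and iso: "\<And>x. norm (T x) = norm x"
  shows "distr lborel borel T = lborel"
proof -
  have cT: "continuous_on UNIV T" using lin by (simp add: linear_continuous_on linear_conv_bounded_linear)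
  have [measurable]: "T \<in> borel_measurable borel" using cT by (rule borel_measurable_continuous_onI)
  have surjT: "surj T"
  proof -
    have "inj T" unfolding linear_injective_0[OF lin] using iso by (metis norm_eq_zero)
    then show ?thesis using lin linear_injective_imp_surjective by blast
  qed
  have inv: "(\<integral>\<^sup>+y. f (T y - x) \<partial>lborel) = (\<integral>\<^sup>+y. f (T y) \<partial>lborel)"
    if [measurable]: "f \<in> borel_measurable borel" for f :: "'a \<Rightarrow> ennreal" and x
  proof -
    obtain w where w: "T w = x" using surjT by (metis surjD)
    have "(\<integral>\<^sup>+y. f (T y - x) \<partial>lborel) = (\<integral>\<^sup>+y. f (T (-w + y)) \<partial>lborel)"
      by (simp add: linear_diff[OF lin] w)
    also have "\<dots> = (\<integral>\<^sup>+y. f (T y) \<partial>lborel)" by (rule nn_integral_lborel_shift[of "\<lambda>y. f (T y)"]) measurable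
    finally show ?thesis .
  qed
  let ?B = "ball 0 1 :: 'a set"
  let ?b = "emeasure lborel ?B"
  have b: "?b \<noteq> 0" "?b \<noteq> \<infinity>" using unit_ball_vol_pos[of "real DIM('a)"] by (simp_all add: emeasure_ball del: unit_ball_vol_pos)
  have main: "emeasure (distr lborel borel T) A = emeasure lborel A" if [measurable]: "A \<in> sets borel" for A
  proof -
    have "?b * emeasure (distr lborel borel T) A = (\<integral>\<^sup>+x. indicator ?B x * (\<integral>\<^sup>+y. indicator A (T y) \<partial>lborel) \<partial>lborel)"
      using nn_integral_distr[of T lborel borel "indicator A"] by (simp add: nn_integral_multc)
    \<comment> \<open>By translation invariance the outer variable may be inserted into the inner
      integral. This couples the two variables, so that Fubini and a shift can exchange the roles of
      \<open>?B\<close> and \<open>A\<close>.\<close>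
    also have "\<dots> = (\<integral>\<^sup>+x. indicator ?B x * (\<integral>\<^sup>+y. indicator A (T y - (- x)) \<partial>lborel) \<partial>lborel)"
      by (subst inv) simp_all
    also have "\<dots> = (\<integral>\<^sup>+x. (\<integral>\<^sup>+y. indicator ?B x * indicator A (T y + x) \<partial>lborel) \<partial>lborel)"
      by (simp add: nn_integral_cmult)
    also have "\<dots> = (\<integral>\<^sup>+y. (\<integral>\<^sup>+x. indicator ?B x * indicator A (T y + x) \<partial>lborel) \<partial>lborel)"
      by (rule lborel_pair.Fubini') measurable
    also have "\<dots> = (\<integral>\<^sup>+y. (\<integral>\<^sup>+x. indicator ?B (x - T y) * indicator A x \<partial>lborel) \<partial>lborel)"
    proof (rule nn_integral_cong)
      fix y
      show "(\<integral>\<^sup>+x. indicator ?B x * indicator A (T y + x) \<partial>lborel) = (\<integral>\<^sup>+x. indicator ?B (x - T y) * indicator A x \<partial>lborel)"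
        using nn_integral_lborel_shift[of "\<lambda>x. indicator ?B (x - T y) * indicator A x" "T y"] by simp
    qed
    also have "\<dots> = (\<integral>\<^sup>+x. (\<integral>\<^sup>+y. indicator ?B (x - T y) * indicator A x \<partial>lborel) \<partial>lborel)"
      by (rule lborel_pair.Fubini') measurable
    also have "\<dots> = (\<integral>\<^sup>+x. (\<integral>\<^sup>+y. indicator ?B (T y - x) \<partial>lborel) * indicator A x \<partial>lborel)"
      by (intro nn_integral_cong, subst nn_integral_multc[symmetric])
         (auto simp: indicator_def dist_norm norm_minus_commute)
    also have "\<dots> = (\<integral>\<^sup>+x. (\<integral>\<^sup>+y. indicator ?B (T y) \<partial>lborel) * indicator A x \<partial>lborel)"
      by (subst inv) simp_all
    also have "(\<integral>\<^sup>+y. indicator ?B (T y) \<partial>lborel) = ?b"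
    proof -
      have "(\<integral>\<^sup>+y. indicator ?B (T y) \<partial>lborel) = (\<integral>\<^sup>+y. indicator ?B y \<partial>lborel)"
        by (intro nn_integral_cong) (auto simp: indicator_def iso)
      then show ?thesis by simp
    qed
    also have "(\<integral>\<^sup>+x. ?b * indicator A x \<partial>lborel) = ?b * emeasure lborel A" by (simp add: nn_integral_cmult)
    finally show ?thesis using b by (simp add: ennreal_mult_cancel_left)
  qed
  show ?thesis by (rule measure_eqI) (auto simp: main)
qed

text \<open>The exponent \<open>p = 1\<close> is integration in polar coordinates; \<open>p = 2\<close> turns Gaussian integrals into values of the
  Gamma function, from which the constant in the polar formula is computed.\<close>

lemma nn_integral_homogeneous:
  fixes h :: "'a::euclidean_space \<Rightarrow> ennreal" and F :: "real \<Rightarrow> ennreal"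
  assumes [measurable]: "h \<in> borel_measurable borel" "F \<in> borel_measurable borel"
    and hom: "\<And>c z. c > 0 \<Longrightarrow> h (c *\<^sub>R z) = ennreal (c powr m) * h z"
    and a: "(\<integral>\<^sup>+z. indicator (ball 0 1) z * h z \<partial>lborel) = ennreal a" "a \<ge> 0"
    and p: "p > 0" and k: "\<kappa> = (real DIM('a) + m) / p" "\<kappa> > 0"
  shows "(\<integral>\<^sup>+z. F (norm z powr p) * h z \<partial>lborel) =
    (\<integral>\<^sup>+t. indicator {0<..} t * (F t * ennreal (a * \<kappa> * t powr (\<kappa> - 1))) \<partial>lborel)"
proof -
  \<comment> \<open>The minus sign is there because \<open>measure_eqI_lessThan\<close> compares
    measures on the rays \<open>{x<..}\<close>: with it their preimages are balls, on which the mass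
    is finite, and not complements of balls.\<close>
  define M where "M = distr (density (lborel :: 'a measure) h) borel (\<lambda>z. - (norm z powr p))"
  define N where "N = distr (density lborel (\<lambda>t. indicator {0<..} t * ennreal (a * \<kappa> * t powr (\<kappa> - 1)))) borel (uminus :: real \<Rightarrow> real)"
  have eM: "emeasure M {x<..} = (if x < 0 then ennreal (a * (-x) powr \<kappa>) else 0)" for x
  proof (cases "x < 0")
    case True
    define \<rho> where "\<rho> = (-x) powr (1/p)"
    have \<rho>: "\<rho> > 0" using True by (simp add: \<rho>_def)
    have iff: "x < - (norm z powr p) \<longleftrightarrow> norm z < \<rho>" for z :: 'a
    proof -
      have "norm z powr p < -x \<longleftrightarrow> norm z powr p < \<rho> powr p"
        using True p by (simp add: \<rho>_def powr_powr)
      also have "\<dots> \<longleftrightarrow> norm z < \<rho>" using p \<rho>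
        by (meson less_eq_real_def linorder_not_less norm_ge_zero powr_less_mono2 powr_mono2)
      finally show ?thesis by auto
    qed
    have "emeasure M {x<..} = (\<integral>\<^sup>+z. h z * indicator {z. x < - (norm z powr p)} z \<partial>lborel)"
      by (simp add: M_def emeasure_distr emeasure_density vimage_def)
    also have "\<dots> = (\<integral>\<^sup>+z. indicator (ball 0 \<rho>) z * h z \<partial>lborel)"
      by (intro nn_integral_cong) (auto simp: indicator_def iff)
    also have "\<dots> = ennreal (\<rho> ^ DIM('a)) * (\<integral>\<^sup>+z. indicator (ball 0 \<rho>) (\<rho> *\<^sub>R z) * h (\<rho> *\<^sub>R z) \<partial>lborel)"
      using \<rho> nn_integral_lborel_affine[of "\<lambda>z. indicator (ball 0 \<rho>) z * h z" \<rho> 0]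
      by simp
    also have "(\<integral>\<^sup>+z. indicator (ball 0 \<rho>) (\<rho> *\<^sub>R z) * h (\<rho> *\<^sub>R z) \<partial>lborel) = (\<integral>\<^sup>+z. ennreal (\<rho> powr m) * (indicator (ball 0 1) z * h z) \<partial>lborel)"
      using \<rho> by (intro nn_integral_cong) (auto simp: indicator_def hom)
    also have "\<dots> = ennreal (\<rho> powr m) * ennreal a" by (simp add: nn_integral_cmult a)
    also have "ennreal (\<rho> ^ DIM('a)) * \<dots> = ennreal (a * (\<rho> powr (DIM('a) + m)))"
      using \<rho> a by (simp add: ennreal_mult[symmetric] powr_add powr_realpow mult_ac)
    also have "\<rho> powr (DIM('a) + m) = (-x) powr \<kappa>" by (simp add: \<rho>_def powr_powr k)
    finally show ?thesis using True by simp
  next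
    case False
    have "emeasure M {x<..} = (\<integral>\<^sup>+z. h z * indicator {z. x < - (norm z powr p)} z \<partial>lborel)"
      by (simp add: M_def emeasure_distr emeasure_density vimage_def)
    also have "{z::'a. x < - (norm z powr p)} = {}" using False by (auto simp: not_less intro: order_trans[of _ 0])
    finally show ?thesis using False by simp
  qed
  have eN: "emeasure N {x<..} = (if x < 0 then ennreal (a * (-x) powr \<kappa>) else 0)" for x
  proof -
    have "emeasure N {x<..} = (\<integral>\<^sup>+t. indicator {0<..} t * ennreal (a * \<kappa> * t powr (\<kappa> - 1)) * indicator {t. x < - t} t \<partial>lborel)"
      by (simp add: N_def emeasure_distr emeasure_density vimage_def)
    also have "\<dots> = (if x < 0 then ennreal (a * (-x) powr \<kappa>) else 0)"
    proof (cases "x < 0")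
      case True
      have "((\<lambda>t. t powr (\<kappa> - 1)) has_integral ((-x) powr \<kappa> / \<kappa>)) {0..-x}"
        using has_integral_powr_from_0[of "\<kappa> - 1" "-x"] True k by simp
      then have "((\<lambda>t. (a * \<kappa>) * t powr (\<kappa> - 1)) has_integral ((a * \<kappa>) * ((-x) powr \<kappa> / \<kappa>))) {0..-x}"
        by (rule has_integral_mult_right)
      then have "(\<integral>\<^sup>+t. ennreal (a * \<kappa> * t powr (\<kappa> - 1)) * indicator {0..-x} t \<partial>lborel) = ennreal ((a * \<kappa>) * ((-x) powr \<kappa> / \<kappa>))"
        using k(2) a(2) by (intro nn_integral_has_integral_lebesgue') auto
      also have "(a * \<kappa>) * ((-x) powr \<kappa> / \<kappa>) = a * (-x) powr \<kappa>" using k(2) by simp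
      finally have "(\<integral>\<^sup>+t. ennreal (a * \<kappa> * t powr (\<kappa> - 1)) * indicator {0..-x} t \<partial>lborel) = ennreal (a * (-x) powr \<kappa>)" .
      moreover have "(\<integral>\<^sup>+t. ennreal (a * \<kappa> * t powr (\<kappa> - 1)) * indicator {0..-x} t \<partial>lborel)
         = (\<integral>\<^sup>+t. indicator {0<..} t * ennreal (a * \<kappa> * t powr (\<kappa> - 1)) * indicator {t. x < - t} t \<partial>lborel)"
        using AE_lborel_singleton[of 0] AE_lborel_singleton[of "-x"]
        by (intro nn_integral_cong_AE, eventually_elim) (auto simp: indicator_def)
      ultimately show ?thesis using True by simp
    next
      case False
      then have "(\<integral>\<^sup>+t. indicator {0<..} t * ennreal (a * \<kappa> * t powr (\<kappa> - 1)) * indicator {t. x < - t} t \<partial>lborel) = (\<integral>\<^sup>+(t::real). 0 \<partial>lborel)"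
        by (intro nn_integral_cong) (auto simp: indicator_def)
      then show ?thesis using False by simp
    qed
    finally show ?thesis .
  qed
  have "M = N" by (rule measure_eqI_lessThan) (auto simp: eM eN, auto simp: M_def N_def)
  have "(\<integral>\<^sup>+z. F (norm z powr p) * h z \<partial>lborel) = (\<integral>\<^sup>+t. F (- t) \<partial>M)"
    by (simp add: M_def nn_integral_distr nn_integral_density mult.commute)
  also have "\<dots> = (\<integral>\<^sup>+t. F (- t) \<partial>N)" by (simp add: \<open>M = N\<close>)
  also have "\<dots> = (\<integral>\<^sup>+t. indicator {0<..} t * (F t * ennreal (a * \<kappa> * t powr (\<kappa> - 1))) \<partial>lborel)"
    by (simp add: N_def nn_integral_distr nn_integral_density mult_ac)
  finally show ?thesis .
qed


section \<open>Gaussian integrals and the constant in the polar formula\<close>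

lemma nn_integral_exp_powr:
  assumes "\<kappa> > 0" "c \<ge> 0"
  shows "(\<integral>\<^sup>+t. indicator {0<..} t * (ennreal (exp (- t)) * ennreal (c * t powr (\<kappa> - 1))) \<partial>lborel) = ennreal (c * Gamma \<kappa>)"
proof -
  have "(\<integral>\<^sup>+t. indicator {0<..} t * (ennreal (exp (- t)) * ennreal (c * t powr (\<kappa> - 1))) \<partial>lborel)
      = (\<integral>\<^sup>+t. ennreal c * ennreal (indicator {0..} t * t powr (\<kappa> - 1) / exp t) \<partial>lborel)"
    using AE_lborel_singleton[of 0]
    by (intro nn_integral_cong_AE, eventually_elim)
       (use assms in \<open>auto simp: indicator_def ennreal_mult[symmetric] exp_minus field_simps\<close>)
  also have "\<dots> = ennreal c * ennreal (Gamma \<kappa>)"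
    using assms by (subst nn_integral_cmult) (auto simp: Gamma_conv_nn_integral_real)
  also have "\<dots> = ennreal (c * Gamma \<kappa>)"
    using assms Gamma_real_pos[of \<kappa>] by (simp add: ennreal_mult)
  finally show ?thesis .
qed

text \<open>The substitution t = |z|^2 leaves a Gamma integral. Read backwards, the mass
  \<open>a\<close> of a homogeneous function on the unit ball can be recovered from its Gaussian
  integral, which is easy to compute when it factorises over coordinates.\<close>

lemma nn_integral_gaussian_homogeneous:
  fixes h :: "'a::euclidean_space \<Rightarrow> ennreal"
  assumes [measurable]: "h \<in> borel_measurable borel"
    and hom: "\<And>c z. c > 0 \<Longrightarrow> h (c *\<^sub>R z) = ennreal (c powr m) * h z"
    and a: "(\<integral>\<^sup>+z. indicator (ball 0 1) z * h z \<partial>lborel) = ennreal a" "a \<ge> 0"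
    and k: "\<kappa> = (real DIM('a) + m) / 2" "\<kappa> > 0"
  shows "(\<integral>\<^sup>+z. ennreal (exp (- (norm z)\<^sup>2)) * h z \<partial>lborel) = ennreal (a * \<kappa> * Gamma \<kappa>)"
proof -
  have "(\<integral>\<^sup>+z. ennreal (exp (- (norm z)\<^sup>2)) * h z \<partial>lborel) = (\<integral>\<^sup>+z. ennreal (exp (- (norm z powr 2))) * h z \<partial>lborel)"
    by (simp add: powr_numeral)
  also have "\<dots> = (\<integral>\<^sup>+t. indicator {0<..} t * (ennreal (exp (- t)) * ennreal (a * \<kappa> * t powr (\<kappa> - 1))) \<partial>lborel)"
    by (rule nn_integral_homogeneous[where F = "\<lambda>t. ennreal (exp (- t))" and p = 2, OF _ _ hom a _ k]) auto
  also have "\<dots> = ennreal (a * \<kappa> * Gamma \<kappa>)"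
    using a k by (intro nn_integral_exp_powr) auto
  finally show ?thesis .
qed

text \<open>Degree 0 on the line: the unit ball has length 2 and \<open>\<kappa>\<close> is 1/2, so
  the value is Gamma(1/2).\<close>

lemma nn_integral_gaussian_real: "(\<integral>\<^sup>+x. ennreal (exp (- x\<^sup>2)) \<partial>lborel) = ennreal (sqrt pi)"
proof -
  have ball: "(\<integral>\<^sup>+(z::real). indicator (ball 0 1) z * 1 \<partial>lborel) = ennreal 2"
    by (simp add: ball_eq_greaterThanLessThan)
  have "(\<integral>\<^sup>+(z::real). ennreal (exp (- (norm z)\<^sup>2)) * 1 \<partial>lborel) = ennreal (2 * (1/2) * Gamma (1/2))"
    by (rule nn_integral_gaussian_homogeneous[where m = 0, OF _ _ ball]) auto
  then show ?thesis by (simp add: Gamma_one_half_real)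
qed

lemma nn_integral_gaussian_abs_real: "(\<integral>\<^sup>+x. ennreal (exp (- x\<^sup>2)) * ennreal \<bar>x\<bar> \<partial>lborel) = 1"
proof -
  have abs: "(\<integral>\<^sup>+x. indicator (ball 0 1) x * ennreal \<bar>x\<bar> \<partial>lborel) = ennreal 1"
  proof -
    have "((\<lambda>x::real. \<bar>x\<bar>) has_integral (1/2 + 1/2)) {-1..1}"
    proof (rule has_integral_combine[where c = 0])
      have "((\<lambda>x::real. x) has_integral 1/2) {0..1}"
        using ident_has_integral[of 0 "1::real"] by simp
      then show "((\<lambda>x::real. \<bar>x\<bar>) has_integral 1/2) {0..1}" by (rule has_integral_eq[rotated]) auto
      have "((\<lambda>x::real. - x) has_integral 1/2) {-1..0}"
        using has_integral_neg[OF ident_has_integral[of "-1::real" 0]] by simp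
      then show "((\<lambda>x::real. \<bar>x\<bar>) has_integral 1/2) {-1..0}" by (rule has_integral_eq[rotated]) auto
    qed auto
    then have "((\<lambda>x::real. \<bar>x\<bar>) has_integral 1) {-1..1}" by simp
    then have "(\<integral>\<^sup>+x. ennreal \<bar>x\<bar> * indicator {-1..1} x \<partial>lborel) = ennreal 1"
      by (intro nn_integral_has_integral_lebesgue') auto
    moreover have "(\<integral>\<^sup>+x. ennreal \<bar>x\<bar> * indicator {-1..1} x \<partial>lborel) = (\<integral>\<^sup>+x. indicator (ball 0 1) x * ennreal \<bar>x\<bar> \<partial>lborel)"
      using AE_lborel_singleton[of 1] AE_lborel_singleton[of "-1"]
      by (intro nn_integral_cong_AE, eventually_elim) (auto simp: indicator_def)
    ultimately show ?thesis by simp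
  qed
  have "(\<integral>\<^sup>+(z::real). ennreal (exp (- (norm z)\<^sup>2)) * ennreal \<bar>z\<bar> \<partial>lborel) = ennreal (1 * 1 * Gamma 1)"
    by (rule nn_integral_gaussian_homogeneous[where m = 1, OF _ _ abs]) (auto simp: abs_mult ennreal_mult)
  then show ?thesis by simp
qed

text \<open>Two vectors of equal norm are interchanged by the reflection in the hyperplane
  orthogonal to their difference (Householder).\<close>

lemma linear_isometry_exists:
  fixes e e' :: "'a::euclidean_space"
  assumes "norm e = norm e'"
  obtains T where "linear T" "\<And>x. norm (T x) = norm x" "T e = e'"
proof (cases "e = e'")
  case True
  then show ?thesis using that[of id] by (simp add: linear_id)
next
  case False
  define v where "v = e - e'"
  define T where "T x = x - (2 * (x \<bullet> v) / (v \<bullet> v)) *\<^sub>R v" for x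
  have v: "v \<bullet> v > 0" using False by (simp add: v_def)
  have "e \<bullet> e = e' \<bullet> e'" using assms by (simp add: dot_square_norm)
  then have ev: "2 * (e \<bullet> v) = v \<bullet> v" by (simp add: v_def inner_diff inner_commute)
  show ?thesis
  proof (rule that)
    show "linear T" by (rule linearI) (auto simp: T_def inner_add_left algebra_simps add_divide_distrib)
    have "T x \<bullet> T x = x \<bullet> x" for x
    proof -
      have "T x \<bullet> T x = x \<bullet> x - 2 * (2 * (x \<bullet> v) / (v \<bullet> v)) * (x \<bullet> v) + (2 * (x \<bullet> v) / (v \<bullet> v)) * (2 * (x \<bullet> v) / (v \<bullet> v)) * (v \<bullet> v)"
        by (simp add: T_def inner_diff inner_commute)
      also have "\<dots> = x \<bullet> x" using v by (simp add: field_simps)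
      finally show ?thesis .
    qed
    then show "norm (T x) = norm x" for x by (simp add: norm_eq_sqrt_inner)
    show "T e = e'" using v by (simp add: T_def ev) (simp add: v_def)
  qed
qed

text \<open>Polar coordinates for a function of degree 1. The constant is the integral of |x
  \<bullet> e| over the unit sphere, for a unit vector e: twice the area of the equatorial disc onto
  which each hemisphere projects. An isometry reduces to a basis vector, and the constant is found
  from a Gaussian integral.\<close>

lemma nn_integral_norm_inner:
  fixes F :: "real \<Rightarrow> ennreal" and e :: "'a::euclidean_space"
  assumes [measurable]: "F \<in> borel_measurable borel"
  shows "(\<integral>\<^sup>+z. F (norm z) * ennreal \<bar>z \<bullet> e\<bar> \<partial>lborel) =
     ennreal (2 * unit_ball_vol (real (DIM('a) - 1)) * norm e) * (\<integral>\<^sup>+t. indicator {0<..} t * (F t * ennreal (t ^ DIM('a))) \<partial>lborel)"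
proof -
  let ?d = "DIM('a)"
  obtain b :: 'a where b: "b \<in> Basis" using nonempty_Basis by blast
  obtain T :: "'a \<Rightarrow> 'a" where T: "linear T" "\<And>x. norm (T x) = norm x" "T e = norm e *\<^sub>R b"
    using linear_isometry_exists[of e "norm e *\<^sub>R b"] b by auto
  have Tin: "T x \<bullet> T y = x \<bullet> y" for x y
  using T(1,2) orthogonal_transformation[of T] by (simp add: orthogonal_transformation_def)
  have [measurable]: "T \<in> borel_measurable borel"
    using T(1) by (intro borel_measurable_continuous_onI) (simp add: linear_continuous_on linear_conv_bounded_linear)
  have "(\<integral>\<^sup>+z. F (norm z) * ennreal \<bar>z \<bullet> e\<bar> \<partial>lborel) = (\<integral>\<^sup>+z. F (norm (T z)) * ennreal \<bar>T z \<bullet> T e\<bar> \<partial>lborel)"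
    by (simp add: T(2) Tin)
  also have "\<dots> = (\<integral>\<^sup>+z. F (norm z) * ennreal \<bar>z \<bullet> T e\<bar> \<partial>distr lborel borel T)"
    by (subst nn_integral_distr) auto
  also have "\<dots> = (\<integral>\<^sup>+z. F (norm z) * ennreal \<bar>z \<bullet> T e\<bar> \<partial>lborel)"
    by (simp add: lborel_distr_isometry[OF T(1,2)])
  also have "\<dots> = (\<integral>\<^sup>+z. ennreal (norm e) * (F (norm z) * ennreal \<bar>z \<bullet> b\<bar>) \<partial>lborel)"
    by (intro nn_integral_cong) (simp add: T(3) abs_mult ennreal_mult mult_ac)
  also have "\<dots> = ennreal (norm e) * (\<integral>\<^sup>+z. F (norm z) * ennreal \<bar>z \<bullet> b\<bar> \<partial>lborel)"
    by (rule nn_integral_cmult) auto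
  finally have 1: "(\<integral>\<^sup>+z. F (norm z) * ennreal \<bar>z \<bullet> e\<bar> \<partial>lborel) = ennreal (norm e) * (\<integral>\<^sup>+z. F (norm z) * ennreal \<bar>z \<bullet> b\<bar> \<partial>lborel)" .
  define h where "h z = ennreal \<bar>z \<bullet> b\<bar>" for z
  have [measurable]: "h \<in> borel_measurable borel" unfolding h_def by measurable
  have hom: "h (c *\<^sub>R z) = ennreal (c powr 1) * h z" if "c > 0" for c z
    using that by (simp add: h_def abs_mult ennreal_mult)
  have "(\<integral>\<^sup>+z. indicator (ball 0 1) z * h z \<partial>lborel) \<le> (\<integral>\<^sup>+(z::'a). indicator (ball 0 1) z \<partial>lborel)"
  proof (rule nn_integral_mono)
    fix z
    have "\<bar>z \<bullet> b\<bar> \<le> norm z" using b by (simp add: Basis_le_norm)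
    then show "indicator (ball 0 1) z * h z \<le> indicator (ball 0 1) z" by (auto simp: indicator_def h_def)
  qed
  also have "\<dots> < \<infinity>" by (simp add: emeasure_ball)
  finally obtain a where a: "(\<integral>\<^sup>+z. indicator (ball 0 1) z * h z \<partial>lborel) = ennreal a" "a \<ge> 0"
    by (metis enn2real_nonneg ennreal_enn2real infinity_ennreal_def)
  \<comment> \<open>The Gaussian integral of \<open>h\<close> is computed twice: by the radial
    formula, and as a product over coordinates in which the direction \<open>b\<close> contributes 1
    and every other direction sqrt pi. Comparing the two values yields \<open>a\<close>.\<close>
  have val: "a * (real ?d + 1) = 2 * unit_ball_vol (real (?d - 1))"
  proof -
    let ?k = "(real ?d + 1) / 2"
    have "(\<integral>\<^sup>+z. ennreal (exp (- (norm z)\<^sup>2)) * h z \<partial>lborel) = ennreal (a * ?k * Gamma ?k)"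
      by (rule nn_integral_gaussian_homogeneous[OF _ hom a]) auto
    moreover have "(\<integral>\<^sup>+z. ennreal (exp (- (norm z)\<^sup>2)) * h z \<partial>lborel) = ennreal (sqrt pi ^ (?d - 1))"
    proof -
      let ?f = "\<lambda>i (t::real). ennreal (exp (- t\<^sup>2)) * (if i = b then ennreal \<bar>t\<bar> else 1)"
      have "(\<integral>\<^sup>+z. ennreal (exp (- (norm z)\<^sup>2)) * h z \<partial>lborel) = (\<integral>\<^sup>+z. (\<Prod>i\<in>Basis. ?f i (z \<bullet> i)) \<partial>lborel)"
      proof (rule nn_integral_cong)
        fix z :: 'a
        have "(norm z)\<^sup>2 = (\<Sum>i\<in>Basis. (z \<bullet> i)\<^sup>2)"
          by (subst power2_norm_eq_inner, subst euclidean_inner) (simp add: power2_eq_square)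
        then have "exp (- (norm z)\<^sup>2) = (\<Prod>i\<in>Basis. exp (- (z \<bullet> i)\<^sup>2))"
          by (simp add: exp_sum sum_negf[symmetric])
        then have "ennreal (exp (- (norm z)\<^sup>2)) = (\<Prod>i\<in>Basis. ennreal (exp (- (z \<bullet> i)\<^sup>2)))"
          by (simp add: prod_ennreal)
        moreover have "(\<Prod>i\<in>Basis. if i = b then ennreal \<bar>z \<bullet> i\<bar> else 1) = h z"
          using b by (simp add: prod.delta h_def)
        ultimately show "ennreal (exp (- (norm z)\<^sup>2)) * h z = (\<Prod>i\<in>Basis. ?f i (z \<bullet> i))"
          by (simp add: prod.distrib)
      qed
      also have "\<dots> = (\<Prod>i\<in>Basis. (\<integral>\<^sup>+t. ?f i t \<partial>lborel))"
        by (rule nn_integral_lborel_prod) auto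
      also have "\<dots> = (\<Prod>i\<in>Basis. if i = b then 1 else ennreal (sqrt pi))"
        by (intro prod.cong) (auto simp: nn_integral_gaussian_real nn_integral_gaussian_abs_real)
      also have "\<dots> = (\<Prod>i\<in>Basis - {b}. ennreal (sqrt pi))"
        by (subst prod.remove[OF _ b]) (auto intro!: prod.cong)
      also have "\<dots> = ennreal (sqrt pi ^ (?d - 1))" using b by (simp add: ennreal_power card_Diff_singleton)
      finally show ?thesis .
    qed
    moreover have G: "Gamma ?k > 0" by (intro Gamma_real_pos) auto
    ultimately have eq: "a * ?k * Gamma ?k = sqrt pi ^ (?d - 1)" using a(2)
      by (simp add: ennreal_inj)
    \<comment> \<open>This is the Gamma argument in the volume of the unit ball of dimension d - 1,
      which is how that volume enters.\<close>
    have k: "?k = real (?d - 1) / 2 + 1" using DIM_positive[where 'a = 'a] by (simp add: of_nat_diff Suc_leI field_simps)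
    have "sqrt pi ^ (?d - 1) = pi powr (real (?d - 1) / 2)"
      by (simp add: powr_half_sqrt[symmetric] powr_realpow[symmetric] powr_powr)
    then have "unit_ball_vol (real (?d - 1)) = sqrt pi ^ (?d - 1) / Gamma ?k"
      by (simp only: unit_ball_vol_def k)
    also have "\<dots> = (a * ?k * Gamma ?k) / Gamma ?k" by (simp only: eq)
    also have "\<dots> = a * ?k" by (rule nonzero_mult_div_cancel_right) (use G in linarith)
    finally have "unit_ball_vol (real (?d - 1)) = a * ?k" .
    then show ?thesis by simp
  qed
  have "(\<integral>\<^sup>+z. F (norm z) * h z \<partial>lborel) = (\<integral>\<^sup>+z. F (norm z powr 1) * h z \<partial>lborel)" by simp
  also have "\<dots> = (\<integral>\<^sup>+t. indicator {0<..} t * (F t * ennreal (a * (real ?d + 1) * t powr ((real ?d + 1) - 1))) \<partial>lborel)"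
    by (rule nn_integral_homogeneous[OF _ _ hom a]) auto
  also have "\<dots> = (\<integral>\<^sup>+t. ennreal (2 * unit_ball_vol (real (?d - 1))) * (indicator {0<..} t * (F t * ennreal (t ^ ?d))) \<partial>lborel)"
    by (intro nn_integral_cong) (auto simp: val indicator_def powr_realpow ennreal_mult mult_ac)
  also have "\<dots> = ennreal (2 * unit_ball_vol (real (?d - 1))) * (\<integral>\<^sup>+t. indicator {0<..} t * (F t * ennreal (t ^ ?d)) \<partial>lborel)"
    by (rule nn_integral_cmult) auto
  finally show ?thesis unfolding 1 h_def by (simp add: ennreal_mult mult_ac)
qed

subsection \<open>Radial integrals of the kernel\<close>

text \<open>What remains of the radial integral up to \<open>\<rho>\<close> once
  \<open>sigma\<close> is taken off; it does not depend on \<open>r\<close>. The plateau appears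
  here only for s = 1, where it contributes the constant 1/(d+1); for s > 1 its contribution is of
  leading order and belongs to \<open>sigma\<close>.\<close>

definition radial_const :: "nat \<Rightarrow> real \<Rightarrow> real \<Rightarrow> real" where
  "radial_const d s \<rho> = (if s = 1 then ln \<rho> + 1 / (real d + 1) else - (\<rho> powr (1 - s) / (s - 1)))"

lemma kern_nonneg [simp]: "0 \<le> kern d s r t"
  by (simp add: kern_def)

lemma borel_measurable_kern [measurable]: "kern d s r \<in> borel_measurable borel"
  unfolding kern_def by measurable

lemma kern_le: "0 < r \<Longrightarrow> 0 \<le> s \<Longrightarrow> kern d s r t \<le> r powr (- real d - s)"
  unfolding kern_def by (auto intro!: powr_mono2')

text \<open>The integral is split at t = r, and above r the integrand is t^(-s). The bound
  \<open>r < 1\<close> turns |ln r| into - ln r. Being an identity, this leaves the replacement of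
  shift differences by gradients as the only source of error near the origin.\<close>

lemma nn_integral_kern_radial:
  assumes r: "0 < r" "r < \<rho>" "r < 1" and s: "s \<ge> 1"
  shows "(\<integral>\<^sup>+t. indicator {0<..} t * (ennreal (indicator {..<\<rho>} t * kern d s r t) * ennreal (t ^ d)) \<partial>lborel)
      = ennreal (sigma d s r + radial_const d s \<rho>)"
proof -
  let ?f = "\<lambda>t. kern d s r t * t ^ d"
  have rr: "r powr (- real d - s) * r ^ Suc d = r powr (1 - s)"
    using r by (simp add: powr_realpow[symmetric] powr_add[symmetric] del: power_Suc)
  have "((\<lambda>t. t ^ d) has_integral (r ^ Suc d / real (Suc d) - 0 ^ Suc d / real (Suc d))) {0..r}"
  proof (rule fundamental_theorem_of_calculus)
    fix x :: real
    show "((\<lambda>x. x ^ Suc d / real (Suc d)) has_vector_derivative x ^ d) (at x within {0..r})"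
      unfolding has_real_derivative_iff_has_vector_derivative[symmetric]
      by (auto intro!: derivative_eq_intros simp del: power_Suc of_nat_Suc)
  qed (use r in simp)
  then have "((\<lambda>t. r powr (- real d - s) * t ^ d) has_integral (r powr (- real d - s) * (r ^ Suc d / real (Suc d) - 0 ^ Suc d / real (Suc d)))) {0..r}"
    by (rule has_integral_mult_right)
  then have "((\<lambda>t. r powr (- real d - s) * t ^ d) has_integral (r powr (1 - s) / (real d + 1))) {0..r}"
    using rr by (simp add: field_simps)
  then have 1: "(?f has_integral (r powr (1 - s) / (real d + 1))) {0..r}"
    by (rule has_integral_eq[rotated]) (auto simp: kern_def)
  \<comment> \<open>An antiderivative of t^(-s), which has a different form at s = 1.\<close>
  define G where "G x = (if s = 1 then ln x else - (x powr (1 - s) / (s - 1)))" for x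
  have "((\<lambda>t. t powr (- s)) has_integral (G \<rho> - G r)) {r..\<rho>}"
  proof (rule fundamental_theorem_of_calculus)
    fix x assume x: "x \<in> {r..\<rho>}"
    then have "x > 0" using r by auto
    have "(G has_real_derivative x powr (- s)) (at x within {r..\<rho>})"
    proof (cases "s = 1")
      case True
      then show ?thesis using \<open>x > 0\<close> unfolding G_def
        by (auto intro!: derivative_eq_intros simp: powr_minus field_simps)
    next
      case False
      have "((\<lambda>x. (- 1 / (s - 1)) * x powr (1 - s)) has_real_derivative (- 1 / (s - 1)) * ((1 - s) * x powr (1 - s - 1))) (at x within {r..\<rho>})"
        by (intro DERIV_cmult has_field_derivative_at_within[OF has_real_derivative_powr] \<open>x > 0\<close>)
      moreover have "(- 1 / (s - 1)) * ((1 - s) * x powr (1 - s - 1)) = x powr (- s)"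
        using False by (simp add: field_simps)
      ultimately show ?thesis using False by (simp add: G_def[abs_def])
    qed
    then show "(G has_vector_derivative x powr (- s)) (at x within {r..\<rho>})"
      by (simp add: has_real_derivative_iff_has_vector_derivative)
  qed (use r in simp)
  then have 2: "(?f has_integral (G \<rho> - G r)) {r..\<rho>}"
  proof (rule has_integral_eq[rotated])
    fix x assume "x \<in> {r..\<rho>}"
    then have x: "x \<ge> r" "x > 0" using r by auto
    then have "kern d s r x = x powr (- real d - s)" by (auto simp: kern_def)
    moreover have "x powr (- real d - s) * x ^ d = x powr (-s)"
      using x by (simp add: powr_realpow[symmetric] powr_add[symmetric])
    ultimately show "x powr (-s) = ?f x" by simp
  qed
  have "(?f has_integral (r powr (1 - s) / (real d + 1) + (G \<rho> - G r))) {0..\<rho>}"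
    using has_integral_combine[OF _ _ 1 2] r by simp
  moreover have "r powr (1 - s) / (real d + 1) + (G \<rho> - G r) = sigma d s r + radial_const d s \<rho>"
  proof (cases "s = 1")
    case True
    then show ?thesis using r by (simp add: G_def sigma_def radial_const_def abs_if)
  next
    case False
    then have "s - 1 > 0" using s by simp
    have "1 / (real d + 1) + 1 / (s - 1) = (real d + s) / ((real d + 1) * (s - 1))"
      using \<open>s - 1 > 0\<close> by (simp add: field_simps)
    then have "r powr (1 - s) * (1 / (real d + 1) + 1 / (s - 1)) = r powr (1 - s) * ((real d + s) / ((real d + 1) * (s - 1)))" by simp
    then show ?thesis using False by (simp add: G_def sigma_def radial_const_def algebra_simps)
  qed
  ultimately have "(?f has_integral (sigma d s r + radial_const d s \<rho>)) {0..\<rho>}" by simp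
  then have "(\<integral>\<^sup>+t. ennreal (?f t) * indicator {0..\<rho>} t \<partial>lborel) = ennreal (sigma d s r + radial_const d s \<rho>)"
    by (intro nn_integral_has_integral_lebesgue') auto
  moreover have "(\<integral>\<^sup>+t. ennreal (?f t) * indicator {0..\<rho>} t \<partial>lborel)
     = (\<integral>\<^sup>+t. indicator {0<..} t * (ennreal (indicator {..<\<rho>} t * kern d s r t) * ennreal (t ^ d)) \<partial>lborel)"
    using AE_lborel_singleton[of 0] AE_lborel_singleton[of \<rho>]
    by (intro nn_integral_cong_AE, eventually_elim) (auto simp: indicator_def ennreal_mult)
  ultimately show ?thesis by simp
qed

lemma nn_integral_kern_inner:
  fixes e :: "'a::euclidean_space"
  assumes r: "0 < r" "r < \<rho>" "r < 1" and s: "s \<ge> 1"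
  shows "(\<integral>\<^sup>+z. ennreal (indicator {..<\<rho>} (norm z) * kern DIM('a) s r (norm z)) * ennreal \<bar>z \<bullet> e\<bar> \<partial>lborel)
     = ennreal (2 * unit_ball_vol (real (DIM('a) - 1)) * norm e) * ennreal (sigma DIM('a) s r + radial_const DIM('a) s \<rho>)"
  unfolding nn_integral_kern_radial[OF assms, symmetric]
  by (rule nn_integral_norm_inner[of "\<lambda>t. ennreal (indicator {..<\<rho>} t * kern DIM('a) s r t)"]) measurable

lemma nn_integral_kern_norm_le:
  assumes r: "0 < r" "r < \<rho>" "r < 1" and s: "s \<ge> 1"
  shows "(\<integral>\<^sup>+(z::'a::euclidean_space). ennreal (indicator {..<\<rho>} (norm z) * kern DIM('a) s r (norm z)) * ennreal (norm z) \<partial>lborel)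
     \<le> ennreal (2 * unit_ball_vol (real (DIM('a) - 1)) * real DIM('a)) * ennreal (sigma DIM('a) s r + radial_const DIM('a) s \<rho>)"
proof -
  let ?F = "\<lambda>z::'a. ennreal (indicator {..<\<rho>} (norm z) * kern DIM('a) s r (norm z))"
  have "(\<integral>\<^sup>+z. ?F z * ennreal (norm z) \<partial>lborel) \<le> (\<integral>\<^sup>+z. (\<Sum>b\<in>Basis. ?F z * ennreal \<bar>z \<bullet> b\<bar>) \<partial>lborel)"
  proof (rule nn_integral_mono)
    fix z :: 'a
    have "ennreal (norm z) \<le> (\<Sum>b\<in>Basis. ennreal \<bar>z \<bullet> b\<bar>)"
      using norm_le_l1[of z] by (simp add: sum_ennreal ennreal_leI)
    then show "?F z * ennreal (norm z) \<le> (\<Sum>b\<in>Basis. ?F z * ennreal \<bar>z \<bullet> b\<bar>)"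
      by (simp add: sum_distrib_left[symmetric] mult_left_mono)
  qed
  also have "\<dots> = (\<Sum>b\<in>Basis. \<integral>\<^sup>+z. ?F z * ennreal \<bar>z \<bullet> b\<bar> \<partial>lborel)"
    by (rule nn_integral_sum) measurable
  also have "\<dots> = (\<Sum>(b::'a)\<in>Basis. ennreal (2 * unit_ball_vol (real (DIM('a) - 1))) * ennreal (sigma DIM('a) s r + radial_const DIM('a) s \<rho>))"
    by (intro sum.cong refl) (simp add: nn_integral_kern_inner[OF assms])
  also have "\<dots> = ennreal (2 * unit_ball_vol (real (DIM('a) - 1)) * real DIM('a)) * ennreal (sigma DIM('a) s r + radial_const DIM('a) s \<rho>)"
    by (simp add: ennreal_mult ennreal_of_nat_eq_real_of_nat mult_ac)
  finally show ?thesis .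
qed

text \<open>For \<open>r < 1\<close> the plateau lies inside the unit ball, so this mass is the same
  for all such \<open>r\<close> and vanishes after division by \<open>sigma\<close>.\<close>

lemma nn_integral_kern_tail:
  assumes r: "0 < r" "r < 1" and s: "s \<ge> 1"
  shows "(\<integral>\<^sup>+(z::'a::euclidean_space). ennreal (indicator {1..} (norm z) * kern DIM('a) s r (norm z)) \<partial>lborel)
     = ennreal (unit_ball_vol (real DIM('a)) * real DIM('a) / s)"
proof -
  let ?d = "DIM('a)"
  let ?F = "\<lambda>t. ennreal (indicator {1..} t * kern ?d s r t)"
  let ?a = "unit_ball_vol (real ?d)"
  have ball: "(\<integral>\<^sup>+(z::'a). indicator (ball 0 1) z * 1 \<partial>lborel) = ennreal ?a"
    by (simp add: emeasure_ball)
  have "(\<integral>\<^sup>+(z::'a). ?F (norm z) \<partial>lborel) = (\<integral>\<^sup>+(z::'a). ?F (norm z powr 1) * 1 \<partial>lborel)" by simp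
  also have "\<dots> = (\<integral>\<^sup>+t. indicator {0<..} t * (?F t * ennreal (?a * real ?d * t powr (real ?d - 1))) \<partial>lborel)"
    by (rule nn_integral_homogeneous[where m = 0, OF _ _ _ ball]) auto
  also have "\<dots> = (\<integral>\<^sup>+t. ennreal (?a * real ?d * t powr (- s - 1)) * indicator {1..} t \<partial>lborel)"
  proof (intro nn_integral_cong)
    fix t :: real
    show "indicator {0<..} t * (?F t * ennreal (?a * real ?d * t powr (real ?d - 1))) = ennreal (?a * real ?d * t powr (- s - 1)) * indicator {1..} t"
    proof (cases "t \<ge> 1")
      case True
      have "kern ?d s r t * t powr (real ?d - 1) = t powr (- s - 1)"
        using True r by (simp add: kern_def powr_add[symmetric])
      then have "kern ?d s r t * (?a * real ?d * t powr (real ?d - 1)) = ?a * real ?d * t powr (- s - 1)"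
        by (simp add: mult_ac)
      then show ?thesis using True by (simp add: ennreal_mult'[symmetric])
    qed (simp add: indicator_def)
  qed
  also have "\<dots> = ennreal (0 - (- (?a * real ?d * 1 powr (- s) / s)))"
  proof (rule nn_integral_FTC_atLeast)
    have "((\<lambda>t. (- (?a * real ?d) / s) * t powr (- s)) \<longlongrightarrow> (- (?a * real ?d) / s) * 0) at_top"
      using s by (intro tendsto_mult tendsto_const tendsto_neg_powr filterlim_ident) auto
    then show "((\<lambda>t. - (?a * real ?d * t powr (- s) / s)) \<longlongrightarrow> 0) at_top"
      by simp
    show "((\<lambda>t. - (?a * real ?d * t powr (- s) / s)) has_real_derivative ?a * real ?d * t powr (- s - 1)) (at t)" if "1 \<le> t" for t
    proof -
      have "((\<lambda>t. (- (?a * real ?d) / s) * t powr (- s)) has_real_derivative (- (?a * real ?d) / s) * (- s * t powr (- s - 1))) (at t)"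
        using that by (intro DERIV_cmult has_real_derivative_powr) simp
      then show ?thesis using s by (simp add: mult.assoc)
    qed
  qed (auto simp: s)
  finally show ?thesis by simp
qed

text \<open>The truncation makes the kernel integrable for each fixed \<open>r\<close>, though not
  uniformly. It is used in \<open>Jt_upper\<close>, where an absolute error is sent to 0 while
  \<open>r\<close> stays fixed.\<close>

lemma nn_integral_kern_finite:
  assumes r: "0 < r" "r < 1" and s: "s \<ge> 1"
  shows "(\<integral>\<^sup>+(z::'a::euclidean_space). ennreal (kern DIM('a) s r (norm z)) \<partial>lborel) < \<infinity>"
proof -
  let ?d = "DIM('a)"
  have "(\<integral>\<^sup>+(z::'a). ennreal (kern ?d s r (norm z)) \<partial>lborel)
     \<le> (\<integral>\<^sup>+(z::'a). ennreal (r powr (- real ?d - s)) * indicator (ball 0 1) z + ennreal (indicator {1..} (norm z) * kern ?d s r (norm z)) \<partial>lborel)"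
    using kern_le[of r s ?d] r s by (intro nn_integral_mono) (auto simp: indicator_def intro!: ennreal_leI)
  also have "\<dots> = ennreal (r powr (- real ?d - s)) * emeasure lborel (ball (0::'a) 1) + ennreal (unit_ball_vol (real DIM('a)) * real DIM('a) / s)"
    by (subst nn_integral_add) (auto simp: nn_integral_cmult nn_integral_kern_tail[OF assms])
  also have "\<dots> < \<infinity>" by (simp add: emeasure_ball ennreal_mult_less_top)
  finally show ?thesis .
qed

lemma filterlim_sigma_at_top:
  assumes "s \<ge> 1"
  shows "filterlim (sigma d s) at_top (at_right 0)"
proof (cases "s = 1")
  case True
  have "filterlim (\<lambda>r::real. - ln r) at_top (at_right 0)"
    using ln_at_0 by (simp add: filterlim_uminus_at_top)
  moreover have "eventually (\<lambda>r::real. - ln r = sigma d s r) (at_right 0)"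
    using eventually_at_right_less[of 0] eventually_at_right_real[of 0 1]
    by (auto elim!: eventually_mono simp: sigma_def True abs_if)
  ultimately show ?thesis by (rule filterlim_cong[OF refl refl, THEN iffD1, rotated])
next
  case False
  with assms have s: "s > 1" by simp
  have "filterlim (\<lambda>r::real. (s - 1) * - ln r) at_top (at_right 0)"
    using ln_at_0 s by (intro filterlim_tendsto_pos_mult_at_top[OF tendsto_const]) (auto simp: filterlim_uminus_at_top)
  then have "filterlim (\<lambda>r::real. exp ((s - 1) * - ln r)) at_top (at_right 0)"
    by (rule filterlim_compose[OF exp_at_top])
  then have "filterlim (\<lambda>r. (real d + s) / ((real d + 1) * (s - 1)) * exp ((s - 1) * - ln r)) at_top (at_right 0)"
    using s by (intro filterlim_tendsto_pos_mult_at_top[OF tendsto_const]) auto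
  moreover have "eventually (\<lambda>r. (real d + s) / ((real d + 1) * (s - 1)) * exp ((s - 1) * - ln r) = sigma d s r) (at_right 0)"
    using eventually_at_right_less[of 0]
    by (rule eventually_mono) (use s in \<open>auto simp: sigma_def powr_def algebra_simps\<close>)
  ultimately show ?thesis by (rule filterlim_cong[OF refl refl, THEN iffD1, rotated])
qed

subsection \<open>Convolution with compactly supported kernels\<close>

definition Cc :: "('a::euclidean_space \<Rightarrow> 'b::euclidean_space) \<Rightarrow> bool" where
  "Cc K \<longleftrightarrow> continuous_on UNIV K \<and> (\<exists>R. \<forall>x. R \<le> norm x \<longrightarrow> K x = 0)"

text \<open>The gradient is an explicit argument, so that \<open>convol g\<close> is again a
  convolution; by \<open>convol_has_derivative\<close> it is the gradient of
  \<open>convol \<eta>\<close>.\<close>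

definition C1_kernel :: "('a::euclidean_space \<Rightarrow> real) \<Rightarrow> ('a \<Rightarrow> 'a) \<Rightarrow> bool" where
  "C1_kernel \<eta> g \<longleftrightarrow> Cc \<eta> \<and> Cc g \<and> (\<forall>x. (\<eta> has_derivative (\<lambda>v. g x \<bullet> v)) (at x))"

text \<open>The density is scalar while the kernel may be vector-valued: one operator serves for a
  mollifier and for its gradient.\<close>

definition convol :: "('a::euclidean_space \<Rightarrow> 'b::euclidean_space) \<Rightarrow> ('a \<Rightarrow> real) \<Rightarrow> 'a \<Rightarrow> 'b" where
  "convol K h x = (\<integral>y. h y *\<^sub>R K (x - y) \<partial>lborel)"

lemma integral_lborel_reflect:
  fixes f :: "'a::euclidean_space \<Rightarrow> 'b::euclidean_space"
  assumes [measurable]: "f \<in> borel_measurable borel"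
  shows "(\<integral>x. f (t - x) \<partial>lborel) = (\<integral>x. f x \<partial>lborel)"
proof -
  have "distr lborel borel (\<lambda>x. t - x) = (lborel :: 'a measure)"
    using lborel_affine[of "-1" t] by (simp add: density_1)
  then show ?thesis using integral_distr[of "\<lambda>x. t - x" lborel borel f] by simp
qed

lemma integral_lborel_shift:
  fixes f :: "'a::euclidean_space \<Rightarrow> 'b::euclidean_space"
  assumes [measurable]: "f \<in> borel_measurable borel"
  shows "(\<integral>x. f (t + x) \<partial>lborel) = (\<integral>x. f x \<partial>lborel)"
proof -
  have "distr lborel borel (\<lambda>x. t + x) = (lborel :: 'a measure)"
    using lborel_affine[of 1 t] by (simp add: density_1)
  then show ?thesis using integral_distr[of "\<lambda>x. t + x" lborel borel f] by simp
qed

lemma integrable_lborel_shift: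
  fixes f :: "'a::euclidean_space \<Rightarrow> 'b::euclidean_space"
  assumes "integrable lborel f"
  shows "integrable lborel (\<lambda>x. f (t + x))"
proof -
  have "distr lborel borel (\<lambda>x. t + x) = (lborel :: 'a measure)"
    using lborel_affine[of 1 t] by (simp add: density_1)
  then have "integrable (distr lborel borel (\<lambda>x. t + x)) f" using assms by simp
  then show ?thesis by (subst (asm) integrable_distr_eq) (use assms in auto)
qed

lemma Cc_measurable [measurable_dest]: "Cc K \<Longrightarrow> K \<in> borel_measurable borel"
  unfolding Cc_def by (auto intro: borel_measurable_continuous_onI)

lemma Cc_bounded:
  assumes "Cc K"
  obtains C where "C \<ge> 0" "\<And>x. norm (K x) \<le> C"
proof -
  obtain R where R: "\<And>x. R \<le> norm x \<Longrightarrow> K x = 0" and c: "continuous_on UNIV K" using assms by (auto simp: Cc_def)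
  have "compact (K ` cball 0 R)"
    by (rule compact_continuous_image) (auto intro: continuous_on_subset[OF c])
  then obtain C where C: "\<And>x. x \<in> cball 0 R \<Longrightarrow> norm (K x) \<le> C"
    using compact_imp_bounded bounded_iff by (metis image_eqI)
  show ?thesis
  proof (rule that[of "max 0 C"])
    show "norm (K x) \<le> max 0 C" for x
      using C[of x] R[of x] by (cases "norm x \<le> R") auto
  qed simp
qed

lemma Cc_uniformly_continuous:
  assumes "Cc K" "e > 0"
  obtains \<rho> where "\<rho> > 0" "\<And>x y. norm (y - x) < \<rho> \<Longrightarrow> norm (K y - K x) < e"
proof -
  obtain R where R: "\<And>x. R \<le> norm x \<Longrightarrow> K x = 0" and c: "continuous_on UNIV K" using assms by (auto simp: Cc_def)
  have "uniformly_continuous_on (cball 0 (R + 1)) K"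
    by (rule compact_uniformly_continuous) (auto intro: continuous_on_subset[OF c])
  then obtain d where d: "d > 0" "\<And>x y. x \<in> cball 0 (R+1) \<Longrightarrow> y \<in> cball 0 (R+1) \<Longrightarrow> dist y x < d \<Longrightarrow> dist (K y) (K x) < e"
    using assms(2) unfolding uniformly_continuous_on_def by metis
  show ?thesis
  proof (rule that[of "min d 1"])
    show "min d 1 > 0" using d by simp
    fix x y :: 'a assume xy: "norm (y - x) < min d 1"
    show "norm (K y - K x) < e"
    proof (cases "norm x \<le> R + 1 \<and> norm y \<le> R + 1")
      case True
      then show ?thesis using d(2)[of x y] xy by (simp add: dist_norm)
    next
      case False
      have "\<bar>norm y - norm x\<bar> < 1" using xy norm_triangle_ineq3[of y x] by linarith
      then have "R \<le> norm x" "R \<le> norm y" using False by linarith+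
      then show ?thesis using R assms(2) by simp
    qed
  qed
qed

lemma Cc_integrable:
  assumes "Cc K" shows "integrable lborel K"
proof -
  obtain R where R: "\<And>x. R \<le> norm x \<Longrightarrow> K x = 0" and c: "continuous_on UNIV K" using assms by (auto simp: Cc_def)
  have "integrable lborel (\<lambda>x. indicator (cball 0 R) x *\<^sub>R K x)"
    using borel_integrable_compact[of "cball 0 R" K] continuous_on_subset[OF c] by (simp add: set_integrable_def)
  also have "(\<lambda>x. indicator (cball 0 R) x *\<^sub>R K x) = K"
    using R by (auto simp: indicator_def fun_eq_iff)
  finally show ?thesis .
qed

lemma Cc_inner: "Cc K \<Longrightarrow> Cc (\<lambda>x. K x \<bullet> b)"
  unfolding Cc_def by (auto intro!: continuous_intros exI)

lemma convol_integrable: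
  assumes K: "Cc K" and h: "integrable lborel h"
  shows "integrable lborel (\<lambda>y. h y *\<^sub>R K (x - y))"
proof -
  obtain C where C: "C \<ge> 0" "\<And>x. norm (K x) \<le> C" using Cc_bounded[OF K] by blast
  have [measurable]: "K \<in> borel_measurable borel" using K by measurable
  have [measurable]: "h \<in> borel_measurable borel" using h by auto
  show ?thesis
  proof (rule Bochner_Integration.integrable_bound)
    show "integrable lborel (\<lambda>y. C * \<bar>h y\<bar>)" using h by auto
    show "AE y in lborel. norm (h y *\<^sub>R K (x - y)) \<le> norm (C * \<bar>h y\<bar>)"
      using mult_right_mono[OF C(2) abs_ge_zero] C(1) by (intro AE_I2) (simp add: abs_mult mult.commute)
  qed measurable
qed

lemma norm_convol_le:
  assumes K: "Cc K" and h: "integrable lborel h" and C: "\<And>x. norm (K x) \<le> C"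
  shows "norm (convol K h x) \<le> C * (\<integral>y. \<bar>h y\<bar> \<partial>lborel)"
proof -
  have "norm (convol K h x) \<le> (\<integral>y. norm (h y *\<^sub>R K (x - y)) \<partial>lborel)" unfolding convol_def by (rule integral_norm_bound)
  also have "\<dots> \<le> (\<integral>y. C * \<bar>h y\<bar> \<partial>lborel)"
  proof (rule integral_mono)
    show "integrable lborel (\<lambda>y. norm (h y *\<^sub>R K (x - y)))"
      by (rule integrable_norm) (rule convol_integrable[OF K h])
    show "norm (h y *\<^sub>R K (x - y)) \<le> C * \<bar>h y\<bar>" for y
      using mult_right_mono[OF C[of "x - y"] abs_ge_zero[of "h y"]] by (simp add: mult.commute)
  qed (use h in auto)
  finally show ?thesis by simp
qed

lemma convol_minus_translate:
  assumes K: "Cc K" and h: "integrable lborel h" and C: "\<And>y. norm (K (y + v) - K y) \<le> C"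
  shows "norm (convol K h (x + v) - convol K h x) \<le> C * (\<integral>y. \<bar>h y\<bar> \<partial>lborel)"
proof -
  have "convol K h (x + v) - convol K h x = (\<integral>y. h y *\<^sub>R K (x + v - y) - h y *\<^sub>R K (x - y) \<partial>lborel)"
    unfolding convol_def by (rule Bochner_Integration.integral_diff[symmetric]) (rule convol_integrable[OF K h])+
  also have "norm \<dots> \<le> (\<integral>y. norm (h y *\<^sub>R K (x + v - y) - h y *\<^sub>R K (x - y)) \<partial>lborel)" by (rule integral_norm_bound)
  also have "\<dots> \<le> (\<integral>y. C * \<bar>h y\<bar> \<partial>lborel)"
  proof (rule integral_mono)
    fix y
    have "norm (K (x + v - y) - K (x - y)) \<le> C" using C[of "x - y"] by (simp add: algebra_simps)
    then show "norm (h y *\<^sub>R K (x + v - y) - h y *\<^sub>R K (x - y)) \<le> C * \<bar>h y\<bar>"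
      using mult_right_mono[OF _ abs_ge_zero[of "h y"]]
      by (simp add: scaleR_diff_right[symmetric] mult.commute[of C] mult_left_mono)
  qed (use h in \<open>auto intro!: convol_integrable K\<close>)
  finally show ?thesis by simp
qed

lemma continuous_on_convol:
  assumes K: "Cc K" and h: "integrable lborel h"
  shows "continuous_on UNIV (convol K h)"
proof (rule continuous_onI)
  fix x :: 'a and e :: real assume e: "e > 0"
  define I where "I = (\<integral>y. \<bar>h y\<bar> \<partial>lborel)"
  have I: "I \<ge> 0" by (simp add: I_def)
  obtain \<rho> where \<rho>: "\<rho> > 0" "\<And>x y. norm (y - x) < \<rho> \<Longrightarrow> norm (K y - K x) < e / (I + 1)"
    using Cc_uniformly_continuous[OF K, of "e / (I + 1)"] e I by (metis add_nonneg_pos divide_pos_pos zero_less_one)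
  show "\<exists>d>0. \<forall>x'\<in>UNIV. dist x' x < d \<longrightarrow> dist (convol K h x') (convol K h x) \<le> e"
  proof (intro exI[of _ \<rho>] conjI ballI impI)
    fix x' assume "dist x' x < \<rho>"
    then have "norm (K (y + (x' - x)) - K y) \<le> e / (I + 1)" for y
      using \<rho>(2)[of "y + (x' - x)" y] by (simp add: dist_norm less_imp_le)
    from convol_minus_translate[OF K h this, of x] have "dist (convol K h x') (convol K h x) \<le> e / (I + 1) * I"
      by (simp add: dist_norm I_def)
    also have "\<dots> \<le> e" using e I by (simp add: field_simps)
    finally show "dist (convol K h x') (convol K h x) \<le> e" .
  qed (use \<rho> in simp)
qed

lemma convol_measurable: "Cc K \<Longrightarrow> integrable lborel h \<Longrightarrow> convol K h \<in> borel_measurable borel"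
  by (rule borel_measurable_continuous_onI[OF continuous_on_convol])

lemma convol_inner:
  assumes "Cc K" "integrable lborel h"
  shows "convol K h x \<bullet> b = convol (\<lambda>x. K x \<bullet> b) h x"
  unfolding convol_def
  by (subst integral_inner_left[symmetric]) (auto intro!: convol_integrable assms)

lemma convol_diff:
  assumes "Cc K" "integrable lborel h" "integrable lborel h'"
  shows "convol K (\<lambda>y. h y - h' y) x = convol K h x - convol K h' x"
  unfolding convol_def by (subst Bochner_Integration.integral_diff[symmetric])
     (auto intro!: convol_integrable assms simp: scaleR_diff_left)

lemma convol_scale: "convol K (\<lambda>y. c * h y) x = c *\<^sub>R convol K h x"
  unfolding convol_def by (simp flip: integral_scaleR_right)

lemma convol_sum:
  assumes "Cc K" "\<And>i. i \<in> I \<Longrightarrow> integrable lborel (h i)"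
  shows "convol K (\<lambda>y. \<Sum>i\<in>I. h i y) x = (\<Sum>i\<in>I. convol K (h i) x)"
  unfolding convol_def by (subst Bochner_Integration.integral_sum[symmetric])
     (auto intro!: convol_integrable assms simp: scaleR_sum_left)

lemma convol_eq_0:
  assumes "\<And>x. R \<le> norm x \<Longrightarrow> K x = 0" "\<And>x. L < norm x \<Longrightarrow> h x = 0" "norm x \<ge> L + R"
  shows "convol K h x = 0"
proof -
  have "h y *\<^sub>R K (x - y) = 0" for y
  proof (cases "L < norm y")
    case False
    then have "R \<le> norm (x - y)" using assms(3) norm_triangle_ineq2[of x y] by linarith
    then show ?thesis using assms(1) by simp
  qed (simp add: assms(2))
  then have "(\<lambda>y. h y *\<^sub>R K (x - y)) = (\<lambda>_. 0)" by blast
  then show ?thesis by (simp only: convol_def integral_zero)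
qed

lemma convol_shift:
  assumes "Cc K" "integrable lborel h"
  shows "convol K h (x + z) = convol K (\<lambda>y. h (z + y)) x"
proof -
  have [measurable]: "K \<in> borel_measurable borel" using assms by measurable
  have [measurable]: "h \<in> borel_measurable borel" using assms by auto
  have "convol K (\<lambda>y. h (z + y)) x = (\<integral>y. (\<lambda>y. h y *\<^sub>R K (x + z - y)) (z + y) \<partial>lborel)"
    unfolding convol_def by (simp add: algebra_simps)
  also have "\<dots> = convol K h (x + z)" unfolding convol_def by (rule integral_lborel_shift) measurable
  finally show ?thesis ..
qed

lemma convol_commute:
  fixes K h :: "'a::euclidean_space \<Rightarrow> real"
  assumes "Cc K" "Cc h"
  shows "convol K h x = convol h K x"
proof -
  have [measurable]: "K \<in> borel_measurable borel" "h \<in> borel_measurable borel" using assms by measurable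
  have "convol K h x = (\<integral>y. (\<lambda>y. K y *\<^sub>R h (x - y)) (x - y) \<partial>lborel)" unfolding convol_def by (simp add: mult.commute)
  also have "\<dots> = convol h K x" unfolding convol_def by (rule integral_lborel_reflect) measurable
  finally show ?thesis .
qed

text \<open>Mean value inequality for \<open>\<eta> (x + w) - g x \<bullet> w\<close> as a function
  of \<open>w\<close>: its derivative is \<open>g (x + w) - g x\<close>, small uniformly in
  \<open>x\<close> because \<open>g\<close> is uniformly continuous.\<close>

lemma C1_kernel_uniform:
  assumes "C1_kernel \<eta> g" "e > 0"
  obtains \<rho> where "\<rho> > 0" "\<And>x v. norm v < \<rho> \<Longrightarrow> \<bar>\<eta> (x + v) - \<eta> x - g x \<bullet> v\<bar> \<le> e * norm v"
proof -
  have \<eta>: "(\<eta> has_derivative (\<lambda>v. g x \<bullet> v)) (at x)" for x using assms by (simp add: C1_kernel_def)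
  obtain \<rho> where \<rho>: "\<rho> > 0" "\<And>x y. norm (y - x) < \<rho> \<Longrightarrow> norm (g y - g x) < e"
    using Cc_uniformly_continuous[of g e] assms unfolding C1_kernel_def by metis
  show ?thesis
  proof (rule that[OF \<rho>(1)])
    fix x v :: 'a assume v: "norm v < \<rho>"
    define f where "f w = \<eta> (x + w) - g x \<bullet> w" for w
    have der: "(f has_derivative (\<lambda>u. (g (x + w) - g x) \<bullet> u)) (at w within ball 0 \<rho>)" for w
    proof -
      have "((\<lambda>w. \<eta> (x + w)) has_derivative (\<lambda>u. g (x + w) \<bullet> u)) (at w within ball 0 \<rho>)"
        by (rule has_derivative_compose[OF _ \<eta>]) (auto intro!: derivative_eq_intros)
      then show ?thesis unfolding f_def
        by (auto intro!: derivative_eq_intros simp: inner_diff_left)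
    qed
    have "norm (f v - f 0) \<le> e * norm (v - 0)"
    proof (rule differentiable_bound[OF convex_ball der])
      fix w :: 'a assume "w \<in> ball 0 \<rho>"
      then have "norm (g (x + w) - g x) < e" using \<rho>(2)[of "x + w" x] by simp
      then show "onorm (\<lambda>u. (g (x + w) - g x) \<bullet> u) \<le> e"
      proof (intro onorm_le)
        fix u
        have "norm ((g (x + w) - g x) \<bullet> u) \<le> norm (g (x + w) - g x) * norm u"
          by (simp add: Cauchy_Schwarz_ineq2)
        also have "\<dots> \<le> e * norm u" using \<open>norm (g (x + w) - g x) < e\<close> by (intro mult_right_mono) auto
        finally show "norm ((g (x + w) - g x) \<bullet> u) \<le> e * norm u" .
      qed
    qed (use v \<rho>(1) in auto)
    then show "\<bar>\<eta> (x + v) - \<eta> x - g x \<bullet> v\<bar> \<le> e * norm v" by (simp add: f_def algebra_simps)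
  qed
qed

lemma convol_remainder:
  assumes k: "C1_kernel \<eta> g" and h: "integrable lborel h"
    and C: "\<And>x. \<bar>\<eta> (x + v) - \<eta> x - g x \<bullet> v\<bar> \<le> C"
  shows "\<bar>convol \<eta> h (x + v) - convol \<eta> h x - convol g h x \<bullet> v\<bar> \<le> C * (\<integral>y. \<bar>h y\<bar> \<partial>lborel)"
proof -
  have cc: "Cc \<eta>" "Cc g" using k by (auto simp: C1_kernel_def)
  note I = convol_integrable[OF cc(1) h] convol_integrable[OF Cc_inner[OF cc(2)] h]
  let ?F = "\<lambda>y. h y *\<^sub>R \<eta> (x + v - y) - h y *\<^sub>R \<eta> (x - y) - h y *\<^sub>R (g (x - y) \<bullet> v)"
  have iF: "integrable lborel ?F" using I[of "x + v"] I[of x] by (intro Bochner_Integration.integrable_diff) auto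
  have eq: "convol \<eta> h (x + v) - convol \<eta> h x - convol g h x \<bullet> v = (\<integral>y. ?F y \<partial>lborel)"
    unfolding convol_inner[OF cc(2) h] using I[of "x + v"] I[of x] unfolding convol_def
    by (simp add: Bochner_Integration.integral_diff)
  have "\<bar>\<integral>y. ?F y \<partial>lborel\<bar> \<le> (\<integral>y. norm (?F y) \<partial>lborel)" using integral_norm_bound[of lborel ?F] by simp
  also have "\<dots> \<le> (\<integral>y. C * \<bar>h y\<bar> \<partial>lborel)"
  proof (rule integral_mono)
    fix y
    have "x + v - y = x - y + v" by simp
    then have F: "?F y = h y * (\<eta> (x - y + v) - \<eta> (x - y) - g (x - y) \<bullet> v)"
      by (simp only: real_scaleR_def right_diff_distrib)
    have "norm (?F y) = \<bar>\<eta> (x - y + v) - \<eta> (x - y) - g (x - y) \<bullet> v\<bar> * \<bar>h y\<bar>"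
      unfolding F real_norm_def abs_mult by (rule mult.commute)
    also have "\<dots> \<le> C * \<bar>h y\<bar>" by (rule mult_right_mono[OF C abs_ge_zero])
    finally show "norm (?F y) \<le> C * \<bar>h y\<bar>" .
  next
    show "integrable lborel (\<lambda>y. norm (?F y))" by (rule integrable_norm[OF iF])
    show "integrable lborel (\<lambda>y. C * \<bar>h y\<bar>)" using h by simp
  qed
  finally show ?thesis unfolding eq by simp
qed

text \<open>The radius depends on the kernel and on \<open>e\<close> alone, because the Taylor
  remainder of the kernel is integrated against |h|. This uniformity in \<open>h\<close> allows the
  sets in the lower bound to change with \<open>r\<close>.\<close>

lemma convol_uniform_differentiable:
  assumes k: "C1_kernel \<eta> g" and e: "e > 0"
  obtains \<rho> where "\<rho> > 0"
    "\<And>h x v. integrable lborel h \<Longrightarrow> norm v < \<rho> \<Longrightarrow>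
       \<bar>convol \<eta> h (x + v) - convol \<eta> h x - convol g h x \<bullet> v\<bar> \<le> e * norm v * (\<integral>y. \<bar>h y\<bar> \<partial>lborel)"
proof -
  obtain \<rho> where \<rho>: "\<rho> > 0" "\<And>x v. norm v < \<rho> \<Longrightarrow> \<bar>\<eta> (x + v) - \<eta> x - g x \<bullet> v\<bar> \<le> e * norm v"
    using C1_kernel_uniform[OF k e] by blast
  show ?thesis by (rule that[OF \<rho>(1)]) (rule convol_remainder[OF k _ \<rho>(2)])
qed

lemma convol_has_derivative:
  assumes k: "C1_kernel \<eta> g" and h: "integrable lborel h"
  shows "(convol \<eta> h has_derivative (\<lambda>v. convol g h x \<bullet> v)) (at x)"
proof (rule has_derivativeI_sandwich[of 1])
  show "bounded_linear (\<lambda>v. convol g h x \<bullet> v)" by (rule bounded_linear_inner_right)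
  define I where "I = (\<integral>y. \<bar>h y\<bar> \<partial>lborel)"
  have I: "I \<ge> 0" by (simp add: I_def)
  define Q where "Q y = norm (convol \<eta> h y - convol \<eta> h x - convol g h x \<bullet> (y - x)) / norm (y - x)" for y
  show "(Q \<longlongrightarrow> 0) (at x)"
  proof (rule tendstoI)
    fix e :: real assume e: "e > 0"
    obtain \<rho> where \<rho>: "\<rho> > 0" "\<And>h x v. integrable lborel h \<Longrightarrow> norm v < \<rho> \<Longrightarrow>
       \<bar>convol \<eta> h (x + v) - convol \<eta> h x - convol g h x \<bullet> v\<bar> \<le> e / (I + 1) * norm v * (\<integral>y. \<bar>h y\<bar> \<partial>lborel)"
      using convol_uniform_differentiable[OF k, of "e / (I + 1)"] e I by (auto simp: add_nonneg_pos)
    have "dist (Q y) 0 < e" if "y \<noteq> x" "dist y x < \<rho>" for y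
    proof -
      have n: "norm (y - x) > 0" using that by simp
      have "\<bar>convol \<eta> h (x + (y - x)) - convol \<eta> h x - convol g h x \<bullet> (y - x)\<bar> \<le> e / (I + 1) * norm (y - x) * I"
        using \<rho>(2)[OF h, of "y - x" x] that by (simp add: dist_norm I_def)
      then have "Q y \<le> e / (I + 1) * I" using n unfolding Q_def by (simp add: pos_divide_le_eq mult_ac)
      also have "\<dots> < e" using e I by (simp add: field_simps)
      finally show ?thesis by (simp add: Q_def)
    qed
    then show "eventually (\<lambda>y. dist (Q y) 0 < e) (at x)"
      unfolding eventually_at using \<rho>(1) by blast
  qed
  show "norm (convol \<eta> h y - convol \<eta> h x - convol g h x \<bullet> (y - x)) / norm (y - x) \<le> Q y" for y
    by (simp add: Q_def)
qed simp

text \<open>Fubini, with C |f x| |h y| as integrable majorant. For the partial derivatives of an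
  even mollifier, oddness supplies the minus sign of integration by parts.\<close>

lemma convol_odd_adjoint:
  fixes K :: "'a::euclidean_space \<Rightarrow> real"
  assumes K: "Cc K" and odd: "\<And>x. K (- x) = - K x" and f: "integrable lborel f" and h: "integrable lborel h"
  shows "(\<integral>x. f x * convol K h x \<partial>lborel) = - (\<integral>y. h y * convol K f y \<partial>lborel)"
proof -
  obtain C where C: "C \<ge> 0" "\<And>x. norm (K x) \<le> C" using Cc_bounded[OF K] by blast
  have [measurable]: "K \<in> borel_measurable borel" using K by measurable
  have [measurable]: "f \<in> borel_measurable borel" "h \<in> borel_measurable borel" using f h by auto
  have int: "integrable (lborel \<Otimes>\<^sub>M lborel) (\<lambda>(x, y). f x * h y * K (x - y))"
  proof (rule Bochner_Integration.integrable_bound)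
    show "integrable (lborel \<Otimes>\<^sub>M lborel) (\<lambda>(x, y). C * (f x * h y))"
    proof (rule lborel_pair.Fubini_integrable)
      show "integrable lborel (\<lambda>x. \<integral>y. norm (case (x, y) of (x, y) \<Rightarrow> C * (f x * h y)) \<partial>lborel)"
        using f by (simp add: abs_mult)
    qed (use h in auto)
    show "AE x in lborel \<Otimes>\<^sub>M lborel. norm (case x of (x, y) \<Rightarrow> f x * h y * K (x - y)) \<le> norm (case x of (x, y) \<Rightarrow> C * (f x * h y))"
    proof (rule AE_I2, clarify)
      fix x y
      have "\<bar>K (x - y)\<bar> \<le> C" using C(2)[of "x - y"] by simp
      then show "norm (f x * h y * K (x - y)) \<le> norm (C * (f x * h y))"
        using C(1) by (simp add: abs_mult mult.commute[of C] mult_left_mono)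
    qed
  qed measurable
  have "(\<integral>x. f x * convol K h x \<partial>lborel) = (\<integral>x. \<integral>y. f x * h y * K (x - y) \<partial>lborel \<partial>lborel)"
    unfolding convol_def by (simp add: mult.assoc)
  also have "\<dots> = (\<integral>y. \<integral>x. f x * h y * K (x - y) \<partial>lborel \<partial>lborel)"
    using lborel_pair.Fubini_integral[OF int] by simp
  also have "\<dots> = (\<integral>y. - (h y * convol K f y) \<partial>lborel)"
  proof (rule Bochner_Integration.integral_cong[OF refl])
    fix y
    have "K (x - y) = - K (y - x)" for x using odd[of "y - x"] by simp
    then have "(\<integral>x. f x * h y * K (x - y) \<partial>lborel) = (\<integral>x. - h y * (f x * K (y - x)) \<partial>lborel)" by (simp add: mult_ac)
    also have "\<dots> = - h y * convol K f y" unfolding convol_def by (subst integral_mult_right_zero) simp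
    finally show "(\<integral>x. f x * h y * K (x - y) \<partial>lborel) = - (h y * convol K f y)" by simp
  qed
  finally show ?thesis by simp
qed

text \<open>Young's inequality in L1, by Fubini and translation invariance.\<close>

lemma nn_integral_convol_le:
  assumes K: "Cc K" and h: "integrable lborel h"
  shows "(\<integral>\<^sup>+x. ennreal (norm (convol K h x)) \<partial>lborel) \<le> (\<integral>\<^sup>+x. ennreal (norm (K x)) \<partial>lborel) * (\<integral>\<^sup>+x. ennreal \<bar>h x\<bar> \<partial>lborel)"
proof -
  have [measurable]: "K \<in> borel_measurable borel" using K by measurable
  have [measurable]: "h \<in> borel_measurable borel" using h by auto
  have "(\<integral>\<^sup>+x. ennreal (norm (convol K h x)) \<partial>lborel) \<le> (\<integral>\<^sup>+x. (\<integral>\<^sup>+y. ennreal \<bar>h y\<bar> * ennreal (norm (K (x - y))) \<partial>lborel) \<partial>lborel)"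
  proof (rule nn_integral_mono)
    fix x
    have "ennreal (norm (convol K h x)) \<le> (\<integral>\<^sup>+y. ennreal (norm (h y *\<^sub>R K (x - y))) \<partial>lborel)"
      unfolding convol_def by (rule integral_norm_bound_ennreal) (rule convol_integrable[OF K h])
    then show "ennreal (norm (convol K h x)) \<le> (\<integral>\<^sup>+y. ennreal \<bar>h y\<bar> * ennreal (norm (K (x - y))) \<partial>lborel)"
      by (simp add: ennreal_mult)
  qed
  also have "\<dots> = (\<integral>\<^sup>+y. (\<integral>\<^sup>+x. ennreal \<bar>h y\<bar> * ennreal (norm (K (x - y))) \<partial>lborel) \<partial>lborel)"
    by (rule lborel_pair.Fubini') measurable
  also have "\<dots> = (\<integral>\<^sup>+y. ennreal \<bar>h y\<bar> * (\<integral>\<^sup>+x. ennreal (norm (K x)) \<partial>lborel) \<partial>lborel)"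
  proof (rule nn_integral_cong)
    fix y
    show "(\<integral>\<^sup>+x. ennreal \<bar>h y\<bar> * ennreal (norm (K (x - y))) \<partial>lborel) = ennreal \<bar>h y\<bar> * (\<integral>\<^sup>+x. ennreal (norm (K x)) \<partial>lborel)"
      using nn_integral_lborel_shift[of "\<lambda>x. ennreal (norm (K x))" "- y"] by (simp add: nn_integral_cmult)
  qed
  also have "\<dots> = (\<integral>\<^sup>+x. ennreal (norm (K x)) \<partial>lborel) * (\<integral>\<^sup>+x. ennreal \<bar>h x\<bar> \<partial>lborel)"
    by (simp add: nn_integral_multc mult.commute)
  finally show ?thesis .
qed

subsection \<open>Mollifiers and the perimeter\<close>

text \<open>A polynomial cut-off. Squaring the positive part makes it continuously differentiable,
  the regularity demanded of \<open>test_fields\<close>, with the explicit gradient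
  \<open>bump_grad\<close>.\<close>

definition bump :: "real \<Rightarrow> 'a::euclidean_space \<Rightarrow> real" where
  "bump \<delta> x = (max 0 (1 - (x \<bullet> x) / \<delta>\<^sup>2))\<^sup>2"

definition bump_grad :: "real \<Rightarrow> 'a::euclidean_space \<Rightarrow> 'a" where
  "bump_grad \<delta> x = (- 4 / \<delta>\<^sup>2 * max 0 (1 - (x \<bullet> x) / \<delta>\<^sup>2)) *\<^sub>R x"

definition moll :: "real \<Rightarrow> 'a::euclidean_space \<Rightarrow> real" where
  "moll \<delta> x = bump \<delta> x / (\<integral>(y::'a). bump \<delta> y \<partial>lborel)"

definition moll_grad :: "real \<Rightarrow> 'a::euclidean_space \<Rightarrow> 'a" where
  "moll_grad \<delta> x = bump_grad \<delta> x /\<^sub>R (\<integral>(y::'a). bump \<delta> y \<partial>lborel)"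

lemma DERIV_pos_part_squared: "((\<lambda>t::real. (max 0 t)\<^sup>2) has_real_derivative 2 * max 0 t) (at t)"
proof (cases "t = 0")
  case True
  have "((\<lambda>h::real. max 0 h) \<longlongrightarrow> max 0 0) (at 0)" by (intro tendsto_intros)
  then have lim: "((\<lambda>h::real. max 0 h) \<longlongrightarrow> 0) (at 0)" by simp
  \<comment> \<open>For nonzero \<open>h\<close> the difference quotient equals
    \<open>max 0 h\<close>.\<close>
  have "((\<lambda>h::real. ((max 0 (0 + h))\<^sup>2 - (max 0 0)\<^sup>2) / h) \<longlongrightarrow> 0) (at 0)"
    by (rule Lim_transform_eventually[OF lim])
       (auto simp: eventually_at max_def power2_eq_square intro!: exI[of _ 1])
  then show ?thesis using True by (simp add: DERIV_def)
next
  case False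
  show ?thesis
  proof (cases "t > 0")
    case True
    have "((\<lambda>t::real. t\<^sup>2) has_real_derivative 2 * t) (at t)" by (auto intro!: derivative_eq_intros)
    then have "((\<lambda>t::real. (max 0 t)\<^sup>2) has_real_derivative 2 * t) (at t)"
      by (rule has_field_derivative_transform_within_open[where S = "{0<..}"]) (use True in auto)
    then show ?thesis using True by simp
  next
    case f: False
    have "((\<lambda>t::real. 0) has_real_derivative 0) (at t)" by simp
    then have "((\<lambda>t::real. (max 0 t)\<^sup>2) has_real_derivative 0) (at t)"
      by (rule has_field_derivative_transform_within_open[where S = "{..<0}"]) (use False f in auto)
    then show ?thesis using False f by simp
  qed
qed

lemma bump_eq_0:
  assumes "\<delta> > 0" "\<delta> \<le> norm x"
  shows "bump \<delta> x = 0" "bump_grad \<delta> x = 0"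
proof -
  have "\<delta>\<^sup>2 \<le> x \<bullet> x" using power_mono[OF assms(2), of 2] assms(1) by (simp add: power2_norm_eq_inner)
  then have "max 0 (1 - (x \<bullet> x) / \<delta>\<^sup>2) = 0" using assms by simp
  then show "bump \<delta> x = 0" "bump_grad \<delta> x = 0" by (simp_all add: bump_def bump_grad_def)
qed

lemma bump_C1_kernel:
  assumes "\<delta> > 0" shows "C1_kernel (bump \<delta>) (bump_grad \<delta>)"
proof -
  have "Cc (bump \<delta> :: 'a \<Rightarrow> real)" unfolding Cc_def
  proof
    show "continuous_on UNIV (bump \<delta> :: 'a \<Rightarrow> real)" unfolding bump_def by (intro continuous_intros) (use assms in auto)
  qed (use bump_eq_0 assms in blast)
  moreover have "Cc (bump_grad \<delta> :: 'a \<Rightarrow> 'a)" unfolding Cc_def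
  proof
    show "continuous_on UNIV (bump_grad \<delta> :: 'a \<Rightarrow> 'a)" unfolding bump_grad_def by (intro continuous_intros) (use assms in auto)
  qed (use bump_eq_0 assms in blast)
  moreover have "(bump \<delta> has_derivative (\<lambda>v. bump_grad \<delta> x \<bullet> v)) (at x)" for x :: 'a
  proof -
    let ?q = "\<lambda>x::'a. 1 - (x \<bullet> x) / \<delta>\<^sup>2"
    have "(?q has_derivative (\<lambda>v. - (2 * (x \<bullet> v) / \<delta>\<^sup>2))) (at x)"
      using assms by (auto intro!: derivative_eq_intros simp: inner_commute field_simps)
    then have "((\<lambda>x. (max 0 (?q x))\<^sup>2) has_derivative (\<lambda>v. 2 * max 0 (?q x) * (- (2 * (x \<bullet> v) / \<delta>\<^sup>2)))) (at x)"
      by (rule has_derivative_compose[OF _ DERIV_pos_part_squared[unfolded has_field_derivative_def]])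
    moreover have "(\<lambda>v. 2 * max 0 (?q x) * (- (2 * (x \<bullet> v) / \<delta>\<^sup>2))) = (\<lambda>v. bump_grad \<delta> x \<bullet> v)"
      by (auto simp: bump_grad_def fun_eq_iff)
    moreover have "(\<lambda>x. (max 0 (?q x))\<^sup>2) = bump \<delta>" by (auto simp: bump_def fun_eq_iff)
    ultimately show ?thesis by simp
  qed
  ultimately show ?thesis by (simp add: C1_kernel_def)
qed

lemma bump_bounds: "0 \<le> bump \<delta> x" "\<delta> > 0 \<Longrightarrow> bump \<delta> x \<le> 1"
proof -
  show "0 \<le> bump \<delta> x" by (simp add: bump_def)
  assume "\<delta> > 0"
  then have "max 0 (1 - (x \<bullet> x) / \<delta>\<^sup>2) \<le> 1" by simp
  then show "bump \<delta> x \<le> 1" unfolding bump_def by (intro power_le_one) auto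
qed

text \<open>On the ball of half the radius, 1 - |y|^2/\<delta>^2 is at least 3/4, and 9/16 is its
  square. The point is the power of \<delta>, which \<open>moll_le\<close> turns into a sup bound of
  order \<delta>^(-d).\<close>

lemma bump_integral_ge:
  assumes d: "\<delta> > 0"
  shows "9/16 * (unit_ball_vol (real DIM('a)) * (\<delta>/2) ^ DIM('a)) \<le> (\<integral>(y::'a::euclidean_space). bump \<delta> y \<partial>lborel)"
proof -
  have i: "integrable lborel (bump \<delta> :: 'a \<Rightarrow> real)"
    using bump_C1_kernel[OF d, where 'a = 'a] by (intro Cc_integrable) (simp add: C1_kernel_def)
  have "9/16 * (unit_ball_vol (real DIM('a)) * (\<delta>/2) ^ DIM('a)) = (\<integral>y. 9/16 * indicator (ball 0 (\<delta>/2)) (y::'a) \<partial>lborel)"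
    using d by (simp add: content_ball)
  also have "\<dots> \<le> (\<integral>(y::'a). bump \<delta> y \<partial>lborel)"
  proof (rule integral_mono[OF _ i])
    show "integrable lborel (\<lambda>y::'a. 9/16 * indicator (ball 0 (\<delta>/2)) y :: real)"
      using d by (simp add: emeasure_ball)
    fix y :: 'a
    show "9/16 * indicator (ball 0 (\<delta>/2)) y \<le> bump \<delta> y"
    proof (cases "norm y < \<delta>/2")
      case True
      have "y \<bullet> y \<le> (\<delta>/2)\<^sup>2" using power_mono[of "norm y" "\<delta>/2" 2] True by (simp add: power2_norm_eq_inner)
      then have "3/4 \<le> 1 - (y \<bullet> y) / \<delta>\<^sup>2" using d by (simp add: field_simps power2_eq_square)
      then have "(3/4)\<^sup>2 \<le> bump \<delta> y" unfolding bump_def by (intro power_mono max.coboundedI2) auto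
      then show ?thesis using True by (simp add: power2_eq_square)
    qed (simp add: bump_bounds)
  qed
  finally show ?thesis .
qed

lemma bump_integral_pos:
  assumes d: "\<delta> > 0" shows "0 < (\<integral>(y::'a::euclidean_space). bump \<delta> y \<partial>lborel)"
  by (rule less_le_trans[OF _ bump_integral_ge[OF d]]) (use d in simp)

lemma moll_C1_kernel:
  assumes d: "\<delta> > 0" shows "C1_kernel (moll \<delta>) (moll_grad \<delta>)"
proof -
  note b = bump_C1_kernel[OF d, unfolded C1_kernel_def Cc_def]
  have "(moll \<delta> has_derivative (\<lambda>v. moll_grad \<delta> x \<bullet> v)) (at x)" for x :: 'a
  proof -
    have "((\<lambda>x::'a. inverse (\<integral>(y::'a). bump \<delta> y \<partial>lborel) *\<^sub>R bump \<delta> x) has_derivative (\<lambda>v. inverse (\<integral>(y::'a). bump \<delta> y \<partial>lborel) *\<^sub>R (bump_grad \<delta> x \<bullet> v))) (at x)"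
      by (rule has_derivative_scaleR_right) (use b in blast)
    then show ?thesis by (simp add: moll_def[abs_def] moll_grad_def divide_inverse mult.commute)
  qed
  moreover have "Cc (moll \<delta> :: 'a \<Rightarrow> real)" "Cc (moll_grad \<delta> :: 'a \<Rightarrow> 'a)"
    using b bump_integral_pos[OF d, where 'a = 'a] unfolding Cc_def moll_def[abs_def] moll_grad_def[abs_def]
    by (auto intro!: continuous_intros)
  ultimately show ?thesis by (simp add: C1_kernel_def)
qed

lemma moll_Cc: "\<delta> > 0 \<Longrightarrow> Cc (moll \<delta>)" "\<delta> > 0 \<Longrightarrow> Cc (moll_grad \<delta>)"
  using moll_C1_kernel by (auto simp: C1_kernel_def)

lemma moll_eq_0:
  assumes "\<delta> > 0" "\<delta> \<le> norm x"
  shows "moll \<delta> x = 0"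
  using bump_eq_0[OF assms] by (simp add: moll_def)

lemma moll_nonneg: "\<delta> > 0 \<Longrightarrow> 0 \<le> moll \<delta> x"
  using bump_bounds(1)[of \<delta> x] bump_integral_pos[where 'a = 'a, of \<delta>] by (simp add: moll_def)

lemma moll_grad_odd: "moll_grad \<delta> (- x) = - moll_grad \<delta> x"
  by (simp add: moll_grad_def bump_grad_def)

lemma moll_minus [simp]: "moll \<delta> (- x) = moll \<delta> x"
  by (simp add: moll_def bump_def)

lemma moll_integral: "\<delta> > 0 \<Longrightarrow> (\<integral>(x::'a::euclidean_space). moll \<delta> x \<partial>lborel) = 1"
  using bump_integral_pos[where 'a = 'a, of \<delta>] by (simp add: moll_def)

lemma moll_nn_integral: "\<delta> > 0 \<Longrightarrow> (\<integral>\<^sup>+(x::'a::euclidean_space). ennreal (moll \<delta> x) \<partial>lborel) = 1"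
  by (subst nn_integral_eq_integral) (auto simp: moll_integral moll_nonneg intro!: Cc_integrable moll_Cc)

lemma moll_le:
  assumes d: "\<delta> > 0"
  shows "moll \<delta> (x::'a::euclidean_space) \<le> 16/9 * 2 ^ DIM('a) / unit_ball_vol (real DIM('a)) / \<delta> ^ DIM('a)"
proof -
  let ?m = "9/16 * (unit_ball_vol (real DIM('a)) * (\<delta>/2) ^ DIM('a))"
  have m: "?m > 0" using d by simp
  have "moll \<delta> x \<le> 1 / ?m" unfolding moll_def
    using m bump_integral_ge[OF d, where 'a = 'a] bump_bounds[of \<delta> x] d by (intro frac_le) auto
  also have "\<dots> = 16/9 * 2 ^ DIM('a) / unit_ball_vol (real DIM('a)) / \<delta> ^ DIM('a)"
    by (simp add: power_divide)
  finally show ?thesis .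
qed

lemma integrable_convol_mult:
  assumes K: "Cc K" and f: "integrable lborel f" and h: "integrable lborel h"
  shows "integrable lborel (\<lambda>x. f x *\<^sub>R convol K h x)"
proof -
  obtain C where C: "C \<ge> 0" "\<And>x. norm (K x) \<le> C" using Cc_bounded[OF K] by blast
  have [measurable]: "convol K h \<in> borel_measurable borel" by (rule convol_measurable[OF K h])
  have [measurable]: "f \<in> borel_measurable borel" using f by auto
  show ?thesis
  proof (rule Bochner_Integration.integrable_bound)
    show "integrable lborel (\<lambda>x. (C * (\<integral>y. \<bar>h y\<bar> \<partial>lborel)) * f x)" using f by simp
    show "AE x in lborel. norm (f x *\<^sub>R convol K h x) \<le> norm ((C * (\<integral>y. \<bar>h y\<bar> \<partial>lborel)) * f x)"
      using mult_right_mono[OF norm_convol_le[OF K h C(2)] abs_ge_zero] C(1)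
      by (intro AE_I2) (simp add: abs_mult mult.commute)
  qed measurable
qed

text \<open>\<open>convol_odd_adjoint\<close> is applied in each coordinate. The sum on the left is
  the divergence of the mollified field, by \<open>moll_field_divergence\<close>; the derivative
  thus moves from the field to the set.\<close>

lemma convol_grad_pairing:
  fixes \<psi> :: "'a::euclidean_space \<Rightarrow> 'a"
  assumes d: "\<delta> > 0" and h: "integrable lborel h" and \<psi>: "\<And>b. b \<in> Basis \<Longrightarrow> integrable lborel (\<lambda>x. \<psi> x \<bullet> b)"
  shows "(\<integral>x. h x * (\<Sum>b\<in>Basis. convol (moll_grad \<delta>) (\<lambda>y. \<psi> y \<bullet> b) x \<bullet> b) \<partial>lborel)
     = - (\<integral>x. \<psi> x \<bullet> convol (moll_grad \<delta>) h x \<partial>lborel)"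
    and "integrable lborel (\<lambda>x. \<psi> x \<bullet> convol (moll_grad \<delta>) h x)"
proof -
  let ?K = "\<lambda>b x. moll_grad \<delta> x \<bullet> (b::'a)"
  have K: "Cc (?K b)" for b by (rule Cc_inner[OF moll_Cc(2)[OF d]])
  have odd: "?K b (- x) = - ?K b x" for b x by (simp add: moll_grad_odd)
  have e: "\<psi> x \<bullet> convol (moll_grad \<delta>) h x = (\<Sum>b\<in>Basis. (\<psi> x \<bullet> b) * convol (?K b) h x)" for x
    by (subst euclidean_inner) (simp add: convol_inner[OF moll_Cc(2)[OF d] h])
  have i1: "integrable lborel (\<lambda>x. (\<psi> x \<bullet> b) * convol (?K b) h x)" if "b \<in> Basis" for b
    using integrable_convol_mult[OF K \<psi>[OF that] h] by simp
  have i2: "integrable lborel (\<lambda>x. h x * convol (?K b) (\<lambda>y. \<psi> y \<bullet> b) x)" if "b \<in> Basis" for b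
    using integrable_convol_mult[OF K h \<psi>[OF that]] by simp
  show "integrable lborel (\<lambda>x. \<psi> x \<bullet> convol (moll_grad \<delta>) h x)"
    unfolding e by (rule Bochner_Integration.integrable_sum) (rule i1)
  have "(\<integral>x. h x * (\<Sum>b\<in>Basis. convol (moll_grad \<delta>) (\<lambda>y. \<psi> y \<bullet> b) x \<bullet> b) \<partial>lborel)
    = (\<integral>x. (\<Sum>b\<in>Basis. h x * convol (?K b) (\<lambda>y. \<psi> y \<bullet> b) x) \<partial>lborel)"
    by (intro Bochner_Integration.integral_cong refl)
       (simp add: sum_distrib_left convol_inner[OF moll_Cc(2)[OF d] \<psi>])
  also have "\<dots> = (\<Sum>b\<in>Basis. \<integral>x. h x * convol (?K b) (\<lambda>y. \<psi> y \<bullet> b) x \<partial>lborel)"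
    by (rule Bochner_Integration.integral_sum) (rule i2)
  also have "\<dots> = (\<Sum>b\<in>Basis. - (\<integral>x. (\<psi> x \<bullet> b) * convol (?K b) h x \<partial>lborel))"
    by (intro sum.cong refl convol_odd_adjoint K odd h \<psi>)
  also have "\<dots> = - (\<integral>x. (\<Sum>b\<in>Basis. (\<psi> x \<bullet> b) * convol (?K b) h x) \<partial>lborel)"
    by (subst Bochner_Integration.integral_sum) (auto intro: i1 simp: sum_negf)
  finally show "(\<integral>x. h x * (\<Sum>b\<in>Basis. convol (moll_grad \<delta>) (\<lambda>y. \<psi> y \<bullet> b) x \<bullet> b) \<partial>lborel)
     = - (\<integral>x. \<psi> x \<bullet> convol (moll_grad \<delta>) h x \<partial>lborel)" unfolding e .
qed

section \<open>Mollified vector fields and the total variation of mollified indicators\<close>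

text \<open>The convolution of a vector field with the scalar mollifier, taken by components because
  \<open>convol\<close> expects a scalar density.\<close>

definition moll_field :: "real \<Rightarrow> ('a::euclidean_space \<Rightarrow> 'a) \<Rightarrow> 'a \<Rightarrow> 'a" where
  "moll_field \<delta> \<psi> x = (\<Sum>b\<in>Basis. convol (moll \<delta>) (\<lambda>y. \<psi> y \<bullet> b) x *\<^sub>R b)"

text \<open>All differentiability comes from the mollifier, so a bounded measurable field of bounded
  support, such as a truncated sign field, becomes a competitor in the definition of
  \<open>Per\<close>.\<close>

lemma moll_field:
  fixes \<psi> :: "'a::euclidean_space \<Rightarrow> 'a"
  assumes d: "\<delta> > 0" and [measurable]: "\<psi> \<in> borel_measurable borel"
    and b1: "\<And>x. norm (\<psi> x) \<le> 1" and supp: "\<And>x. L < norm x \<Longrightarrow> \<psi> x = 0"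
  shows "moll_field \<delta> \<psi> \<in> test_fields"
    and moll_field_divergence: "divergence (moll_field \<delta> \<psi>) x = (\<Sum>b\<in>Basis. convol (moll_grad \<delta>) (\<lambda>y. \<psi> y \<bullet> b) x \<bullet> b)"
    and "integrable lborel (\<lambda>x. \<psi> x \<bullet> v)"
proof -
  have int: "integrable lborel (\<lambda>x. \<psi> x \<bullet> v)" for v
  proof (rule Bochner_Integration.integrable_bound)
    show "integrable lborel (\<lambda>x::'a. norm v * indicator (cball 0 L) x)"
      using emeasure_bounded_finite[of "cball (0::'a) L"] by (intro integrable_mult_right integrable_real_indicator) auto
    show "AE x in lborel. norm (\<psi> x \<bullet> v) \<le> norm (norm v * indicator (cball 0 L) x :: real)"
    proof (rule AE_I2)
      fix x
      have "norm (\<psi> x \<bullet> v) \<le> norm (\<psi> x) * norm v" by (simp add: Cauchy_Schwarz_ineq2)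
      also have "\<dots> \<le> norm v * indicator (cball 0 L) x"
        using mult_right_mono[OF b1[of x] norm_ge_zero[of v]] supp[of x] by (cases "norm x \<le> L") auto
      finally show "norm (\<psi> x \<bullet> v) \<le> norm (norm v * indicator (cball 0 L) x :: real)" by simp
    qed
  qed measurable
  then show "integrable lborel (\<lambda>x. \<psi> x \<bullet> v)" .
  let ?\<phi> = "moll_field \<delta> \<psi>"
  let ?D = "\<lambda>x v. (\<Sum>b\<in>Basis. (convol (moll_grad \<delta>) (\<lambda>y. \<psi> y \<bullet> b) x \<bullet> v) *\<^sub>R b)"
  have der: "(?\<phi> has_derivative ?D x) (at x)" for x
    unfolding moll_field_def[abs_def]
    by (intro has_derivative_sum has_derivative_scaleR_left convol_has_derivative moll_C1_kernel d int)
  have fre: "frechet_derivative ?\<phi> (at x) = ?D x" for x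
    using frechet_derivative_at[OF der] by simp
  show "divergence ?\<phi> x = (\<Sum>b\<in>Basis. convol (moll_grad \<delta>) (\<lambda>y. \<psi> y \<bullet> b) x \<bullet> b)"
    unfolding divergence_def fre
    by (intro sum.cong refl) (simp add: inner_sum_left inner_Basis if_distrib[of "\<lambda>t. _ * t"] sum.delta cong: if_cong)
  show "?\<phi> \<in> test_fields"
    unfolding test_fields_def
  proof (intro CollectI conjI allI ballI)
    show "?\<phi> differentiable at x" for x using der by (auto simp: differentiable_def)
    show "continuous_on UNIV (\<lambda>x. frechet_derivative ?\<phi> (at x) b)" for b
      unfolding fre by (intro continuous_intros continuous_on_convol moll_Cc d int)
    have z: "?\<phi> x = 0" if "norm x \<ge> L + \<delta>" for x
      unfolding moll_field_def
      by (intro sum.neutral ballI, subst convol_eq_0[where R = \<delta> and L = L]) (use that d supp moll_eq_0 in auto)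
    have "{x. ?\<phi> x \<noteq> 0} \<subseteq> cball 0 (L + \<delta>)" using z by (force simp: not_le)
    then have "bounded {x. ?\<phi> x \<noteq> 0}" using bounded_cball bounded_subset by blast
    then show "compact (closure {x. ?\<phi> x \<noteq> 0})" by (simp add: compact_closure)
    fix x
    show "norm (?\<phi> x) \<le> 1"
    proof (cases "?\<phi> x = 0")
      case False
      \<comment> \<open>Pairing with its own direction reduces the norm to a scalar convolution of
        \<open>\<psi> \<bullet> v\<close>, which is an average of numbers at most 1 because the
        mollifier is nonnegative with mass 1.\<close>
      define v where "v = ?\<phi> x /\<^sub>R norm (?\<phi> x)"
      have nv: "norm v = 1" using False by (simp add: v_def)
      have "norm (?\<phi> x) = ?\<phi> x \<bullet> v" using False by (simp add: v_def dot_square_norm power2_eq_square)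
      also have "\<dots> = (\<Sum>b\<in>Basis. (v \<bullet> b) *\<^sub>R convol (moll \<delta>) (\<lambda>y. \<psi> y \<bullet> b) x)"
        unfolding moll_field_def inner_sum_left by (intro sum.cong refl) (simp add: inner_commute[of v])
      also have "\<dots> = convol (moll \<delta>) (\<lambda>y. \<Sum>b\<in>Basis. (v \<bullet> b) * (\<psi> y \<bullet> b)) x"
        by (subst convol_sum) (auto simp: moll_Cc d int convol_scale)
      also have "(\<lambda>y. \<Sum>b\<in>Basis. (v \<bullet> b) * (\<psi> y \<bullet> b)) = (\<lambda>y. \<psi> y \<bullet> v)"
        by (subst (2) euclidean_inner) (simp add: mult.commute)
      also have "convol (moll \<delta>) (\<lambda>y. \<psi> y \<bullet> v) x = (\<integral>y. (\<psi> y \<bullet> v) * moll \<delta> (x - y) \<partial>lborel)" by (simp add: convol_def)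
      also have "\<dots> \<le> (\<integral>y. moll \<delta> (x - y) \<partial>lborel)"
      proof (rule integral_mono)
        show "integrable lborel (\<lambda>y. (\<psi> y \<bullet> v) * moll \<delta> (x - y))"
          using convol_integrable[OF moll_Cc(1)[OF d] int, of v x] by simp
        have "integrable lborel (\<lambda>y. moll \<delta> (- x + y))" by (rule integrable_lborel_shift[OF Cc_integrable[OF moll_Cc(1)[OF d]]])
        moreover have "moll \<delta> (- x + y) = moll \<delta> (x - y)" for y using moll_minus[of \<delta> "x - y"] by (simp del: moll_minus)
        ultimately show "integrable lborel (\<lambda>y. moll \<delta> (x - y))" by simp
        fix y
        have "\<psi> y \<bullet> v \<le> norm (\<psi> y) * norm v" by (rule norm_cauchy_schwarz)
        also have "\<dots> \<le> 1" using b1 nv by simp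
        finally show "(\<psi> y \<bullet> v) * moll \<delta> (x - y) \<le> moll \<delta> (x - y)"
          using mult_right_mono[OF _ moll_nonneg[OF d, of "x - y"], of "\<psi> y \<bullet> v" 1] by simp
      qed
      also have "\<dots> = 1" using integral_lborel_reflect[of "moll \<delta>" x] Cc_measurable[OF moll_Cc(1)[OF d]] by (simp add: moll_integral d)
      finally show ?thesis .
    qed simp
  qed
qed

lemma test_field_divergence_continuous: "\<phi> \<in> test_fields \<Longrightarrow> continuous_on UNIV (divergence \<phi>)"
  unfolding divergence_def[abs_def] test_fields_def by (auto intro!: continuous_intros)

lemma Per_eq_lborel:
  assumes [measurable]: "E \<in> sets borel"
  shows "Per E = (SUP \<phi>\<in>test_fields. ennreal (\<integral>x. indicator E x * divergence \<phi> x \<partial>lborel))"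
  unfolding Per_def
proof (intro SUP_cong refl arg_cong[where f = ennreal])
  fix \<phi> :: "'a \<Rightarrow> 'a" assume "\<phi> \<in> test_fields"
  then have [measurable]: "divergence \<phi> \<in> borel_measurable borel"
    by (intro borel_measurable_continuous_onI test_field_divergence_continuous)
  show "(\<integral>x. indicator E x * divergence \<phi> x \<partial>lebesgue) = (\<integral>x. indicator E x * divergence \<phi> x \<partial>lborel)"
    by (rule integral_completion) measurable
qed

text \<open>Duality: the L1 norm of \<open>W\<close> is approached by pairings with sign fields, and
  each pairing equals the integral over \<open>E\<close> of the divergence of the mollified field.
  The bound does not depend on \<delta>.\<close>

lemma nn_integral_grad_le_Per:
  fixes E :: "'a::euclidean_space set"
  assumes d: "\<delta> > 0" and [measurable]: "E \<in> sets borel" and E: "emeasure lborel E < \<infinity>"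
  shows "(\<integral>\<^sup>+x. ennreal (norm (convol (moll_grad \<delta>) (indicator E) x)) \<partial>lborel) \<le> Per E"
proof -
  define W where "W = convol (moll_grad \<delta>) (indicator E)"
  have iE: "integrable lborel (indicator E :: 'a \<Rightarrow> real)" using E by simp
  have [measurable]: "W \<in> borel_measurable borel" unfolding W_def by (rule convol_measurable[OF moll_Cc(2)[OF d] iE])
  have bd: "(\<integral>\<^sup>+x. ennreal (norm (W x)) * indicator (cball 0 (real n)) x \<partial>lborel) \<le> Per E" for n
  proof -
    \<comment> \<open>The sign field turns the pairing into the norm of \<open>W\<close>, the minus
      compensates integration by parts, and the cut-off provides the bounded support; it is removed
      afterwards by monotone convergence.\<close>
    define \<psi> where "\<psi> x = - indicator (cball 0 (real n)) x *\<^sub>R sgn (W x)" for x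
    have [measurable]: "\<psi> \<in> borel_measurable borel" unfolding \<psi>_def sgn_div_norm by measurable
    have \<psi>1: "norm (\<psi> x) \<le> 1" for x by (simp add: \<psi>_def norm_sgn indicator_def)
    have \<psi>0: "\<psi> x = 0" if "real n < norm x" for x using that by (simp add: \<psi>_def)
    note mf = moll_field[OF d \<open>\<psi> \<in> borel_measurable borel\<close> \<psi>1 \<psi>0]
    have div: "divergence (moll_field \<delta> \<psi>) x = (\<Sum>b\<in>Basis. convol (moll_grad \<delta>) (\<lambda>y. \<psi> y \<bullet> b) x \<bullet> b)" for x
      by (rule moll_field_divergence[OF d \<open>\<psi> \<in> borel_measurable borel\<close> \<psi>1 \<psi>0])
    have e: "\<psi> x \<bullet> W x = - (norm (W x) * indicator (cball 0 (real n)) x)" for x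
      by (cases "W x = 0") (auto simp: \<psi>_def sgn_div_norm dot_square_norm power2_eq_square indicator_def)
    have i: "integrable lborel (\<lambda>x. norm (W x) * indicator (cball 0 (real n)) x)"
      using convol_grad_pairing(2)[OF d iE mf(3)] unfolding W_def[symmetric] e by simp
    have "(\<integral>\<^sup>+x. ennreal (norm (W x)) * indicator (cball 0 (real n)) x \<partial>lborel)
       = (\<integral>\<^sup>+x. ennreal (norm (W x) * indicator (cball 0 (real n)) x) \<partial>lborel)"
      by (intro nn_integral_cong) (auto simp: indicator_def)
    also have "\<dots> = ennreal (\<integral>x. norm (W x) * indicator (cball 0 (real n)) x \<partial>lborel)"
      by (rule nn_integral_eq_integral[OF i]) auto
    also have "(\<integral>x. norm (W x) * indicator (cball 0 (real n)) x \<partial>lborel) = - (\<integral>x. \<psi> x \<bullet> W x \<partial>lborel)"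
      unfolding e by simp
    also have "\<dots> = (\<integral>x. indicator E x * divergence (moll_field \<delta> \<psi>) x \<partial>lborel)"
      unfolding div W_def by (rule convol_grad_pairing(1)[OF d iE mf(3), symmetric])
    also have "ennreal \<dots> \<le> Per E" unfolding Per_eq_lborel[OF \<open>E \<in> sets borel\<close>] by (rule SUP_upper[OF mf(1)])
    finally show ?thesis .
  qed
  have "(\<integral>\<^sup>+x. ennreal (norm (W x)) \<partial>lborel) = (\<integral>\<^sup>+x. (SUP n. ennreal (norm (W x)) * indicator (cball 0 (real n)) x) \<partial>lborel)"
  proof (rule nn_integral_cong)
    fix x :: 'a
    obtain n :: nat where "norm x \<le> real n" using real_arch_simple by blast
    then have "ennreal (norm (W x)) \<le> (SUP n. ennreal (norm (W x)) * indicator (cball 0 (real n)) x)"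
      by (intro SUP_upper2[of n]) auto
    moreover have "(SUP n. ennreal (norm (W x)) * indicator (cball 0 (real n)) x) \<le> ennreal (norm (W x))"
      by (intro SUP_least) (auto simp: indicator_def)
    ultimately show "ennreal (norm (W x)) = (SUP n. ennreal (norm (W x)) * indicator (cball 0 (real n)) x)" by (rule antisym)
  qed
  also have "\<dots> = (SUP n. \<integral>\<^sup>+x. ennreal (norm (W x)) * indicator (cball 0 (real n)) x \<partial>lborel)"
    by (intro nn_integral_monotone_convergence_SUP incseq_SucI le_funI mult_left_mono) (auto simp: indicator_def)
  also have "\<dots> \<le> Per E" by (intro SUP_least bd)
  finally show ?thesis by (simp add: W_def)
qed

section \<open>Recovering the perimeter from mollified gradients\<close>

text \<open>The gradient of the scalar component in direction \<open>b\<close>, assembled from the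
  values of the derivative on the basis. It is the second argument that \<open>C1_kernel\<close>
  expects.\<close>

definition component_grad :: "('a::euclidean_space \<Rightarrow> 'a) \<Rightarrow> 'a \<Rightarrow> 'a \<Rightarrow> 'a" where
  "component_grad \<phi> b x = (\<Sum>i\<in>Basis. (frechet_derivative \<phi> (at x) i \<bullet> b) *\<^sub>R i)"

lemma component_grad_inner: "b \<in> Basis \<Longrightarrow> component_grad \<phi> b x \<bullet> b = frechet_derivative \<phi> (at x) b \<bullet> b"
  by (simp add: component_grad_def inner_sum_left inner_Basis if_distrib[of "\<lambda>t. _ * t"] sum.delta cong: if_cong)

lemma divergence_eq_component_grad: "divergence \<phi> x = (\<Sum>b\<in>Basis. component_grad \<phi> b x \<bullet> b)"
  by (simp add: divergence_def component_grad_inner)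

lemma test_field_support:
  assumes "\<phi> \<in> test_fields"
  obtains L where "L > 0" "\<And>x. L \<le> norm x \<Longrightarrow> \<phi> x = 0" "\<And>x v. L \<le> norm x \<Longrightarrow> frechet_derivative \<phi> (at x) v = 0"
proof -
  let ?S = "closure {x. \<phi> x \<noteq> 0}"
  have "bounded ?S" using assms compact_imp_bounded by (auto simp: test_fields_def)
  then obtain L where L: "L > 0" "\<And>x. x \<in> ?S \<Longrightarrow> norm x < L" unfolding bounded_pos_less by blast
  have out: "x \<in> - ?S" if "L \<le> norm x" for x using L(2)[of x] that by force
  have z: "\<phi> x = 0" if "x \<in> - ?S" for x using that closure_subset[of "{x. \<phi> x \<noteq> 0}"] by auto
  show ?thesis
  proof (rule that[OF L(1)])
    fix x :: 'a assume x: "L \<le> norm x"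
    show "\<phi> x = 0" using out[OF x] z by blast
    fix v
    have "((\<lambda>x. 0) has_derivative (\<lambda>v. 0)) (at x)" by simp
    \<comment> \<open>The complement of the closed support is open, and the field is identically 0
      on it.\<close>
    then have "(\<phi> has_derivative (\<lambda>v. 0)) (at x)"
    proof (rule has_derivative_transform_within_open[where s = "- ?S"])
      show "open (- ?S)" by (rule open_Compl[OF closed_closure])
      show "x \<in> - ?S" by (rule out[OF x])
      show "0 = \<phi> y" if "y \<in> - ?S" for y using z[OF that] by (rule sym)
    qed
    then show "frechet_derivative \<phi> (at x) v = 0" using frechet_derivative_at by metis
  qed
qed

lemma test_field_component_C1:
  assumes \<phi>: "\<phi> \<in> test_fields"
  shows "C1_kernel (\<lambda>x. \<phi> x \<bullet> b) (component_grad \<phi> b)"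
proof -
  obtain L where L: "L > 0" "\<And>x. L \<le> norm x \<Longrightarrow> \<phi> x = 0" "\<And>x v. L \<le> norm x \<Longrightarrow> frechet_derivative \<phi> (at x) v = 0"
    using test_field_support[OF \<phi>] by blast
  have dif: "\<phi> differentiable (at x)" for x using \<phi> by (simp add: test_fields_def)
  have D: "(\<phi> has_derivative frechet_derivative \<phi> (at x)) (at x)" for x using dif frechet_derivative_works by blast
  have c: "continuous_on UNIV \<phi>" using dif by (simp add: continuous_on_eq_continuous_at differentiable_imp_continuous_within)
  have "Cc (\<lambda>x. \<phi> x \<bullet> b)" unfolding Cc_def using c L(2) by (auto intro!: continuous_intros exI[of _ L])
  moreover have "Cc (component_grad \<phi> b)" unfolding Cc_def
  proof
    show "continuous_on UNIV (component_grad \<phi> b)" unfolding component_grad_def[abs_def]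
      using \<phi> by (auto intro!: continuous_intros simp: test_fields_def)
  qed (auto simp: component_grad_def L(3) intro!: exI[of _ L])
  moreover have "((\<lambda>x. \<phi> x \<bullet> b) has_derivative (\<lambda>v. component_grad \<phi> b x \<bullet> v)) (at x)" for x
  proof -
    have "((\<lambda>x. \<phi> x \<bullet> b) has_derivative (\<lambda>v. frechet_derivative \<phi> (at x) v \<bullet> b)) (at x)"
      by (rule has_derivative_inner_left[OF D])
    moreover have "frechet_derivative \<phi> (at x) v \<bullet> b = component_grad \<phi> b x \<bullet> v" for v
    proof -
      have lin: "linear (frechet_derivative \<phi> (at x))" using D has_derivative_linear by blast
      have "frechet_derivative \<phi> (at x) v = frechet_derivative \<phi> (at x) (\<Sum>i\<in>Basis. (v \<bullet> i) *\<^sub>R i)" by (simp add: euclidean_representation)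
      also have "\<dots> = (\<Sum>i\<in>Basis. (v \<bullet> i) *\<^sub>R frechet_derivative \<phi> (at x) i)"
        by (simp add: linear_sum[OF lin] linear_scale[OF lin])
      finally show ?thesis by (simp add: component_grad_def inner_sum_left inner_commute[of v] mult.commute)
    qed
    ultimately show ?thesis by simp
  qed
  ultimately show ?thesis by (simp add: C1_kernel_def)
qed

text \<open>Integration by parts without boundary terms: the convolution is differentiated once through each factor.\<close>

lemma convol_grad_component:
  assumes d: "\<delta> > 0" and \<phi>: "\<phi> \<in> test_fields"
  shows "convol (moll_grad \<delta>) (\<lambda>y. \<phi> y \<bullet> b) x = convol (component_grad \<phi> b) (moll \<delta>) x"
proof -
  have C: "Cc (\<lambda>y. \<phi> y \<bullet> b)" using test_field_component_C1[OF \<phi>] by (simp add: C1_kernel_def)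
  have "(convol (moll \<delta>) (\<lambda>y. \<phi> y \<bullet> b) has_derivative (\<lambda>v. convol (moll_grad \<delta>) (\<lambda>y. \<phi> y \<bullet> b) x \<bullet> v)) (at x)"
    by (rule convol_has_derivative[OF moll_C1_kernel[OF d] Cc_integrable[OF C]])
  moreover have "convol (moll \<delta>) (\<lambda>y. \<phi> y \<bullet> b) = convol (\<lambda>y. \<phi> y \<bullet> b) (moll \<delta>)"
    by (rule ext) (rule convol_commute[OF moll_Cc(1)[OF d] C])
  ultimately have 1: "(convol (\<lambda>y. \<phi> y \<bullet> b) (moll \<delta>) has_derivative (\<lambda>v. convol (moll_grad \<delta>) (\<lambda>y. \<phi> y \<bullet> b) x \<bullet> v)) (at x)" by simp
  have 2: "(convol (\<lambda>y. \<phi> y \<bullet> b) (moll \<delta>) has_derivative (\<lambda>v. convol (component_grad \<phi> b) (moll \<delta>) x \<bullet> v)) (at x)"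
    by (rule convol_has_derivative[OF test_field_component_C1[OF \<phi>] Cc_integrable[OF moll_Cc(1)[OF d]]])
  have "(\<lambda>v. convol (moll_grad \<delta>) (\<lambda>y. \<phi> y \<bullet> b) x \<bullet> v) = (\<lambda>v. convol (component_grad \<phi> b) (moll \<delta>) x \<bullet> v)"
    by (rule has_derivative_unique[OF 1 2])
  then show ?thesis by (simp add: fun_eq_iff) (metis vector_eq_ldot inner_commute)
qed

lemma test_field_divergence_Cc:
  assumes "\<phi> \<in> test_fields" shows "Cc (divergence \<phi>)"
proof -
  obtain L where L: "L > 0" "\<And>x v. L \<le> norm x \<Longrightarrow> frechet_derivative \<phi> (at x) v = 0"
    using test_field_support[OF assms] by metis
  show ?thesis unfolding Cc_def using test_field_divergence_continuous[OF assms] L(2)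
    by (auto simp: divergence_def intro!: exI[of _ L])
qed

text \<open>Sum of \<open>convol_grad_component\<close> over the basis: the divergence of the
  mollified field is the mollified divergence. On the right the divergence occupies the kernel slot
  and the mollifier is the density.\<close>

lemma convol_grad_divergence:
  assumes d: "\<delta> > 0" and \<phi>: "\<phi> \<in> test_fields"
  shows "(\<Sum>b\<in>Basis. convol (moll_grad \<delta>) (\<lambda>y. \<phi> y \<bullet> b) x \<bullet> b) = convol (divergence \<phi>) (moll \<delta>) x"
proof -
  have C: "Cc (component_grad \<phi> b)" for b using test_field_component_C1[OF \<phi>] by (simp add: C1_kernel_def)
  have i: "integrable lborel (moll \<delta> :: 'a \<Rightarrow> real)" by (rule Cc_integrable[OF moll_Cc(1)[OF d]])
  have "(\<Sum>b\<in>Basis. convol (moll_grad \<delta>) (\<lambda>y. \<phi> y \<bullet> b) x \<bullet> b) = (\<Sum>b\<in>Basis. convol (\<lambda>x. component_grad \<phi> b x \<bullet> b) (moll \<delta>) x)"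
    by (intro sum.cong refl) (simp only: convol_grad_component[OF d \<phi>] convol_inner[OF C i])
  also have "\<dots> = (\<integral>y. (\<Sum>b\<in>Basis. moll \<delta> y *\<^sub>R (component_grad \<phi> b (x - y) \<bullet> b)) \<partial>lborel)"
    unfolding convol_def by (rule Bochner_Integration.integral_sum[symmetric]) (rule convol_integrable[OF Cc_inner[OF C] i])
  also have "\<dots> = convol (divergence \<phi>) (moll \<delta>) x"
    by (simp add: convol_def divergence_eq_component_grad sum_distrib_left)
  finally show ?thesis .
qed

lemma divergence_approx:
  assumes \<phi>: "\<phi> \<in> test_fields" and e: "e > 0"
  obtains \<delta> where "\<delta> > 0" "\<And>x. \<bar>convol (divergence \<phi>) (moll \<delta>) x - divergence \<phi> x\<bar> \<le> e"
proof -
  note C = test_field_divergence_Cc[OF \<phi>]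
  \<comment> \<open>The modulus of continuity serves at the same time as mollification radius, since
    \<open>moll \<delta>\<close> vanishes at distance \<delta> and beyond.\<close>
  obtain \<delta> where \<delta>: "\<delta> > 0" "\<And>x y. norm (y - x) < \<delta> \<Longrightarrow> norm (divergence \<phi> y - divergence \<phi> x) < e"
    using Cc_uniformly_continuous[OF C e] by blast
  have i: "integrable lborel (moll \<delta> :: 'a \<Rightarrow> real)" by (rule Cc_integrable[OF moll_Cc(1)[OF \<delta>(1)]])
  show ?thesis
  proof (rule that[OF \<delta>(1)])
    fix x
    let ?f = "\<lambda>y. moll \<delta> y * (divergence \<phi> (x - y) - divergence \<phi> x)"
    have i1: "integrable lborel (\<lambda>y. moll \<delta> y * divergence \<phi> (x - y))" using convol_integrable[OF C i, of x] by simp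
    have i2: "integrable lborel (\<lambda>y::'a. moll \<delta> y * divergence \<phi> x)" using i by simp
    have if': "integrable lborel ?f" unfolding right_diff_distrib by (rule Bochner_Integration.integrable_diff[OF i1 i2])
    have eq: "convol (divergence \<phi>) (moll \<delta>) x - divergence \<phi> x = (\<integral>y. ?f y \<partial>lborel)"
      unfolding right_diff_distrib using i1 i2 by (simp add: convol_def moll_integral[OF \<delta>(1)])
    have "\<bar>\<integral>y. ?f y \<partial>lborel\<bar> \<le> (\<integral>y. norm (?f y) \<partial>lborel)" using integral_norm_bound[of lborel ?f] by simp
    also have "\<dots> \<le> (\<integral>(y::'a). moll \<delta> y * e \<partial>lborel)"
    proof (rule integral_mono[OF integrable_norm[OF if']])
      show "integrable lborel (\<lambda>y::'a. moll \<delta> y * e)" using i by simp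
      fix y
      show "norm (?f y) \<le> moll \<delta> y * e"
      proof (cases "norm y < \<delta>")
        case True
        then have "\<bar>divergence \<phi> (x - y) - divergence \<phi> x\<bar> \<le> e" using \<delta>(2)[of "x - y" x] by simp
        then show ?thesis using moll_nonneg[OF \<delta>(1), of y] by (simp add: abs_mult mult_left_mono)
      qed (simp add: moll_eq_0[OF \<delta>(1)])
    qed
    also have "\<dots> = e" by (simp add: moll_integral[OF \<delta>(1)])
    finally show "\<bar>convol (divergence \<phi>) (moll \<delta>) x - divergence \<phi> x\<bar> \<le> e" unfolding eq .
  qed
qed

text \<open>The converse of \<open>nn_integral_grad_le_Per\<close>, up to \<open>e\<close>.
  Replacing the divergence by its mollification costs at most e/(m+1) pointwise, hence at most
  \<open>e\<close> over a set of measure m; afterwards the derivative is moved onto the set. The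
  ball covers the support of the field, and the lower bound needs its finite volume.\<close>

lemma integral_divergence_le:
  fixes E :: "'a::euclidean_space set"
  assumes \<phi>: "\<phi> \<in> test_fields" and [measurable]: "E \<in> sets borel" and E: "emeasure lborel E < \<infinity>" and e: "e > 0"
  obtains \<delta> L where "\<delta> > 0" "L > 0"
    "ennreal (\<integral>x. indicator E x * divergence \<phi> x \<partial>lborel)
       \<le> (\<integral>\<^sup>+x. indicator (ball 0 L) x * ennreal (norm (convol (moll_grad \<delta>) (indicator E) x)) \<partial>lborel) + ennreal e"
proof -
  have iE: "integrable lborel (indicator E :: 'a \<Rightarrow> real)" using E by simp
  define m where "m = measure lborel E"
  have m: "m \<ge> 0" by (simp add: m_def)
  obtain \<delta> where \<delta>: "\<delta> > 0" "\<And>x. \<bar>convol (divergence \<phi>) (moll \<delta>) x - divergence \<phi> x\<bar> \<le> e / (m + 1)"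
    using divergence_approx[OF \<phi>, of "e / (m + 1)"] e m by (auto simp: add_nonneg_pos)
  obtain L where L: "L > 0" "\<And>x. L \<le> norm x \<Longrightarrow> \<phi> x = 0" using test_field_support[OF \<phi>] by metis
  define W where "W = convol (moll_grad \<delta>) (indicator E)"
  have [measurable]: "W \<in> borel_measurable borel" unfolding W_def by (rule convol_measurable[OF moll_Cc(2)[OF \<delta>(1)] iE])
  have Cdiv: "Cc (divergence \<phi>)" by (rule test_field_divergence_Cc[OF \<phi>])
  have C: "Cc (\<lambda>y. \<phi> y \<bullet> b)" for b using test_field_component_C1[OF \<phi>] by (simp add: C1_kernel_def)
  have imoll: "integrable lborel (moll \<delta> :: 'a \<Rightarrow> real)" by (rule Cc_integrable[OF moll_Cc(1)[OF \<delta>(1)]])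
  have [measurable]: "divergence \<phi> \<in> borel_measurable borel" by (rule Cc_measurable[OF Cdiv])
  note pair = convol_grad_pairing[OF \<delta>(1) iE Cc_integrable[OF C]]
  have ic: "integrable lborel (\<lambda>x. indicator E x * convol (divergence \<phi>) (moll \<delta>) x)"
    using integrable_convol_mult[OF Cdiv iE imoll] by simp
  have id: "integrable lborel (\<lambda>x. indicator E x * divergence \<phi> x)"
  proof -
    have "integrable lborel (\<lambda>x. indicator E x *\<^sub>R divergence \<phi> x)"
      by (rule integrable_mult_indicator[OF _ Cc_integrable[OF Cdiv]]) simp
    then show ?thesis by simp
  qed
  have "(\<integral>x. indicator E x * divergence \<phi> x \<partial>lborel) \<le> (\<integral>x. indicator E x * convol (divergence \<phi>) (moll \<delta>) x + e / (m + 1) * indicator E x \<partial>lborel)"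
  proof (rule integral_mono[OF id])
    show "integrable lborel (\<lambda>x. indicator E x * convol (divergence \<phi>) (moll \<delta>) x + e / (m + 1) * indicator E x)"
      using ic iE by simp
    show "indicator E x * divergence \<phi> x \<le> indicator E x * convol (divergence \<phi>) (moll \<delta>) x + e / (m + 1) * indicator E x" for x
      using \<delta>(2)[of x] by (auto simp: indicator_def abs_le_iff)
  qed
  also have "\<dots> = (\<integral>x. indicator E x * convol (divergence \<phi>) (moll \<delta>) x \<partial>lborel) + e / (m + 1) * m"
    using ic iE by (subst Bochner_Integration.integral_add) (auto simp: m_def)
  also have "(\<integral>x. indicator E x * convol (divergence \<phi>) (moll \<delta>) x \<partial>lborel) = - (\<integral>x. \<phi> x \<bullet> W x \<partial>lborel)"
    using pair(1) unfolding convol_grad_divergence[OF \<delta>(1) \<phi>] W_def .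
  also have "\<dots> + e / (m + 1) * m \<le> (\<integral>x. norm (\<phi> x \<bullet> W x) \<partial>lborel) + e"
  proof (rule add_mono)
    have "- (\<integral>x. \<phi> x \<bullet> W x \<partial>lborel) \<le> \<bar>\<integral>x. \<phi> x \<bullet> W x \<partial>lborel\<bar>" by simp
    also have "\<dots> \<le> (\<integral>x. norm (\<phi> x \<bullet> W x) \<partial>lborel)" using integral_norm_bound[of lborel "\<lambda>x. \<phi> x \<bullet> W x"] by simp
    finally show "- (\<integral>x. \<phi> x \<bullet> W x \<partial>lborel) \<le> (\<integral>x. norm (\<phi> x \<bullet> W x) \<partial>lborel)" .
    show "e / (m + 1) * m \<le> e" using e m by (simp add: field_simps)
  qed
  finally have "ennreal (\<integral>x. indicator E x * divergence \<phi> x \<partial>lborel) \<le> ennreal ((\<integral>x. norm (\<phi> x \<bullet> W x) \<partial>lborel) + e)"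
    by (rule ennreal_leI)
  also have "\<dots> = ennreal (\<integral>x. norm (\<phi> x \<bullet> W x) \<partial>lborel) + ennreal e"
    using e by (intro ennreal_plus) auto
  also have "ennreal (\<integral>x. norm (\<phi> x \<bullet> W x) \<partial>lborel) = (\<integral>\<^sup>+x. ennreal (norm (\<phi> x \<bullet> W x)) \<partial>lborel)"
    using pair(2) unfolding W_def[symmetric] by (intro nn_integral_eq_integral[symmetric] integrable_norm) auto
  also have "\<dots> \<le> (\<integral>\<^sup>+x. indicator (ball 0 L) x * ennreal (norm (W x)) \<partial>lborel)"
  proof (rule nn_integral_mono)
    fix x
    show "ennreal (norm (\<phi> x \<bullet> W x)) \<le> indicator (ball 0 L) x * ennreal (norm (W x))"
    proof (cases "norm x < L")
      case True
      have "norm (\<phi> x \<bullet> W x) \<le> norm (\<phi> x) * norm (W x)" by (simp add: Cauchy_Schwarz_ineq2)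
      also have "\<dots> \<le> 1 * norm (W x)" using \<phi> by (intro mult_right_mono) (auto simp: test_fields_def)
      finally show ?thesis using True by (simp add: ennreal_leI)
    qed (simp add: L)
  qed
  finally have "ennreal (\<integral>x. indicator E x * divergence \<phi> x \<partial>lborel) \<le> (\<integral>\<^sup>+x. indicator (ball 0 L) x * ennreal (norm (W x)) \<partial>lborel) + ennreal e"
    by (simp add: add_right_mono)
  then show ?thesis using that[OF \<delta>(1) L(1)] by (simp add: W_def)
qed

subsection \<open>Translates of sets\<close>

text \<open>The function \<open>G\<close> of the overview. As an integral, rather than the measure
  of a symmetric difference, it is ready for Fubini and the triangle inequality.\<close>

definition shift_diff :: "'a::euclidean_space set \<Rightarrow> 'a \<Rightarrow> ennreal" where
  "shift_diff E z = (\<integral>\<^sup>+x. ennreal \<bar>indicator E (z + x) - indicator E x\<bar> \<partial>lborel)"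

lemma borel_measurable_shift_diff [measurable]:
  assumes [measurable]: "E \<in> sets borel"
  shows "shift_diff E \<in> borel_measurable borel"
  unfolding shift_diff_def[abs_def] by measurable

text \<open>Substituting y = x + z gives an integral of the kernel against the one-sided difference,
  points of \<open>E\<close> moved out of \<open>E\<close> by z. Since the kernel is even, z -> - z
  yields the same value for points moved into \<open>E\<close>; the factor 2 accounts for
  both.\<close>

lemma twice_Jt:
  fixes E :: "'a::euclidean_space set"
  assumes [measurable]: "E \<in> sets borel"
  shows "2 * Jt s r E = (\<integral>\<^sup>+z. ennreal (kern DIM('a) s r (norm z)) * shift_diff E z \<partial>lborel)"
proof -
  let ?k = "\<lambda>z::'a. ennreal (kern DIM('a) s r (norm z))"
  let ?A = "\<lambda>z. \<integral>\<^sup>+x. indicator E x * indicator (- E) (z + x) \<partial>lborel"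
  let ?B = "\<lambda>z. \<integral>\<^sup>+x. indicator (- E) x * indicator E (z + x) \<partial>lborel"
  have "Jt s r E = (\<integral>\<^sup>+x. indicator E x * (\<integral>\<^sup>+y. indicator (- E) y * ?k (y - x) \<partial>lborel) \<partial>lborel)"
    unfolding Jt_def by (simp add: nn_integral_completion dist_norm norm_minus_commute)
  also have "\<dots> = (\<integral>\<^sup>+x. indicator E x * (\<integral>\<^sup>+z. indicator (- E) (x + z) * ?k z \<partial>lborel) \<partial>lborel)"
  proof (rule nn_integral_cong, rule arg_cong2[where f = times, OF refl])
    fix x
    show "(\<integral>\<^sup>+y. indicator (- E) y * ?k (y - x) \<partial>lborel) = (\<integral>\<^sup>+z. indicator (- E) (x + z) * ?k z \<partial>lborel)"
      using nn_integral_lborel_shift[of "\<lambda>y. indicator (- E) y * ?k (y - x)" x] by simp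
  qed
  also have "\<dots> = (\<integral>\<^sup>+x. (\<integral>\<^sup>+z. indicator E x * (indicator (- E) (x + z) * ?k z) \<partial>lborel) \<partial>lborel)"
    by (simp add: nn_integral_cmult)
  also have "\<dots> = (\<integral>\<^sup>+z. (\<integral>\<^sup>+x. indicator E x * (indicator (- E) (x + z) * ?k z) \<partial>lborel) \<partial>lborel)"
    by (rule lborel_pair.Fubini') measurable
  also have "\<dots> = (\<integral>\<^sup>+z. ?k z * ?A z \<partial>lborel)"
    by (intro nn_integral_cong) (simp add: nn_integral_cmult[symmetric] mult_ac add.commute)
  finally have 1: "Jt s r E = (\<integral>\<^sup>+z. ?k z * ?A z \<partial>lborel)" .
  have "?A (0 - z) = ?B z" for z
    using nn_integral_lborel_shift[of "\<lambda>x. indicator E x * indicator (- E) (0 - z + x)" z]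
    by (simp add: mult.commute)
  then have "(\<integral>\<^sup>+z. ?k z * ?B z \<partial>lborel) = (\<integral>\<^sup>+z. ?k (0 - z) * ?A (0 - z) \<partial>lborel)" by simp
  also have "\<dots> = (\<integral>\<^sup>+z. ?k z * ?A z \<partial>lborel)"
    by (rule nn_integral_lborel_reflect[of "\<lambda>z. ?k z * ?A z" 0]) measurable
  finally have 2: "Jt s r E = (\<integral>\<^sup>+z. ?k z * ?B z \<partial>lborel)" using 1 by simp
  have sd: "shift_diff E z = ?A z + ?B z" for z
    unfolding shift_diff_def
    by (subst nn_integral_add[symmetric]) (auto intro!: nn_integral_cong simp: indicator_def)
  have "2 * Jt s r E = Jt s r E + Jt s r E" by (simp add: mult_2)
  also have "\<dots> = (\<integral>\<^sup>+z. ?k z * ?A z \<partial>lborel) + (\<integral>\<^sup>+z. ?k z * ?B z \<partial>lborel)" using 1 2 by simp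
  also have "\<dots> = (\<integral>\<^sup>+z. ?k z * shift_diff E z \<partial>lborel)"
    unfolding sd distrib_left by (rule nn_integral_add[symmetric]) measurable
  finally show ?thesis .
qed

text \<open>Triangle inequality and translation invariance. With z = w it becomes the doubling
  estimate behind compactness.\<close>

lemma shift_diff_add:
  assumes [measurable]: "E \<in> sets borel"
  shows "shift_diff E (z + w) \<le> shift_diff E z + shift_diff E w"
proof -
  have "shift_diff E (z + w) \<le> (\<integral>\<^sup>+x. ennreal \<bar>indicator E (z + (w + x)) - indicator E (w + x)\<bar> + ennreal \<bar>indicator E (w + x) - indicator E x\<bar> \<partial>lborel)"
    unfolding shift_diff_def
  proof (rule nn_integral_mono)
    fix x
    have "ennreal \<bar>indicator E (z + w + x) - indicator E x\<bar> \<le> ennreal (\<bar>indicator E (z + (w + x)) - indicator E (w + x)\<bar> + \<bar>indicator E (w + x) - indicator E x\<bar>)"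
      by (intro ennreal_leI) (simp add: add.assoc)
    then show "ennreal \<bar>indicator E (z + w + x) - indicator E x\<bar> \<le> ennreal \<bar>indicator E (z + (w + x)) - indicator E (w + x)\<bar> + ennreal \<bar>indicator E (w + x) - indicator E x\<bar>"
      by (simp add: ennreal_plus)
  qed
  also have "\<dots> = (\<integral>\<^sup>+x. ennreal \<bar>indicator E (z + (w + x)) - indicator E (w + x)\<bar> \<partial>lborel) + shift_diff E w"
    unfolding shift_diff_def by (rule nn_integral_add) measurable
  also have "(\<integral>\<^sup>+x. ennreal \<bar>indicator E (z + (w + x)) - indicator E (w + x)\<bar> \<partial>lborel) = shift_diff E z"
    unfolding shift_diff_def by (rule nn_integral_lborel_shift[of "\<lambda>x. ennreal \<bar>indicator E (z + x) - indicator E x\<bar>" w]) measurable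
  finally show ?thesis .
qed

lemma shift_diff_le:
  assumes [measurable]: "E \<in> sets borel"
  shows "shift_diff E z \<le> 2 * emeasure lborel E"
proof -
  have "shift_diff E z \<le> (\<integral>\<^sup>+x. indicator E (z + x) + indicator E x \<partial>lborel)"
    unfolding shift_diff_def by (intro nn_integral_mono) (auto simp: indicator_def)
  also have "\<dots> = (\<integral>\<^sup>+x. indicator E (z + x) \<partial>lborel) + (\<integral>\<^sup>+x. indicator E x \<partial>lborel)"
    by (rule nn_integral_add) measurable
  also have "(\<integral>\<^sup>+x. indicator E (z + x) \<partial>lborel) = (\<integral>\<^sup>+x. indicator E x \<partial>lborel)"
    by (rule nn_integral_lborel_shift) measurable
  finally show ?thesis by (simp add: mult_2)
qed

text \<open>Continuity of translation in L1. Outer regularity gives an open \<open>U\<close> around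
  \<open>E\<close> with little excess, and a point of \<open>E\<close> stays in \<open>U\<close>
  under small translations, so dominated convergence applies. It is a theorem on sequences, hence
  the argument by contradiction.\<close>

lemma shift_diff_small:
  fixes E :: "'a::euclidean_space set"
  assumes [measurable]: "E \<in> sets borel" and E: "emeasure lborel E < \<infinity>" and e: "e > 0"
  obtains \<rho> where "\<rho> > 0" "\<And>w. norm w < \<rho> \<Longrightarrow> shift_diff E w \<le> ennreal e"
proof -
  let ?A = "\<lambda>z. \<integral>\<^sup>+x. indicator E x * indicator (- E) (z + x) \<partial>lborel"
  have small: "\<exists>\<rho>>0. \<forall>w. norm w < \<rho> \<longrightarrow> ?A w \<le> ennreal (e / 2)"
  proof (rule ccontr)
    assume "\<not> ?thesis"
    then have "\<exists>w. norm w < 1 / real (Suc n) \<and> ?A w > ennreal (e / 2)" for n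
      by (metis not_le of_nat_0_less_iff zero_less_Suc zero_less_divide_1_iff)
    then obtain w where w: "\<And>n. norm (w n) < 1 / real (Suc n)" "\<And>n. ?A (w n) > ennreal (e / 2)" by metis
    have w0: "w \<longlonglongrightarrow> 0"
    proof (rule tendsto_norm_zero_cancel)
      show "(\<lambda>n. norm (w n)) \<longlonglongrightarrow> 0"
        using LIMSEQ_inverse_real_of_nat
        by (rule real_tendsto_sandwich[OF _ _ tendsto_const, rotated 2]) (use w(1) in \<open>auto simp: inverse_eq_divide less_imp_le\<close>)
    qed
    have "e / 4 > 0" using e by simp
    then obtain U where U: "open U" "E \<subseteq> U" "emeasure lborel (U - E) < ennreal (e / 4)"
      by (rule outer_regular_lborel[OF assms(1)])
    have [measurable]: "U \<in> sets borel" using U(1) by simp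
    let ?C = "\<lambda>z. \<integral>\<^sup>+x. indicator E x * indicator (- U) (z + x) \<partial>lborel"
    \<comment> \<open>The complement of \<open>E\<close> is split into \<open>U - E\<close>, whose
      measure is small however it is translated, and the complement of \<open>U\<close>.\<close>
    have le: "?A z \<le> ennreal (e / 4) + ?C z" for z
    proof -
      have "?A z \<le> (\<integral>\<^sup>+x. indicator (U - E) (z + x) + indicator E x * indicator (- U) (z + x) \<partial>lborel)"
        by (intro nn_integral_mono) (auto simp: indicator_def)
      also have "\<dots> = (\<integral>\<^sup>+x. indicator (U - E) (z + x) \<partial>lborel) + ?C z"
        by (rule nn_integral_add) measurable
      also have "(\<integral>\<^sup>+x. indicator (U - E) (z + x) \<partial>lborel) = (\<integral>\<^sup>+x. indicator (U - E) x \<partial>lborel)"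
        by (rule nn_integral_lborel_shift) measurable
      also have "(\<integral>\<^sup>+x. indicator (U - E) x \<partial>lborel) \<le> ennreal (e / 4)" using U(3) by (simp add: less_imp_le)
      finally show ?thesis by (simp add: add_right_mono)
    qed
    have "(\<lambda>n. ?C (w n)) \<longlonglongrightarrow> (\<integral>\<^sup>+(x::'a). 0 \<partial>lborel)"
    proof (rule nn_integral_dominated_convergence[where w = "indicator E"])
      show "AE x in lborel. (\<lambda>n. indicator E x * indicator (- U) (w n + x) :: ennreal) \<longlonglongrightarrow> 0"
      proof (rule AE_I2)
        fix x
        show "(\<lambda>n. indicator E x * indicator (- U) (w n + x) :: ennreal) \<longlonglongrightarrow> 0"
        proof (cases "x \<in> E")
          case True
          have "(\<lambda>n. w n + x) \<longlonglongrightarrow> 0 + x" by (intro tendsto_intros w0)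
          then have "eventually (\<lambda>n. w n + x \<in> U) sequentially"
            using True U topological_tendstoD[of "\<lambda>n. w n + x" x sequentially U] by auto
          then have "eventually (\<lambda>n. indicator E x * indicator (- U) (w n + x) = (0::ennreal)) sequentially"
            by (rule eventually_mono) (auto simp: indicator_def)
          then show ?thesis by (rule tendsto_eventually)
        qed simp
      qed
      show "AE x in lborel. indicator E x * indicator (- U) (w n + x) \<le> (indicator E x :: ennreal)" for n
        by (auto simp: indicator_def)
    qed (use E in auto)
    then have "(\<lambda>n. ?C (w n)) \<longlonglongrightarrow> 0" by simp
    then have "eventually (\<lambda>n. ?C (w n) < ennreal (e / 4)) sequentially"
      using e by (intro order_tendstoD) auto
    then obtain n where n: "?C (w n) < ennreal (e / 4)" by (auto simp: eventually_sequentially)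
    have "?A (w n) \<le> ennreal (e / 4) + ennreal (e / 4)" using le[of "w n"] n by (meson add_left_mono less_imp_le order_trans)
    also have "\<dots> = ennreal (e / 2)" using e by (subst ennreal_plus[symmetric]) auto
    finally show False using w(2)[of n] by simp
  qed
  then obtain \<rho> where \<rho>: "\<rho> > 0" "\<And>w. norm w < \<rho> \<Longrightarrow> ?A w \<le> ennreal (e / 2)" by blast
  show ?thesis
  proof (rule that[OF \<rho>(1)])
    fix w :: 'a assume w: "norm w < \<rho>"
    have "(\<integral>\<^sup>+x. indicator (- E) x * indicator E (w + x) \<partial>lborel) = ?A (- w)"
      using nn_integral_lborel_shift[of "\<lambda>x. indicator E x * indicator (- E) (- w + x)" w] by (simp add: mult.commute)
    moreover have "shift_diff E w = ?A w + (\<integral>\<^sup>+x. indicator (- E) x * indicator E (w + x) \<partial>lborel)"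
      unfolding shift_diff_def by (subst nn_integral_add[symmetric]) (auto intro!: nn_integral_cong simp: indicator_def)
    ultimately have "shift_diff E w = ?A w + ?A (- w)" by simp
    also have "\<dots> \<le> ennreal (e / 2) + ennreal (e / 2)" using \<rho>(2)[of w] \<rho>(2)[of "- w"] w by (intro add_mono) auto
    also have "\<dots> = ennreal e" using e by (subst ennreal_plus[symmetric]) auto
    finally show "shift_diff E w \<le> ennreal e" .
  qed
qed

text \<open>Convolution commutes with translation, and by Young's inequality a kernel of mass 1 does
  not increase the L1 norm.\<close>

lemma nn_integral_convol_shift_le:
  assumes d: "\<delta> > 0" and [measurable]: "E \<in> sets borel" and E: "emeasure lborel E < \<infinity>"
  shows "(\<integral>\<^sup>+y. ennreal \<bar>convol (moll \<delta>) (indicator E) (y + z) - convol (moll \<delta>) (indicator E) y\<bar> \<partial>lborel) \<le> shift_diff E z"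
proof -
  have iE: "integrable lborel (indicator E :: 'a \<Rightarrow> real)" using E by simp
  have iz: "integrable lborel (\<lambda>x. indicator E (z + x) :: real)" by (rule integrable_lborel_shift[OF iE])
  have m: "Cc (moll \<delta> :: 'a \<Rightarrow> real)" by (rule moll_Cc(1)[OF d])
  have "(\<integral>\<^sup>+y. ennreal \<bar>convol (moll \<delta>) (indicator E) (y + z) - convol (moll \<delta>) (indicator E) y\<bar> \<partial>lborel)
     = (\<integral>\<^sup>+y. ennreal (norm (convol (moll \<delta>) (\<lambda>x. indicator E (z + x) - indicator E x) y)) \<partial>lborel)"
    by (simp add: convol_shift[OF m iE] convol_diff[OF m iz iE])
  also have "\<dots> \<le> (\<integral>\<^sup>+x. ennreal (norm (moll \<delta> (x::'a))) \<partial>lborel) * (\<integral>\<^sup>+x. ennreal \<bar>indicator E (z + x) - indicator E x\<bar> \<partial>lborel)"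
    by (rule nn_integral_convol_le[OF m]) (use iz iE in simp)
  also have "\<dots> = shift_diff E z"
    using moll_nn_integral[OF d, where 'a = 'a] by (simp add: moll_nonneg[OF d] shift_diff_def)
  finally show ?thesis .
qed

text \<open>The mollified indicator is an average of translates of the indicator with the weights
  \<open>moll \<delta> w\<close>; since these have mass 1, the value at \<open>x\<close> can be
  subtracted under the integral.\<close>

lemma nn_integral_convol_dist_le:
  fixes E :: "'a::euclidean_space set"
  assumes d: "\<delta> > 0" and [measurable]: "E \<in> sets borel" and E: "emeasure lborel E < \<infinity>"
  shows "(\<integral>\<^sup>+x. ennreal \<bar>convol (moll \<delta>) (indicator E) x - indicator E x\<bar> \<partial>lborel) \<le> (\<integral>\<^sup>+w. ennreal (moll \<delta> w) * shift_diff E w \<partial>lborel)"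
proof -
  have iE: "integrable lborel (indicator E :: 'a \<Rightarrow> real)" using E by simp
  have m: "Cc (moll \<delta> :: 'a \<Rightarrow> real)" by (rule moll_Cc(1)[OF d])
  have [measurable]: "(moll \<delta> :: 'a \<Rightarrow> real) \<in> borel_measurable borel" by (rule Cc_measurable[OF m])
  have i2: "integrable lborel (\<lambda>w. indicator E x * moll \<delta> (w::'a))" for x using Cc_integrable[OF m] by simp
  have pt: "ennreal \<bar>convol (moll \<delta>) (indicator E) x - indicator E x\<bar> \<le> (\<integral>\<^sup>+w. ennreal (moll \<delta> w) * ennreal \<bar>indicator E (w + x) - indicator E x\<bar> \<partial>lborel)" for x
  proof -
    have "convol (moll \<delta>) (indicator E) x = (\<integral>w. (\<lambda>y. indicator E y * moll \<delta> (x - y)) (x + w) \<partial>lborel)"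
      unfolding convol_def by (subst integral_lborel_shift) auto
    also have "\<dots> = (\<integral>w. indicator E (w + x) * moll \<delta> w \<partial>lborel)" by (simp add: add.commute)
    finally have u: "convol (moll \<delta>) (indicator E) x = (\<integral>w. indicator E (w + x) * moll \<delta> w \<partial>lborel)" .
    have i1: "integrable lborel (\<lambda>w. indicator E (w + x) * moll \<delta> w)"
      by (rule Bochner_Integration.integrable_bound[OF Cc_integrable[OF m]]) (auto simp: indicator_def)
    let ?f = "\<lambda>w. indicator E (w + x) * moll \<delta> w - indicator E x * moll \<delta> w"
    have eq: "convol (moll \<delta>) (indicator E) x - indicator E x = (\<integral>w. ?f w \<partial>lborel)"
      unfolding u using i1 i2 by (subst Bochner_Integration.integral_diff) (auto simp: moll_integral[OF d])
    have "ennreal \<bar>\<integral>w. ?f w \<partial>lborel\<bar> \<le> (\<integral>\<^sup>+w. ennreal (norm (?f w)) \<partial>lborel)"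
      using integral_norm_bound_ennreal[of lborel ?f] i1 i2 by simp
    also have "\<dots> = (\<integral>\<^sup>+w. ennreal (moll \<delta> w) * ennreal \<bar>indicator E (w + x) - indicator E x\<bar> \<partial>lborel)"
      using moll_nonneg[OF d, where 'a = 'a] by (intro nn_integral_cong) (auto simp: indicator_def)
    finally show ?thesis unfolding eq .
  qed
  have "(\<integral>\<^sup>+x. ennreal \<bar>convol (moll \<delta>) (indicator E) x - indicator E x\<bar> \<partial>lborel)
    \<le> (\<integral>\<^sup>+x. (\<integral>\<^sup>+w. ennreal (moll \<delta> w) * ennreal \<bar>indicator E (w + x) - indicator E x\<bar> \<partial>lborel) \<partial>lborel)"
    by (intro nn_integral_mono pt)
  also have "\<dots> = (\<integral>\<^sup>+w. (\<integral>\<^sup>+x. ennreal (moll \<delta> w) * ennreal \<bar>indicator E (w + x) - indicator E x\<bar> \<partial>lborel) \<partial>lborel)"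
    by (rule lborel_pair.Fubini') measurable
  also have "\<dots> = (\<integral>\<^sup>+w. ennreal (moll \<delta> w) * shift_diff E w \<partial>lborel)"
    unfolding shift_diff_def by (intro nn_integral_cong nn_integral_cmult) measurable
  finally show ?thesis .
qed

lemma shift_diff_le_convol:
  fixes E :: "'a::euclidean_space set"
  assumes d: "\<delta> > 0" and [measurable]: "E \<in> sets borel" and E: "emeasure lborel E < \<infinity>"
  shows "shift_diff E z \<le> (\<integral>\<^sup>+y. ennreal \<bar>convol (moll \<delta>) (indicator E) (y + z) - convol (moll \<delta>) (indicator E) y\<bar> \<partial>lborel)
     + 2 * (\<integral>\<^sup>+x. ennreal \<bar>convol (moll \<delta>) (indicator E) x - indicator E x\<bar> \<partial>lborel)"
proof -
  let ?u = "convol (moll \<delta>) (indicator E)"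
  have iE: "integrable lborel (indicator E :: 'a \<Rightarrow> real)" using E by simp
  have [measurable]: "?u \<in> borel_measurable borel" by (rule convol_measurable[OF moll_Cc(1)[OF d] iE])
  let ?D = "\<lambda>x. ennreal \<bar>?u x - indicator E x\<bar>"
  have "shift_diff E z \<le> (\<integral>\<^sup>+x. ennreal \<bar>?u (x + z) - ?u x\<bar> + (?D (z + x) + ?D x) \<partial>lborel)"
    unfolding shift_diff_def
  proof (rule nn_integral_mono)
    fix x
    have "ennreal \<bar>indicator E (z + x) - indicator E x\<bar> \<le> ennreal (\<bar>?u (x + z) - ?u x\<bar> + (\<bar>?u (z + x) - indicator E (z + x)\<bar> + \<bar>?u x - indicator E x\<bar>))"
      by (intro ennreal_leI) (simp add: add.commute[of x z])
    then show "ennreal \<bar>indicator E (z + x) - indicator E x\<bar> \<le> ennreal \<bar>?u (x + z) - ?u x\<bar> + (?D (z + x) + ?D x)"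
      by (simp add: ennreal_plus)
  qed
  also have "\<dots> = (\<integral>\<^sup>+x. ennreal \<bar>?u (x + z) - ?u x\<bar> \<partial>lborel) + ((\<integral>\<^sup>+x. ?D (z + x) \<partial>lborel) + (\<integral>\<^sup>+x. ?D x \<partial>lborel))"
    by (simp add: nn_integral_add)
  also have "(\<integral>\<^sup>+x. ?D (z + x) \<partial>lborel) = (\<integral>\<^sup>+x. ?D x \<partial>lborel)" by (rule nn_integral_lborel_shift) measurable
  finally show ?thesis by (simp add: mult_2)
qed

subsection \<open>Upper bound\<close>

text \<open>Fundamental theorem of calculus on the segment from y to y + z, then Fubini; each point
  of the segment contributes the same integral over y. The estimate holds for every z, without
  remainder.\<close>

lemma nn_integral_increment_le:
  fixes E :: "'a::euclidean_space set"
  assumes d: "\<delta> > 0" and [measurable]: "E \<in> sets borel" and E: "emeasure lborel E < \<infinity>"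
  shows "(\<integral>\<^sup>+y. ennreal \<bar>convol (moll \<delta>) (indicator E) (y + z) - convol (moll \<delta>) (indicator E) y\<bar> \<partial>lborel)
    \<le> (\<integral>\<^sup>+y. ennreal \<bar>convol (moll_grad \<delta>) (indicator E) y \<bullet> z\<bar> \<partial>lborel)"
proof -
  define u where "u = convol (moll \<delta>) (indicator E)"
  define W where "W = convol (moll_grad \<delta>) (indicator E)"
  have iE: "integrable lborel (indicator E :: 'a \<Rightarrow> real)" using E by simp
  have cW: "continuous_on UNIV W" unfolding W_def by (rule continuous_on_convol[OF moll_Cc(2)[OF d] iE])
  have [measurable]: "W \<in> borel_measurable borel" by (rule borel_measurable_continuous_onI[OF cW])
  have du: "(u has_derivative (\<lambda>v. W x \<bullet> v)) (at x)" for x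
    unfolding u_def W_def by (rule convol_has_derivative[OF moll_C1_kernel[OF d] iE])
  have pt: "ennreal \<bar>u (y + z) - u y\<bar> \<le> (\<integral>\<^sup>+t. indicator {0..1} t * ennreal \<bar>W (t *\<^sub>R z + y) \<bullet> z\<bar> \<partial>lborel)" for y
  proof -
    let ?F = "\<lambda>t. u (t *\<^sub>R z + y)" and ?f = "\<lambda>t. W (t *\<^sub>R z + y) \<bullet> z"
    have der: "(?F has_vector_derivative ?f t) (at t within {0..1})" for t
    proof -
      have "(?F has_derivative (\<lambda>h. W (t *\<^sub>R z + y) \<bullet> (h *\<^sub>R z))) (at t within {0..1})"
        by (rule has_derivative_compose[OF _ du]) (auto intro!: derivative_eq_intros)
      then show ?thesis by (simp add: has_vector_derivative_def)
    qed
    have cf: "continuous_on {0..1} ?f"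
      by (intro continuous_intros continuous_on_compose2[OF cW]) auto
    have hb: "has_bochner_integral lborel (\<lambda>t. indicator {0..1} t *\<^sub>R ?f t) (?F 1 - ?F 0)"
      using has_bochner_integral_FTC_Icc[of 0 1 ?F ?f] der cf by simp
    then have "u (y + z) - u y = (\<integral>t. indicator {0..1} t *\<^sub>R ?f t \<partial>lborel)"
      using has_bochner_integral_integral_eq[OF hb] by (simp add: add.commute)
    then have "ennreal \<bar>u (y + z) - u y\<bar> = ennreal (norm (\<integral>t. indicator {0..1} t *\<^sub>R ?f t \<partial>lborel))" by simp
    also have "\<dots> \<le> (\<integral>\<^sup>+t. ennreal (norm (indicator {0..1} t *\<^sub>R ?f t)) \<partial>lborel)"
      by (rule integral_norm_bound_ennreal) (use hb in \<open>simp add: has_bochner_integral_iff\<close>)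
    also have "\<dots> = (\<integral>\<^sup>+t. indicator {0..1} t * ennreal \<bar>?f t\<bar> \<partial>lborel)"
      by (intro nn_integral_cong) (auto simp: indicator_def)
    finally show ?thesis .
  qed
  have "(\<integral>\<^sup>+y. ennreal \<bar>u (y + z) - u y\<bar> \<partial>lborel) \<le> (\<integral>\<^sup>+y. (\<integral>\<^sup>+t. indicator {0..1} (t::real) * ennreal \<bar>W (t *\<^sub>R z + y) \<bullet> z\<bar> \<partial>lborel) \<partial>lborel)"
    by (intro nn_integral_mono pt)
  also have "\<dots> = (\<integral>\<^sup>+t. (\<integral>\<^sup>+y. indicator {0..1} (t::real) * ennreal \<bar>W (t *\<^sub>R z + y) \<bullet> z\<bar> \<partial>lborel) \<partial>lborel)"
    by (rule lborel_pair.Fubini') measurable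
  also have "\<dots> = (\<integral>\<^sup>+t. indicator {0..1} (t::real) * (\<integral>\<^sup>+y. ennreal \<bar>W y \<bullet> z\<bar> \<partial>lborel) \<partial>lborel)"
  proof (rule nn_integral_cong)
    fix t :: real
    show "(\<integral>\<^sup>+y. indicator {0..1} t * ennreal \<bar>W (t *\<^sub>R z + y) \<bullet> z\<bar> \<partial>lborel) = indicator {0..1} t * (\<integral>\<^sup>+y. ennreal \<bar>W y \<bullet> z\<bar> \<partial>lborel)"
      using nn_integral_lborel_shift[of "\<lambda>y. ennreal \<bar>W y \<bullet> z\<bar>" "t *\<^sub>R z"] by (simp add: nn_integral_cmult)
  qed
  also have "\<dots> = (\<integral>\<^sup>+y. ennreal \<bar>W y \<bullet> z\<bar> \<partial>lborel)" by (simp add: nn_integral_multc)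
  finally show ?thesis by (simp add: u_def W_def)
qed

text \<open>Fubini, then \<open>nn_integral_kern_inner\<close> with \<open>W y\<close> as direction.
  The weight \<open>p\<close> is 1 in the upper bound and the indicator of a ball in the lower
  bound.\<close>

lemma nn_integral_kern_weighted:
  fixes W :: "'a::euclidean_space \<Rightarrow> 'a"
  assumes [measurable]: "W \<in> borel_measurable borel" "p \<in> borel_measurable borel"
    and r: "0 < r" "r < \<rho>" "r < 1" and s: "s \<ge> 1"
  shows "(\<integral>\<^sup>+z. ennreal (indicator {..<\<rho>} (norm z) * kern DIM('a) s r (norm z)) * (\<integral>\<^sup>+y. p y * ennreal \<bar>W y \<bullet> z\<bar> \<partial>lborel) \<partial>lborel)
    = ennreal (2 * unit_ball_vol (real (DIM('a) - 1))) * (\<integral>\<^sup>+y. p y * ennreal (norm (W y)) \<partial>lborel) * ennreal (sigma DIM('a) s r + radial_const DIM('a) s \<rho>)"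
proof -
  let ?k = "\<lambda>z::'a. ennreal (indicator {..<\<rho>} (norm z) * kern DIM('a) s r (norm z))"
  let ?c = "ennreal (2 * unit_ball_vol (real (DIM('a) - 1)))" and ?q = "ennreal (sigma DIM('a) s r + radial_const DIM('a) s \<rho>)"
  have "(\<integral>\<^sup>+z. ?k z * (\<integral>\<^sup>+y. p y * ennreal \<bar>W y \<bullet> z\<bar> \<partial>lborel) \<partial>lborel) = (\<integral>\<^sup>+z. (\<integral>\<^sup>+y. ?k z * (p y * ennreal \<bar>W y \<bullet> z\<bar>) \<partial>lborel) \<partial>lborel)"
    by (simp add: nn_integral_cmult)
  also have "\<dots> = (\<integral>\<^sup>+y. (\<integral>\<^sup>+z. ?k z * (p y * ennreal \<bar>W y \<bullet> z\<bar>) \<partial>lborel) \<partial>lborel)"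
    by (rule lborel_pair.Fubini') measurable
  also have "\<dots> = (\<integral>\<^sup>+y. (?c * ?q) * (p y * ennreal (norm (W y))) \<partial>lborel)"
  proof (rule nn_integral_cong)
    fix y
    have "(\<integral>\<^sup>+z. ?k z * (p y * ennreal \<bar>W y \<bullet> z\<bar>) \<partial>lborel) = p y * (\<integral>\<^sup>+z. ?k z * ennreal \<bar>z \<bullet> W y\<bar> \<partial>lborel)"
      by (simp add: nn_integral_cmult[symmetric] mult_ac inner_commute)
    also have "\<dots> = (?c * ?q) * (p y * ennreal (norm (W y)))"
      unfolding nn_integral_kern_inner[OF r s] by (simp add: ennreal_mult mult_ac)
    finally show "(\<integral>\<^sup>+z. ?k z * (p y * ennreal \<bar>W y \<bullet> z\<bar>) \<partial>lborel) = (?c * ?q) * (p y * ennreal (norm (W y)))" .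
  qed
  also have "\<dots> = (?c * ?q) * (\<integral>\<^sup>+y. p y * ennreal (norm (W y)) \<partial>lborel)" by (rule nn_integral_cmult) measurable
  finally show ?thesis by (simp add: mult_ac)
qed

text \<open>The kernel is split at distance 1. Inside, shift differences are replaced by mollified
  gradients, whose L1 norms never exceed \<open>Per E\<close>; outside, they are bounded by twice
  the measure.\<close>

lemma Jt_upper:
  fixes E :: "'a::euclidean_space set"
  assumes [measurable]: "E \<in> sets borel" and E: "emeasure lborel E < \<infinity>"
    and r: "0 < r" "r < 1" and s: "s \<ge> 1"
  shows "2 * Jt s r E \<le> ennreal (2 * unit_ball_vol (real (DIM('a) - 1))) * Per E * ennreal (sigma DIM('a) s r + radial_const DIM('a) s 1)
     + 2 * emeasure lborel E * ennreal (unit_ball_vol (real DIM('a)) * real DIM('a) / s)"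
    (is "_ \<le> ?X + ?Y")
proof -
  let ?k = "\<lambda>z::'a. ennreal (kern DIM('a) s r (norm z))"
  let ?k1 = "\<lambda>z::'a. ennreal (indicator {..<1} (norm z) * kern DIM('a) s r (norm z))"
  let ?k2 = "\<lambda>z::'a. ennreal (indicator {1..} (norm z) * kern DIM('a) s r (norm z))"
  define T where "T = (\<integral>\<^sup>+z. ?k z \<partial>lborel)"
  have T: "T < \<infinity>" unfolding T_def by (rule nn_integral_kern_finite[OF r s])
  \<comment> \<open>The mollification scale is chosen after \<open>r\<close>, so the error in
    \<open>shift_diff\<close> is weighted by the finite mass \<open>T\<close>. Letting
    \<open>e\<close> tend to 0 removes it although \<open>T\<close> is unbounded in
    \<open>r\<close>.\<close>
  have main: "2 * Jt s r E \<le> ?X + ?Y + 2 * ennreal e * T" if e: "e > 0" for e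
  proof -
    obtain \<delta> where \<delta>: "\<delta> > 0" "\<And>w. norm w < \<delta> \<Longrightarrow> shift_diff E w \<le> ennreal e"
      using shift_diff_small[OF assms(1) E e] by blast
    define u where "u = convol (moll \<delta>) (indicator E)"
    define W where "W = convol (moll_grad \<delta>) (indicator E)"
    have iE: "integrable lborel (indicator E :: 'a \<Rightarrow> real)" using E by simp
    have [measurable]: "W \<in> borel_measurable borel" unfolding W_def by (rule convol_measurable[OF moll_Cc(2)[OF \<delta>(1)] iE])
    have D: "(\<integral>\<^sup>+x. ennreal \<bar>u x - indicator E x\<bar> \<partial>lborel) \<le> ennreal e"
    proof -
      have [measurable]: "(moll \<delta> :: 'a \<Rightarrow> real) \<in> borel_measurable borel" by (rule Cc_measurable[OF moll_Cc(1)[OF \<delta>(1)]])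
      have "(\<integral>\<^sup>+x. ennreal \<bar>u x - indicator E x\<bar> \<partial>lborel) \<le> (\<integral>\<^sup>+w. ennreal (moll \<delta> w) * shift_diff E w \<partial>lborel)"
        unfolding u_def by (rule nn_integral_convol_dist_le[OF \<delta>(1) assms(1) E])
      also have "\<dots> \<le> (\<integral>\<^sup>+(w::'a). ennreal (moll \<delta> w) * ennreal e \<partial>lborel)"
      proof (rule nn_integral_mono)
        fix w :: 'a
        show "ennreal (moll \<delta> w) * shift_diff E w \<le> ennreal (moll \<delta> w) * ennreal e"
          using \<delta>(2)[of w] moll_eq_0[OF \<delta>(1), of w] by (cases "norm w < \<delta>") (auto intro: mult_left_mono)
      qed
      also have "\<dots> = ennreal e" by (simp add: nn_integral_multc moll_nn_integral[OF \<delta>(1)])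
      finally show ?thesis .
    qed
    have sd: "shift_diff E z \<le> (\<integral>\<^sup>+y. 1 * ennreal \<bar>W y \<bullet> z\<bar> \<partial>lborel) + 2 * ennreal e" for z
    proof -
      have "shift_diff E z \<le> (\<integral>\<^sup>+y. ennreal \<bar>u (y + z) - u y\<bar> \<partial>lborel) + 2 * (\<integral>\<^sup>+x. ennreal \<bar>u x - indicator E x\<bar> \<partial>lborel)"
        unfolding u_def by (rule shift_diff_le_convol[OF \<delta>(1) assms(1) E])
      also have "\<dots> \<le> (\<integral>\<^sup>+y. ennreal \<bar>W y \<bullet> z\<bar> \<partial>lborel) + 2 * ennreal e"
        using D nn_integral_increment_le[OF \<delta>(1) assms(1) E, of z] unfolding u_def W_def
        by (intro add_mono mult_left_mono) auto
      finally show ?thesis by simp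
    qed
    have "2 * Jt s r E = (\<integral>\<^sup>+z. ?k z * shift_diff E z \<partial>lborel)" by (rule twice_Jt) measurable
    also have "\<dots> = (\<integral>\<^sup>+z. ?k1 z * shift_diff E z + ?k2 z * shift_diff E z \<partial>lborel)"
      by (intro nn_integral_cong) (auto simp: indicator_def)
    also have "\<dots> \<le> (\<integral>\<^sup>+z. (?k1 z * (\<integral>\<^sup>+y. 1 * ennreal \<bar>W y \<bullet> z\<bar> \<partial>lborel) + ?k z * (2 * ennreal e)) + ?k2 z * (2 * emeasure lborel E) \<partial>lborel)"
    proof (rule nn_integral_mono, rule add_mono)
      fix z :: 'a
      have "?k1 z * shift_diff E z \<le> ?k1 z * ((\<integral>\<^sup>+y. 1 * ennreal \<bar>W y \<bullet> z\<bar> \<partial>lborel) + 2 * ennreal e)"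
        by (rule mult_left_mono[OF sd]) simp
      also have "\<dots> = ?k1 z * (\<integral>\<^sup>+y. 1 * ennreal \<bar>W y \<bullet> z\<bar> \<partial>lborel) + ?k1 z * (2 * ennreal e)" by (rule distrib_left)
      also have "\<dots> \<le> ?k1 z * (\<integral>\<^sup>+y. 1 * ennreal \<bar>W y \<bullet> z\<bar> \<partial>lborel) + ?k z * (2 * ennreal e)"
        by (intro add_left_mono mult_right_mono ennreal_leI) (auto simp: indicator_def)
      finally show "?k1 z * shift_diff E z \<le> ?k1 z * (\<integral>\<^sup>+y. 1 * ennreal \<bar>W y \<bullet> z\<bar> \<partial>lborel) + ?k z * (2 * ennreal e)" .
      show "?k2 z * shift_diff E z \<le> ?k2 z * (2 * emeasure lborel E)"
        by (rule mult_left_mono[OF shift_diff_le]) auto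
    qed
    also have "\<dots> = ((\<integral>\<^sup>+z. ?k1 z * (\<integral>\<^sup>+y. 1 * ennreal \<bar>W y \<bullet> z\<bar> \<partial>lborel) \<partial>lborel) + (\<integral>\<^sup>+z. ?k z * (2 * ennreal e) \<partial>lborel)) + (\<integral>\<^sup>+z. ?k2 z * (2 * emeasure lborel E) \<partial>lborel)"
      by (subst nn_integral_add, measurable, subst nn_integral_add, measurable)
    also have "(\<integral>\<^sup>+z. ?k1 z * (\<integral>\<^sup>+y. 1 * ennreal \<bar>W y \<bullet> z\<bar> \<partial>lborel) \<partial>lborel)
      = ennreal (2 * unit_ball_vol (real (DIM('a) - 1))) * (\<integral>\<^sup>+y. 1 * ennreal (norm (W y)) \<partial>lborel) * ennreal (sigma DIM('a) s r + radial_const DIM('a) s 1)"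
      using r s by (intro nn_integral_kern_weighted) auto
    also have "(\<integral>\<^sup>+z. ?k z * (2 * ennreal e) \<partial>lborel) = 2 * ennreal e * T"
      by (subst nn_integral_multc) (auto simp: T_def mult_ac)
    also have "(\<integral>\<^sup>+z. ?k2 z * (2 * emeasure lborel E) \<partial>lborel) = ?Y"
      by (subst nn_integral_multc) (auto simp: nn_integral_kern_tail[OF r s] mult_ac)
    also have "ennreal (2 * unit_ball_vol (real (DIM('a) - 1))) * (\<integral>\<^sup>+y. 1 * ennreal (norm (W y)) \<partial>lborel) * ennreal (sigma DIM('a) s r + radial_const DIM('a) s 1) + 2 * ennreal e * T + ?Y
       \<le> ?X + 2 * ennreal e * T + ?Y"
      using nn_integral_grad_le_Per[OF \<delta>(1) assms(1) E] unfolding W_def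
      by (intro add_right_mono mult_right_mono mult_left_mono) auto
    finally show ?thesis by (simp add: add_ac)
  qed
  show ?thesis
  proof (rule ennreal_le_epsilon)
    fix e :: real assume e: "e > 0"
    define t where "t = enn2real T"
    have t: "T = ennreal t" "t \<ge> 0" using T by (auto simp: t_def)
    define e' where "e' = e / (2 * (t + 1))"
    have e': "e' > 0" "2 * e' * (t + 1) = e" using e t by (auto simp: e'_def field_simps)
    have "2 * Jt s r E \<le> ?X + ?Y + 2 * ennreal e' * T" by (intro main e')
    also have "2 * ennreal e' * T = ennreal (2 * e' * t)"
      using t e' by (simp add: ennreal_mult)
    also have "\<dots> \<le> ennreal e"
      using e' t by (intro ennreal_leI) (simp add: algebra_simps)
    finally show "2 * Jt s r E \<le> ?X + ?Y + ennreal e" by (simp add: add_left_mono)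
  qed
qed

subsection \<open>Lower bound\<close>

text \<open>By Taylor expansion |W y \<bullet> z| exceeds the increment of the mollification by at
  most a small multiple of \<open>norm z\<close>. The restriction to a ball makes this pointwise
  error integrable, and integrating it against the kernel gives the same factor as the main term.
  Hence \<open>e\<close> is a relative error, and \<open>\<rho>\<close> does not depend on the
  set.\<close>

lemma Jt_lower:
  fixes L e m :: real
  assumes d: "\<delta> > 0" and L: "L > 0" and e: "e > 0" and m: "m \<ge> 0" and s: "s \<ge> 1"
  obtains \<rho> where "\<rho> > 0"
    "\<And>(F::'a::euclidean_space set) r. F \<in> sets borel \<Longrightarrow> emeasure lborel F \<le> ennreal m \<Longrightarrow> 0 < r \<Longrightarrow> r < \<rho> \<Longrightarrow> r < 1 \<Longrightarrow>
      ennreal (2 * unit_ball_vol (real (DIM('a) - 1))) * (\<integral>\<^sup>+y. indicator (ball 0 L) y * ennreal (norm (convol (moll_grad \<delta>) (indicator F) y)) \<partial>lborel)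
         * ennreal (sigma DIM('a) s r + radial_const DIM('a) s \<rho>)
      \<le> 2 * Jt s r F + ennreal e * ennreal (sigma DIM('a) s r + radial_const DIM('a) s \<rho>)"
proof -
  define V where "V = unit_ball_vol (real DIM('a)) * L ^ DIM('a)"
  define w where "w = 2 * unit_ball_vol (real (DIM('a) - 1)) * real DIM('a)"
  have V: "V \<ge> 0" "emeasure lborel (ball (0::'a) L) = ennreal V" using L by (auto simp: V_def emeasure_ball)
  have w: "w \<ge> 0" by (simp add: w_def)
  \<comment> \<open>The Taylor tolerance is multiplied later by the measure bound \<open>m\<close>,
    the volume \<open>V\<close> of the ball and the constant \<open>w\<close> of
    \<open>nn_integral_kern_norm_le\<close>; adding 1 avoids dividing by 0.\<close>
  define e' where "e' = e / (m * V * w + 1)"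
  have mVw: "m * V * w \<ge> 0" using m V w by simp
  have e': "e' > 0" using e mVw by (auto simp: e'_def intro!: divide_pos_pos add_nonneg_pos)
  have e'le: "e' * m * V * w \<le> e"
  proof -
    have "e' * m * V * w \<le> e' * (m * V * w + 1)" using e' by (simp add: algebra_simps)
    also have "\<dots> = e" using mVw by (simp add: e'_def)
    finally show ?thesis .
  qed
  obtain \<rho> where \<rho>: "\<rho> > 0"
    "\<And>h (x::'a) v. integrable lborel h \<Longrightarrow> norm v < \<rho> \<Longrightarrow>
       \<bar>convol (moll \<delta>) h (x + v) - convol (moll \<delta>) h x - convol (moll_grad \<delta>) h x \<bullet> v\<bar> \<le> e' * norm v * (\<integral>y. \<bar>h y\<bar> \<partial>lborel)"
    using convol_uniform_differentiable[OF moll_C1_kernel[OF d] e'] by blast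
  show ?thesis
  proof (rule that[OF \<rho>(1)])
    fix F :: "'a set" and r :: real
    assume [measurable]: "F \<in> sets borel" and F: "emeasure lborel F \<le> ennreal m" and r: "0 < r" "r < \<rho>" "r < 1"
    let ?q = "ennreal (sigma DIM('a) s r + radial_const DIM('a) s \<rho>)"
    let ?k = "\<lambda>z::'a. ennreal (indicator {..<\<rho>} (norm z) * kern DIM('a) s r (norm z))"
    have Ffin: "emeasure lborel F < \<infinity>" using F by (simp add: le_less_trans)
    define u where "u = convol (moll \<delta>) (indicator F)"
    define W where "W = convol (moll_grad \<delta>) (indicator F)"
    have iF: "integrable lborel (indicator F :: 'a \<Rightarrow> real)" using Ffin by simp
    have [measurable]: "W \<in> borel_measurable borel" unfolding W_def by (rule convol_measurable[OF moll_Cc(2)[OF d] iF])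
    have [measurable]: "u \<in> borel_measurable borel" unfolding u_def by (rule convol_measurable[OF moll_Cc(1)[OF d] iF])
    have mF: "measure lborel F \<le> m" using F m by (simp add: measure_def enn2real_leI)
    have step: "?k z * (\<integral>\<^sup>+y. indicator (ball 0 L) y * ennreal \<bar>W y \<bullet> z\<bar> \<partial>lborel)
       \<le> ennreal (kern DIM('a) s r (norm z)) * shift_diff F z + ennreal (e' * m * V) * (?k z * ennreal (norm z))" for z
    proof (cases "norm z < \<rho>")
      case True
      have "(\<integral>\<^sup>+y. indicator (ball 0 L) y * ennreal \<bar>W y \<bullet> z\<bar> \<partial>lborel)
         \<le> (\<integral>\<^sup>+y. ennreal \<bar>u (y + z) - u y\<bar> + ennreal (e' * norm z * m) * indicator (ball 0 L) y \<partial>lborel)"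
      proof (rule nn_integral_mono)
        fix y :: 'a
        have "\<bar>u (y + z) - u y - W y \<bullet> z\<bar> \<le> e' * norm z * (\<integral>y. \<bar>indicator F y\<bar> \<partial>lborel)"
          unfolding u_def W_def by (rule \<rho>(2)[OF iF True])
        also have "(\<integral>y. \<bar>indicator F y\<bar> \<partial>lborel) = measure lborel F" by simp
        also have "e' * norm z * measure lborel F \<le> e' * norm z * m" using mF e' by (intro mult_left_mono) auto
        finally have "\<bar>W y \<bullet> z\<bar> \<le> \<bar>u (y + z) - u y\<bar> + e' * norm z * m" by linarith
        then have "ennreal \<bar>W y \<bullet> z\<bar> \<le> ennreal (\<bar>u (y + z) - u y\<bar> + e' * norm z * m)"
          by (rule ennreal_leI)
        also have "\<dots> = ennreal \<bar>u (y + z) - u y\<bar> + ennreal (e' * norm z * m)"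
          using e' m by (intro ennreal_plus) auto
        finally have "ennreal \<bar>W y \<bullet> z\<bar> \<le> ennreal \<bar>u (y + z) - u y\<bar> + ennreal (e' * norm z * m)" .
        then show "indicator (ball 0 L) y * ennreal \<bar>W y \<bullet> z\<bar> \<le> ennreal \<bar>u (y + z) - u y\<bar> + ennreal (e' * norm z * m) * indicator (ball 0 L) y"
          by (auto simp: indicator_def)
      qed
      also have "\<dots> = (\<integral>\<^sup>+y. ennreal \<bar>u (y + z) - u y\<bar> \<partial>lborel) + ennreal (e' * norm z * m) * ennreal V"
        by (subst nn_integral_add) (auto simp: nn_integral_cmult V(2))
      also have "\<dots> \<le> shift_diff F z + ennreal (e' * norm z * m) * ennreal V"
        unfolding u_def by (intro add_right_mono nn_integral_convol_shift_le d Ffin) measurable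
      finally have "?k z * (\<integral>\<^sup>+y. indicator (ball 0 L) y * ennreal \<bar>W y \<bullet> z\<bar> \<partial>lborel) \<le> ?k z * (shift_diff F z + ennreal (e' * norm z * m) * ennreal V)"
        by (rule mult_left_mono) simp
      also have "\<dots> = ennreal (kern DIM('a) s r (norm z)) * shift_diff F z + ennreal (e' * m * V) * (?k z * ennreal (norm z))"
        using True e' m V(1) by (simp add: distrib_left ennreal_mult mult_ac)
      finally show ?thesis .
    qed simp
    have "ennreal (2 * unit_ball_vol (real (DIM('a) - 1))) * (\<integral>\<^sup>+y. indicator (ball 0 L) y * ennreal (norm (W y)) \<partial>lborel) * ?q
      = (\<integral>\<^sup>+z. ?k z * (\<integral>\<^sup>+y. indicator (ball 0 L) y * ennreal \<bar>W y \<bullet> z\<bar> \<partial>lborel) \<partial>lborel)"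
      using r s by (intro nn_integral_kern_weighted[symmetric]) auto
    also have "\<dots> \<le> (\<integral>\<^sup>+z. ennreal (kern DIM('a) s r (norm z)) * shift_diff F z + ennreal (e' * m * V) * (?k z * ennreal (norm z)) \<partial>lborel)"
      by (intro nn_integral_mono step)
    also have "\<dots> = 2 * Jt s r F + ennreal (e' * m * V) * (\<integral>\<^sup>+z. ?k z * ennreal (norm z) \<partial>lborel)"
      unfolding twice_Jt[OF \<open>F \<in> sets borel\<close>] by (subst nn_integral_add) (auto simp: nn_integral_cmult)
    also have "\<dots> \<le> 2 * Jt s r F + ennreal (e' * m * V) * (ennreal w * ?q)"
      using nn_integral_kern_norm_le[OF r s, where 'a = 'a] unfolding w_def by (intro add_left_mono mult_left_mono) auto
    also have "ennreal (e' * m * V) * (ennreal w * ?q) = ennreal (e' * m * V * w) * ?q"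
      using e' m V w by (simp add: ennreal_mult mult_ac)
    also have "\<dots> \<le> ennreal e * ?q" by (intro mult_right_mono ennreal_leI e'le) simp
    finally show "ennreal (2 * unit_ball_vol (real (DIM('a) - 1))) * (\<integral>\<^sup>+y. indicator (ball 0 L) y * ennreal (norm (convol (moll_grad \<delta>) (indicator F) y)) \<partial>lborel) * ?q
      \<le> 2 * Jt s r F + ennreal e * ?q" unfolding W_def by (simp add: add_left_mono)
  qed
qed

lemma less_divide_ennrealI:
  assumes "\<sigma> > 0" "t \<ge> 0" "ennreal (t * \<sigma>) < J"
  shows "ennreal t < J / ennreal \<sigma>"
proof (cases J)
  case (real j)
  then show ?thesis using assms by (simp add: divide_ennreal ennreal_less_iff field_simps)
next
  case top
  then show ?thesis by (simp add: ennreal_top_divide)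
qed

lemma eventually_sigma_gt:
  assumes "s \<ge> 1" "\<forall>n. r n > 0" "r \<longlonglongrightarrow> 0"
  shows "eventually (\<lambda>n::nat. sigma d s (r n) > B) sequentially"
proof -
  have "filterlim r (at_right 0) sequentially"
    using assms by (auto simp: filterlim_at less_le intro!: always_eventually)
  from filterlim_compose[OF filterlim_sigma_at_top[OF assms(1)] this]
  show ?thesis by (auto simp: filterlim_at_top_dense)
qed

text \<open>With \<delta> fixed the mollified gradient is Lipschitz in the set, from L1 to the sup
  norm, with constant the supremum of the kernel. L1 convergence of the sets enters the lower bound
  through this.\<close>

lemma nn_integral_ball_grad_le:
  fixes E F :: "'a::euclidean_space set"
  assumes d: "\<delta> > 0" and [measurable]: "E \<in> sets borel" "F \<in> sets borel"
    and fin: "emeasure lborel E < \<infinity>" "emeasure lborel F < \<infinity>"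
    and C: "\<And>x::'a. norm (moll_grad \<delta> x) \<le> C" and C0: "C \<ge> 0"
  shows "(\<integral>\<^sup>+y. indicator (ball 0 L) y * ennreal (norm (convol (moll_grad \<delta>) (indicator E) y)) \<partial>lborel)
    \<le> (\<integral>\<^sup>+y. indicator (ball 0 L) y * ennreal (norm (convol (moll_grad \<delta>) (indicator F) y)) \<partial>lborel)
      + ennreal C * (\<integral>\<^sup>+x. ennreal \<bar>indicator F x - indicator E x\<bar> \<partial>lborel) * emeasure lborel (ball (0::'a) L)"
proof -
  let ?W = "\<lambda>E. convol (moll_grad \<delta>) (indicator E) :: 'a \<Rightarrow> 'a"
  let ?D = "\<integral>\<^sup>+x. ennreal \<bar>indicator F x - indicator E x\<bar> \<partial>lborel"
  have i: "integrable lborel (indicator E :: 'a \<Rightarrow> real)" "integrable lborel (indicator F :: 'a \<Rightarrow> real)" using fin by auto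
  note cc = moll_Cc(2)[OF d]
  have [measurable]: "?W E \<in> borel_measurable borel" "?W F \<in> borel_measurable borel" by (auto intro: convol_measurable[OF cc] i)
  have pt: "ennreal (norm (?W E y)) \<le> ennreal (norm (?W F y)) + ennreal C * ?D" for y
  proof -
    have iD: "integrable lborel (\<lambda>x. indicator F x - indicator E x :: real)" using i by auto
    have D: "?D = ennreal (\<integral>x. \<bar>indicator F x - indicator E x\<bar> \<partial>lborel)" by (rule nn_integral_eq_integral) (use iD in auto)
    have "norm (?W F y - ?W E y) \<le> C * (\<integral>x. \<bar>indicator F x - indicator E x\<bar> \<partial>lborel)"
      unfolding convol_diff[OF cc i(2,1), symmetric] by (rule norm_convol_le[OF cc iD C])
    then have "norm (?W E y) \<le> norm (?W F y) + C * (\<integral>x. \<bar>indicator F x - indicator E x\<bar> \<partial>lborel)"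
      using norm_triangle_ineq2[of "?W E y" "?W F y"] by (simp add: norm_minus_commute)
    then show ?thesis unfolding D using C0 by (subst ennreal_mult[symmetric]) (auto simp flip: ennreal_plus intro: ennreal_leI)
  qed
  have "(\<integral>\<^sup>+y. indicator (ball 0 L) y * ennreal (norm (?W E y)) \<partial>lborel)
    \<le> (\<integral>\<^sup>+y. indicator (ball 0 L) y * ennreal (norm (?W F y)) + (ennreal C * ?D) * indicator (ball 0 L) y \<partial>lborel)"
    using pt by (intro nn_integral_mono) (auto simp: indicator_def)
  also have "\<dots> = (\<integral>\<^sup>+y. indicator (ball 0 L) y * ennreal (norm (?W F y)) \<partial>lborel) + (ennreal C * ?D) * emeasure lborel (ball (0::'a) L)"
    by (subst nn_integral_add) (auto simp: nn_integral_cmult)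
  finally show ?thesis .
qed

text \<open>\<delta> and L stay fixed while \<open>r n\<close> tends to 0. The gradient of the limit
  set is replaced by that of \<open>En n\<close>, \<open>Jt_lower\<close> applies with one common
  \<open>\<rho>\<close>, and the growth of \<open>sigma\<close> absorbs its additive
  constant.\<close>

lemma liminf_lower_ball:
  fixes E :: "'a::euclidean_space set" and En :: "nat \<Rightarrow> 'a set"
  assumes [measurable]: "E \<in> sets borel" and mn: "\<And>n. En n \<in> sets borel"
    and fin: "emeasure lborel E < \<infinity>" "\<And>n. emeasure lborel (En n) < \<infinity>"
    and conv: "(\<lambda>n. \<integral>\<^sup>+x. ennreal \<bar>indicator (En n) x - indicator E x\<bar> \<partial>lborel) \<longlonglongrightarrow> 0"
    and s: "s \<ge> 1" and r: "\<forall>n. r n > 0" "r \<longlonglongrightarrow> 0" and d: "\<delta> > 0" and L: "L > 0"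
  shows "ennreal (unit_ball_vol (real (DIM('a) - 1))) * (\<integral>\<^sup>+y. indicator (ball 0 L) y * ennreal (norm (convol (moll_grad \<delta>) (indicator E) y)) \<partial>lborel)
     \<le> liminf (\<lambda>n. Jt s (r n) (En n) / ennreal (sigma DIM('a) s (r n)))"
proof -
  define D where "D n = (\<integral>\<^sup>+x. ennreal \<bar>indicator (En n) x - indicator E x\<bar> \<partial>lborel)" for n
  define w where "w = unit_ball_vol (real (DIM('a) - 1))"
  have w: "w > 0" by (simp add: w_def)
  define I where "I F = (\<integral>\<^sup>+y. indicator (ball 0 L) y * ennreal (norm (convol (moll_grad \<delta>) (indicator F) y)) \<partial>lborel)" for F :: "'a set"
  obtain C where C: "C \<ge> 0" "\<And>x::'a. norm (moll_grad \<delta> x) \<le> C" using Cc_bounded[OF moll_Cc(2)[OF d]] by blast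
  define V where "V = unit_ball_vol (real DIM('a)) * L ^ DIM('a)"
  have V: "V > 0" "emeasure lborel (ball (0::'a) L) = ennreal V" using L by (auto simp: V_def emeasure_ball)
  have cont: "I E \<le> I F + ennreal C * (\<integral>\<^sup>+x. ennreal \<bar>indicator F x - indicator E x\<bar> \<partial>lborel) * ennreal V"
    if [measurable]: "F \<in> sets borel" and "emeasure lborel F < \<infinity>" for F
    using nn_integral_ball_grad_le[OF d assms(1) that(1) fin(1) that(2) C(2,1), of L] unfolding I_def V(2) .
  have Ifin: "I E < \<infinity>"
  proof -
    \<comment> \<open>Comparison with the empty set, whose gradient vanishes, shows that the
      integral is finite.\<close>
    have "(\<integral>\<^sup>+x. ennreal \<bar>indicator {} x - indicator E x\<bar> \<partial>lborel) = (\<integral>\<^sup>+x. indicator E x \<partial>lborel)"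
      by (intro nn_integral_cong) (auto simp: indicator_def)
    then have "I E \<le> I {} + ennreal C * emeasure lborel E * ennreal V" using cont[of "{}"] by simp
    also have "I {} = 0" by (simp add: I_def convol_def)
    finally show ?thesis using fin(1) by (simp add: ennreal_mult_less_top le_less_trans)
  qed
  define A where "A = enn2real (ennreal w * I E)"
  have A: "ennreal w * I E = ennreal A" "A \<ge> 0" using Ifin by (auto simp: A_def ennreal_mult_less_top)
  \<comment> \<open>Eventually the L1 distance is at most 1, so this bounds the measures of the
    approximating sets.\<close>
  define m where "m = measure lborel E + 1"
  have m: "m \<ge> 0" by (simp add: m_def)
  have "ennreal A \<le> liminf (\<lambda>n. Jt s (r n) (En n) / ennreal (sigma DIM('a) s (r n)))"
    unfolding le_Liminf_iff
  proof (intro allI impI)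
    fix y assume y: "y < ennreal A"
    then obtain t where t: "y = ennreal t" "t \<ge> 0" by (cases y) auto
    with y have tA: "t < A" by (simp add: ennreal_less_iff)
    \<comment> \<open>L1 convergence costs 2e and Taylor expansion e, both against 2A, so the energy
      exceeds (A - 2e)(sigma + c). As A - 2e = t + 2e, a surplus of 2e times \<open>sigma\<close> is
      left to absorb the term with \<open>c\<close>.\<close>
    define e where "e = (A - t) / 4"
    have e: "e > 0" using tA by (simp add: e_def)
    obtain \<rho> where \<rho>: "\<rho> > 0"
      "\<And>F r. F \<in> sets borel \<Longrightarrow> emeasure lborel F \<le> ennreal m \<Longrightarrow> 0 < r \<Longrightarrow> r < \<rho> \<Longrightarrow> r < 1 \<Longrightarrow>
      ennreal (2 * w) * I F * ennreal (sigma DIM('a) s r + radial_const DIM('a) s \<rho>)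
      \<le> 2 * Jt s r F + ennreal e * ennreal (sigma DIM('a) s r + radial_const DIM('a) s \<rho>)"
      using Jt_lower[OF d L e m s, where 'a = 'a, folded I_def w_def] by blast
    define c where "c = radial_const DIM('a) s \<rho>"
    define e2 where "e2 = min 1 (e / (w * C * V + 1))"
    have wCV: "w * C * V \<ge> 0" using w C(1) V by simp
    have e2: "e2 > 0" using e wCV by (auto simp: e2_def intro!: divide_pos_pos add_nonneg_pos)
    have e2le: "w * C * V * e2 \<le> e"
    proof -
      have "w * C * V * e2 \<le> w * C * V * (e / (w * C * V + 1))" using wCV by (intro mult_left_mono) (auto simp: e2_def)
      also have "\<dots> \<le> e" using e wCV by (simp add: field_simps)
      finally show ?thesis .
    qed
    have ev1: "eventually (\<lambda>n. D n < ennreal e2) sequentially"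
      using conv e2 unfolding D_def by (intro order_tendstoD) auto
    have ev2: "eventually (\<lambda>n. r n < \<rho> \<and> r n < 1) sequentially"
      using order_tendstoD(2)[OF r(2) \<rho>(1)] order_tendstoD(2)[OF r(2), of 1] by (auto elim: eventually_elim2)
    \<comment> \<open>The threshold makes \<open>sigma\<close> and \<open>sigma + c\<close> positive
      and the term with \<open>c\<close> smaller than e times \<open>sigma\<close>.\<close>
    have ev3: "eventually (\<lambda>n. sigma DIM('a) s (r n) > \<bar>c\<bar> + 1 + \<bar>(A - 2 * e) * c\<bar> / e) sequentially"
      by (rule eventually_sigma_gt[OF s r])
    show "eventually (\<lambda>n. y < Jt s (r n) (En n) / ennreal (sigma DIM('a) s (r n))) sequentially"
      using ev1 ev2 ev3
    proof eventually_elim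
      case (elim n)
      let ?\<sigma> = "sigma DIM('a) s (r n)" and ?J = "Jt s (r n) (En n)"
      have \<sigma>: "?\<sigma> > 0" "?\<sigma> + c > 0" "\<bar>(A - 2 * e) * c\<bar> / e < ?\<sigma>"
      proof -
        have "\<bar>(A - 2 * e) * c\<bar> / e \<ge> 0" using e by simp
        then show "?\<sigma> > 0" "?\<sigma> + c > 0" "\<bar>(A - 2 * e) * c\<bar> / e < ?\<sigma>" using elim(3) by linarith+
      qed
      have mE: "emeasure lborel (En n) \<le> ennreal m"
      proof -
        have [measurable]: "En n \<in> sets borel" by (rule mn)
        have "emeasure lborel (En n) = (\<integral>\<^sup>+x. indicator (En n) x \<partial>lborel)" by simp
        also have "\<dots> \<le> (\<integral>\<^sup>+x. ennreal \<bar>indicator (En n) x - indicator E x\<bar> + indicator E x \<partial>lborel)"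
          by (intro nn_integral_mono) (auto simp: indicator_def)
        also have "\<dots> = D n + emeasure lborel E" by (subst nn_integral_add) (auto simp: D_def)
        also have "\<dots> \<le> ennreal 1 + ennreal (measure lborel E)"
        proof (rule add_mono)
          have "D n \<le> ennreal e2" using elim(1) by (rule less_imp_le)
          also have "\<dots> \<le> ennreal 1" by (rule ennreal_leI) (simp add: e2_def)
          finally show "D n \<le> ennreal 1" .
          show "emeasure lborel E \<le> ennreal (measure lborel E)"
            using fin(1) by (simp add: emeasure_eq_ennreal_measure less_top)
        qed
        also have "\<dots> = ennreal m" by (subst ennreal_plus[symmetric]) (auto simp: m_def)
        finally show ?thesis .
      qed
      have "ennreal A \<le> ennreal w * (I (En n) + ennreal C * D n * ennreal V)"
        unfolding A(1)[symmetric] D_def by (intro mult_left_mono cont mn fin) simp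
      also have "\<dots> = ennreal w * I (En n) + ennreal (w * C * V) * D n"
        using w C(1) V by (simp add: distrib_left ennreal_mult mult_ac)
      also have "\<dots> \<le> ennreal w * I (En n) + ennreal (w * C * V) * ennreal e2"
        using elim(1) by (intro add_left_mono mult_left_mono) auto
      also have "ennreal (w * C * V) * ennreal e2 = ennreal (w * C * V * e2)" using wCV e2 by (simp add: ennreal_mult)
      also have "\<dots> \<le> ennreal e" by (rule ennreal_leI[OF e2le])
      finally have "ennreal A \<le> ennreal w * I (En n) + ennreal e" by (simp add: add_left_mono)
      then have "2 * ennreal A * ennreal (?\<sigma> + c) \<le> 2 * (ennreal w * I (En n) + ennreal e) * ennreal (?\<sigma> + c)"
        by (intro mult_right_mono mult_left_mono) auto
      also have "\<dots> = ennreal (2 * w) * I (En n) * ennreal (?\<sigma> + c) + 2 * ennreal e * ennreal (?\<sigma> + c)"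
        using w by (simp add: distrib_left distrib_right ennreal_mult mult_ac)
      also have "\<dots> \<le> (2 * ?J + ennreal e * ennreal (?\<sigma> + c)) + 2 * ennreal e * ennreal (?\<sigma> + c)"
        unfolding c_def using elim(2) r(1) by (intro add_right_mono \<rho>(2) mn mE) auto
      finally have ineq: "2 * ennreal A * ennreal (?\<sigma> + c) \<le> 2 * ?J + ennreal e * ennreal (?\<sigma> + c) + 2 * ennreal e * ennreal (?\<sigma> + c)" .
      have "ennreal (t * ?\<sigma>) < ?J"
      proof (cases ?J)
        case (real j)
        define q where "q = ?\<sigma> + c"
        have q: "q > 0" using \<sigma> by (simp add: q_def)
        have "ennreal (2 * A * q) = 2 * ennreal A * ennreal q" using A(2) q by (simp add: ennreal_mult)
        also have "\<dots> \<le> 2 * ?J + ennreal e * ennreal q + 2 * ennreal e * ennreal q" using ineq unfolding q_def .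
        also have "\<dots> = ennreal (2 * j) + ennreal (e * q) + ennreal (2 * e * q)"
          using real e q by (simp add: ennreal_mult)
        also have "ennreal (2 * j) + ennreal (e * q) = ennreal (2 * j + e * q)"
          by (rule ennreal_plus[symmetric]) (use real e q in auto)
        also have "\<dots> + ennreal (2 * e * q) = ennreal (2 * j + e * q + 2 * e * q)"
          by (rule ennreal_plus[symmetric]) (use real e q in auto)
        finally have "ennreal (2 * A * (?\<sigma> + c)) \<le> ennreal (2 * j + e * (?\<sigma> + c) + 2 * e * (?\<sigma> + c))"
          unfolding q_def .
        then have "2 * A * (?\<sigma> + c) \<le> 2 * j + e * (?\<sigma> + c) + 2 * e * (?\<sigma> + c)"
          using real e \<sigma> by (subst (asm) ennreal_le_iff) auto
        moreover have "e * (?\<sigma> + c) > 0" using e \<sigma> by simp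
        ultimately have j: "(A - 2 * e) * (?\<sigma> + c) < j" by (simp add: algebra_simps)
        have "\<bar>(A - 2 * e) * c\<bar> < e * ?\<sigma>" using \<sigma>(3) e by (simp add: field_simps)
        moreover have "A - 2 * e = t + 2 * e" by (simp add: e_def field_simps)
        ultimately have "t * ?\<sigma> < (A - 2 * e) * (?\<sigma> + c)"
          using mult_pos_pos[OF e \<sigma>(1)] by (simp add: algebra_simps)
        then have "t * ?\<sigma> < j" using j by simp
        then show ?thesis using real t(2) \<sigma>(1) by (simp add: ennreal_less_iff)
      next
        case top
        then show ?thesis by simp
      qed
      then show ?case unfolding t(1) by (intro less_divide_ennrealI \<sigma>(1) t(2))
    qed
  qed
  then show ?thesis unfolding A(1)[symmetric] w_def I_def .
qed

text \<open>The supremum defining \<open>Per\<close> is treated one test field at a time, each with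
  its own mollification scale and ball. An infinite perimeter is thereby included.\<close>

lemma Per_liminf:
  fixes E :: "'a::euclidean_space set" and En :: "nat \<Rightarrow> 'a set"
  assumes mE: "E \<in> sets borel" and mn: "\<And>n. En n \<in> sets borel"
    and fin: "emeasure lborel E < \<infinity>" "\<And>n. emeasure lborel (En n) < \<infinity>"
    and conv: "(\<lambda>n. \<integral>\<^sup>+x. ennreal \<bar>indicator (En n) x - indicator E x\<bar> \<partial>lborel) \<longlonglongrightarrow> 0"
    and s: "s \<ge> 1" and r: "\<forall>n. r n > 0" "r \<longlonglongrightarrow> 0"
  shows "ennreal (unit_ball_vol (real (DIM('a) - 1))) * Per E
     \<le> liminf (\<lambda>n. Jt s (r n) (En n) / ennreal (sigma DIM('a) s (r n)))" (is "_ \<le> ?S")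
  unfolding Per_eq_lborel[OF mE] SUP_mult_left_ennreal
proof (rule SUP_least)
  fix \<phi> :: "'a \<Rightarrow> 'a" assume \<phi>: "\<phi> \<in> test_fields"
  define w where "w = unit_ball_vol (real (DIM('a) - 1))"
  have w: "w > 0" by (simp add: w_def)
  show "ennreal (unit_ball_vol (real (DIM('a) - 1))) * ennreal (\<integral>x. indicator E x * divergence \<phi> x \<partial>lborel) \<le> ?S"
  proof (rule ennreal_le_epsilon)
    fix e :: real assume e: "e > 0"
    then have "e / w > 0" using w by simp
    then obtain \<delta> L where dL: "\<delta> > 0" "L > 0"
      "ennreal (\<integral>x. indicator E x * divergence \<phi> x \<partial>lborel)
       \<le> (\<integral>\<^sup>+x. indicator (ball 0 L) x * ennreal (norm (convol (moll_grad \<delta>) (indicator E) x)) \<partial>lborel) + ennreal (e / w)"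
      using integral_divergence_le[OF \<phi> mE fin(1)] by metis
    have "ennreal w * ennreal (\<integral>x. indicator E x * divergence \<phi> x \<partial>lborel)
      \<le> ennreal w * ((\<integral>\<^sup>+x. indicator (ball 0 L) x * ennreal (norm (convol (moll_grad \<delta>) (indicator E) x)) \<partial>lborel) + ennreal (e / w))"
      by (rule mult_left_mono[OF dL(3)]) simp
    also have "\<dots> = ennreal w * (\<integral>\<^sup>+x. indicator (ball 0 L) x * ennreal (norm (convol (moll_grad \<delta>) (indicator E) x)) \<partial>lborel) + ennreal e"
      using w e by (simp add: distrib_left ennreal_mult[symmetric])
    also have "\<dots> \<le> ?S + ennreal e"
      unfolding w_def by (intro add_right_mono liminf_lower_ball mE mn fin conv s r dL)
    finally show "ennreal (unit_ball_vol (real (DIM('a) - 1))) * ennreal (\<integral>x. indicator E x * divergence \<phi> x \<partial>lborel) \<le> ?S + ennreal e"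
      by (simp add: w_def)
  qed
qed

subsection \<open>Compactness\<close>

text \<open>The average of \<open>shift_diff\<close> over a ball, not normalised by the
  volume.\<close>

definition ball_shift :: "'a::euclidean_space set \<Rightarrow> real \<Rightarrow> ennreal" where
  "ball_shift E t = (\<integral>\<^sup>+z. indicator (ball 0 t) z * shift_diff E z \<partial>lborel)"

text \<open>Scaling by 2 gives 2^d from the change of variables, and subadditivity one more factor
  2.\<close>

lemma ball_shift_double:
  fixes E :: "'a::euclidean_space set"
  assumes [measurable]: "E \<in> sets borel"
  shows "ball_shift E (2 * t) \<le> ennreal (2 ^ Suc DIM('a)) * ball_shift E t"
proof -
  have "ball_shift E (2 * t) = ennreal (2 ^ DIM('a)) * (\<integral>\<^sup>+z. indicator (ball 0 (2 * t)) (2 *\<^sub>R z) * shift_diff E (2 *\<^sub>R z) \<partial>lborel)"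
    unfolding ball_shift_def
    using nn_integral_lborel_affine[of "\<lambda>z. indicator (ball 0 (2 * t)) z * shift_diff E z" 2 0] by simp
  also have "\<dots> \<le> ennreal (2 ^ DIM('a)) * (\<integral>\<^sup>+z. 2 * (indicator (ball 0 t) z * shift_diff E z) \<partial>lborel)"
  proof (intro mult_left_mono nn_integral_mono)
    fix z :: 'a
    have "shift_diff E (2 *\<^sub>R z) \<le> 2 * shift_diff E z"
      using shift_diff_add[OF assms, of z z] by (simp add: scaleR_2 mult_2)
    then show "indicator (ball 0 (2 * t)) (2 *\<^sub>R z) * shift_diff E (2 *\<^sub>R z) \<le> 2 * (indicator (ball 0 t) z * shift_diff E z)"
      by (auto simp: indicator_def)
  qed simp
  also have "\<dots> = ennreal (2 ^ Suc DIM('a)) * ball_shift E t"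
    unfolding ball_shift_def by (subst nn_integral_cmult) (auto simp: ennreal_mult mult_ac)
  finally show ?thesis .
qed

lemma ball_shift_dyadic:
  fixes E :: "'a::euclidean_space set"
  assumes "E \<in> sets borel"
  shows "ball_shift E \<delta> \<le> ennreal ((2 ^ Suc DIM('a)) ^ j) * ball_shift E (\<delta> / 2 ^ j)"
proof (induction j)
  case (Suc j)
  have pow: "ennreal ((2 ^ Suc DIM('a)) ^ Suc j) = ennreal ((2 ^ Suc DIM('a)) ^ j) * ennreal (2 ^ Suc DIM('a))"
    by (subst ennreal_mult[symmetric]) (auto simp: mult.commute)
  have "ball_shift E (\<delta> / 2 ^ j) \<le> ennreal (2 ^ Suc DIM('a)) * ball_shift E (\<delta> / 2 ^ Suc j)"
    using ball_shift_double[OF assms, of "\<delta> / 2 ^ Suc j"] by simp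
  then have "ennreal ((2 ^ Suc DIM('a)) ^ j) * ball_shift E (\<delta> / 2 ^ j) \<le> ennreal ((2 ^ Suc DIM('a)) ^ j) * (ennreal (2 ^ Suc DIM('a)) * ball_shift E (\<delta> / 2 ^ Suc j))"
    by (rule mult_left_mono) simp
  also have "\<dots> = ennreal ((2 ^ Suc DIM('a)) ^ Suc j) * ball_shift E (\<delta> / 2 ^ Suc j)"
    by (simp only: pow mult.assoc)
  finally show ?case using Suc by (rule order_trans[rotated])
qed simp

text \<open>Consecutive terms grow by the factor 2^p, at least 2, so the last term dominates all
  earlier ones together.\<close>

lemma dyadic_powr_sum_le:
  fixes p \<delta> :: real
  assumes p: "p \<ge> 1" and d: "\<delta> > 0"
  shows "(\<Sum>j\<le>n. (\<delta> / 2 ^ j) powr (- p)) \<le> 2 * (\<delta> / 2 ^ n) powr (- p)"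
proof (induction n)
  case (Suc n)
  have "(\<delta> / 2 ^ Suc n) powr (- p) = (\<delta> / 2 ^ n) powr (- p) * (1/2) powr (- p)"
    using d by (subst powr_mult[symmetric]) (auto simp: field_simps)
  moreover have "(1/2 :: real) powr (- p) = 2 powr p" by (simp add: powr_divide powr_minus)
  moreover have "(2::real) powr p \<ge> 2 powr 1" using p by (intro powr_mono) auto
  ultimately have "(\<delta> / 2 ^ Suc n) powr (- p) \<ge> 2 * (\<delta> / 2 ^ n) powr (- p)" using d
    by (simp add: mult.commute mult_left_mono)
  then show ?case using Suc by simp
qed simp

text \<open>A sum of weights on nested dyadic balls lies below the kernel. At x only the balls of
  radius above x count, and their weights add up to at most twice that of the smallest one. As all
  radii are at least \<open>r\<close>, the plateau does not spoil the comparison. The induction adds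
  the smallest ball: either x lies in all balls or the new term vanishes.\<close>

lemma dyadic_kern_le:
  assumes s: "s \<ge> 1" and d: "\<delta> > 0" and r: "0 < r" "r \<le> \<delta> / 2 ^ n" and x: "0 \<le> x"
  shows "(\<Sum>j\<le>n. indicator {..<\<delta> / 2 ^ j} x * (\<delta> / 2 ^ j) powr (- real k - s)) \<le> 2 * kern k s r x"
  using r(2)
proof (induction n)
  case 0
  have le: "\<delta> powr (- real k - s) \<le> kern k s r x" if "x < \<delta>"
    using that 0 r s by (auto simp: kern_def intro!: powr_mono2')
  have "indicator {..<\<delta>} x * \<delta> powr (- real k - s) \<le> 2 * kern k s r x"
  proof (cases "x < \<delta>")
    case True
    then show ?thesis using le[OF True] kern_nonneg[of k s r x] by (simp del: kern_nonneg)
  qed simp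
  then show ?case by simp
next
  case (Suc n)
  have "\<delta> / 2 ^ Suc n \<le> \<delta> / 2 ^ n" using d by (intro divide_left_mono) auto
  then have IH: "(\<Sum>j\<le>n. indicator {..<\<delta> / 2 ^ j} x * (\<delta> / 2 ^ j) powr (- real k - s)) \<le> 2 * kern k s r x"
    using Suc by (intro Suc.IH) linarith
  show ?case
  proof (cases "x < \<delta> / 2 ^ Suc n")
    case True
    have "(\<Sum>j\<le>Suc n. indicator {..<\<delta> / 2 ^ j} x * (\<delta> / 2 ^ j) powr (- real k - s)) \<le> (\<Sum>j\<le>Suc n. (\<delta> / 2 ^ j) powr (- (real k + s)))"
      by (intro sum_mono) (auto simp: indicator_def)
    also have "\<dots> \<le> 2 * (\<delta> / 2 ^ Suc n) powr (- (real k + s))" by (rule dyadic_powr_sum_le) (use s d in auto)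
    also have "(\<delta> / 2 ^ Suc n) powr (- (real k + s)) = (\<delta> / 2 ^ Suc n) powr (- real k - s)" by simp
    also have "\<dots> \<le> kern k s r x" using True Suc.prems r s by (auto simp: kern_def intro!: powr_mono2')
    finally show ?thesis by simp
  qed (use IH in simp)
qed

text \<open>The weight at scale j is larger than that at scale 0 by 2^(j(d+s)); passing to that
  scale by doubling loses 2^(j(d+1)), and 2^((s-1)j) is left. The factor 4 combines the 2 of
  \<open>dyadic_kern_le\<close> with that of \<open>twice_Jt\<close>.\<close>

lemma ball_shift_le_Jt:
  fixes E :: "'a::euclidean_space set"
  assumes [measurable]: "E \<in> sets borel" and s: "s \<ge> 1" and d: "\<delta> > 0" and r: "0 < r" "r \<le> \<delta> / 2 ^ n"
  shows "ball_shift E \<delta> * ennreal (\<delta> powr (- real DIM('a) - s) * (\<Sum>j\<le>n. 2 powr ((s - 1) * real j))) \<le> 4 * Jt s r E"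
proof -
  let ?d = "DIM('a)"
  let ?a = "\<lambda>j. (\<delta> / 2 ^ j) powr (- real ?d - s)"
  have coef: "?a j / (2 ^ Suc ?d) ^ j = \<delta> powr (- real ?d - s) * 2 powr ((s - 1) * real j)" for j
  proof -
    have "?a j = \<delta> powr (- real ?d - s) / (2 powr real j) powr (- real ?d - s)"
      using d by (simp add: powr_divide powr_realpow)
    also have "\<dots> = \<delta> powr (- real ?d - s) * 2 powr (real j * (real ?d + s))"
      by (simp add: powr_powr powr_minus divide_inverse algebra_simps flip: powr_minus)
    finally have "?a j = \<delta> powr (- real ?d - s) * 2 powr (real j * (real ?d + s))" .
    moreover have "((2::real) ^ Suc ?d) ^ j = 2 powr (real j * (real ?d + 1))"
      by (simp add: power_mult[symmetric] powr_realpow[symmetric] powr_powr algebra_simps del: power_Suc)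
    ultimately have "?a j / (2 ^ Suc ?d) ^ j = \<delta> powr (- real ?d - s) * (2 powr (real j * (real ?d + s)) / 2 powr (real j * (real ?d + 1)))" by simp
    also have "2 powr (real j * (real ?d + s)) / 2 powr (real j * (real ?d + 1)) = 2 powr (real j * (real ?d + s) - real j * (real ?d + 1))"
      by (rule powr_diff[symmetric])
    also have "real j * (real ?d + s) - real j * (real ?d + 1) = (s - 1) * real j" by (simp add: algebra_simps)
    finally show ?thesis .
  qed
  have each: "ball_shift E \<delta> * ennreal (\<delta> powr (- real ?d - s) * 2 powr ((s - 1) * real j)) \<le> ennreal (?a j) * ball_shift E (\<delta> / 2 ^ j)" for j
  proof -
    have "ball_shift E \<delta> * ennreal (?a j / (2 ^ Suc ?d) ^ j) \<le> (ennreal ((2 ^ Suc ?d) ^ j) * ball_shift E (\<delta> / 2 ^ j)) * ennreal (?a j / (2 ^ Suc ?d) ^ j)"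
      by (intro mult_right_mono ball_shift_dyadic) auto
    also have "\<dots> = ennreal ((2 ^ Suc ?d) ^ j * (?a j / (2 ^ Suc ?d) ^ j)) * ball_shift E (\<delta> / 2 ^ j)"
      by (subst ennreal_mult) (auto simp: mult_ac)
    also have "(2 ^ Suc ?d) ^ j * (?a j / (2 ^ Suc ?d) ^ j) = ?a j" by simp
    finally show ?thesis unfolding coef .
  qed
  have "ball_shift E \<delta> * ennreal (\<delta> powr (- real ?d - s) * (\<Sum>j\<le>n. 2 powr ((s - 1) * real j)))
     = (\<Sum>j\<le>n. ball_shift E \<delta> * ennreal (\<delta> powr (- real ?d - s) * 2 powr ((s - 1) * real j)))"
    by (simp add: sum_distrib_left[symmetric] sum_ennreal)
  also have "\<dots> \<le> (\<Sum>j\<le>n. ennreal (?a j) * ball_shift E (\<delta> / 2 ^ j))" by (intro sum_mono each)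
  also have "\<dots> = (\<integral>\<^sup>+z. (\<Sum>j\<le>n. ennreal (?a j) * (indicator (ball 0 (\<delta> / 2 ^ j)) z * shift_diff E z)) \<partial>lborel)"
    unfolding ball_shift_def by (subst nn_integral_sum) (auto simp: nn_integral_cmult)
  also have "\<dots> \<le> (\<integral>\<^sup>+z. 2 * (ennreal (kern ?d s r (norm z)) * shift_diff E z) \<partial>lborel)"
  proof (rule nn_integral_mono)
    fix z :: 'a
    have "(\<Sum>j\<le>n. ennreal (?a j) * (indicator (ball 0 (\<delta> / 2 ^ j)) z * shift_diff E z))
       = (\<Sum>j\<le>n. ennreal (indicator {..<\<delta> / 2 ^ j} (norm z) * ?a j) * shift_diff E z)"
      by (intro sum.cong refl) (auto simp: indicator_def)
    also have "\<dots> = ennreal (\<Sum>j\<le>n. indicator {..<\<delta> / 2 ^ j} (norm z) * ?a j) * shift_diff E z"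
      unfolding sum_distrib_right[symmetric]
      by (rule arg_cong[where f = "\<lambda>t. t * shift_diff E z"], rule sum_ennreal) simp
    also have "\<dots> \<le> ennreal (2 * kern ?d s r (norm z)) * shift_diff E z"
      by (intro mult_right_mono ennreal_leI dyadic_kern_le s d r) auto
    also have "\<dots> = 2 * (ennreal (kern ?d s r (norm z)) * shift_diff E z)" by (simp add: ennreal_mult mult_ac)
    finally show "(\<Sum>j\<le>n. ennreal (?a j) * (indicator (ball 0 (\<delta> / 2 ^ j)) z * shift_diff E z)) \<le> 2 * (ennreal (kern ?d s r (norm z)) * shift_diff E z)" .
  qed
  also have "\<dots> = 2 * (2 * Jt s r E)" unfolding twice_Jt[OF assms(1)] by (rule nn_integral_cmult) measurable
  finally show ?thesis by (simp add: mult.assoc[symmetric])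
qed

text \<open>The number of dyadic scales between \<open>r\<close> and \<delta> is fixed by
  \<delta>/2^(n+1) < r \<le> \<delta>/2^n. The constant \<open>c\<close> must not depend on
  \<delta>, since it determines the rate of the mollification error; only the threshold
  \<open>r0\<close> does.\<close>

lemma dyadic_sum_ge_sigma:
  assumes s: "s \<ge> 1"
  obtains c where "c > 0"
    "\<And>\<delta>. \<delta> > 0 \<Longrightarrow> \<exists>r0>0. \<forall>r. 0 < r \<and> r < r0 \<longrightarrow> (\<exists>n. r \<le> \<delta> / 2 ^ n \<and> c * \<delta> powr (s - 1) * sigma d s r \<le> (\<Sum>j\<le>n. 2 powr ((s - 1) * real j)))"
proof -
  have ex: "\<exists>n. r \<le> \<delta> / 2 ^ n \<and> \<delta> / 2 ^ Suc n < r" if "0 < r" "r < \<delta>" for r \<delta> :: real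
  proof -
    define n where "n = (LEAST n. \<delta> / 2 ^ Suc n < r)"
    obtain k where "\<delta> / r < 2 ^ k" using real_arch_pow[of 2 "\<delta> / r"] by auto
    moreover have "(2::real) ^ k \<le> 2 ^ Suc k" by simp
    ultimately have "\<delta> / r < 2 ^ Suc k" by linarith
    then have "\<delta> / 2 ^ Suc k < r" using that by (simp add: field_simps)
    then have n: "\<delta> / 2 ^ Suc n < r" unfolding n_def by (rule LeastI)
    have "r \<le> \<delta> / 2 ^ n"
    proof (cases n)
      case (Suc m)
      then have "m < n" by simp
      then have "\<not> \<delta> / 2 ^ Suc m < r" unfolding n_def by (rule not_less_Least)
      then show ?thesis using Suc by simp
    qed (use that in simp)
    then show ?thesis using n by blast
  qed
  show ?thesis
  proof (cases "s = 1")
    case True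
    show ?thesis
    proof (rule that[of "1/2"])
      fix \<delta> :: real assume d: "\<delta> > 0"
      show "\<exists>r0>0. \<forall>r. 0 < r \<and> r < r0 \<longrightarrow> (\<exists>n. r \<le> \<delta> / 2 ^ n \<and> 1/2 * \<delta> powr (s - 1) * sigma d s r \<le> (\<Sum>j\<le>n. 2 powr ((s - 1) * real j)))"
      \<comment> \<open>For s = 1 the sum is n + 1, which exceeds ln \<delta> - ln r because ln 2 <
        1. The condition r < \<delta>^2 makes this difference at least |ln r|/2.\<close>
      proof (intro exI[of _ "min \<delta> (min 1 (\<delta>\<^sup>2))"] conjI allI impI)
        show "0 < min \<delta> (min 1 (\<delta>\<^sup>2))" using d by simp
        fix r assume "0 < r \<and> r < min \<delta> (min 1 (\<delta>\<^sup>2))"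
        then have r: "0 < r" "r < \<delta>" "r < 1" "r < \<delta>\<^sup>2" by auto
        obtain n where n: "r \<le> \<delta> / 2 ^ n" "\<delta> / 2 ^ Suc n < r" using ex r by blast
        have "\<delta> < r * 2 ^ Suc n" using n(2) by (simp add: field_simps)
        then have "ln \<delta> < ln (r * 2 ^ Suc n)" using d r by (intro ln_less_cancel_iff[THEN iffD2]) auto
        also have "\<dots> = ln r + real (Suc n) * ln 2" using r by (simp add: ln_mult ln_realpow del: power_Suc of_nat_Suc)
        also have "real (Suc n) * ln 2 \<le> real (Suc n) * 1" using ln_2_less_1 by (intro mult_left_mono) auto
        finally have 1: "ln \<delta> - ln r < real (Suc n)" by simp
        have "ln r < ln (\<delta>\<^sup>2)" using r d by (intro ln_less_cancel_iff[THEN iffD2]) auto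
        then have "ln r < 2 * ln \<delta>" using d by (simp add: ln_realpow)
        then have "1/2 * \<bar>ln r\<bar> \<le> real (Suc n)" using 1 r by (simp add: abs_if)
        then show "\<exists>n. r \<le> \<delta> / 2 ^ n \<and> 1/2 * \<delta> powr (s - 1) * sigma d s r \<le> (\<Sum>j\<le>n. 2 powr ((s - 1) * real j))"
          using n(1) d by (intro exI[of _ n]) (simp add: True sigma_def)
      qed
    qed simp
  next
    case False
    then have s1: "s > 1" using s by simp
    define \<kappa> where "\<kappa> = (real d + s) / (real d + 1) / (s - 1)"
    have \<kappa>: "\<kappa> > 0" using s1 by (auto simp: \<kappa>_def intro!: divide_pos_pos)
    show ?thesis
    \<comment> \<open>For s > 1 the last term suffices: 2^n is greater than \<delta>/(2r), and
      \<open>\<kappa>\<close> is the coefficient of r^(1-s) in \<open>sigma\<close>.\<close>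
    proof (rule that[of "2 powr (1 - s) / \<kappa>"])
      show "2 powr (1 - s) / \<kappa> > 0" using \<kappa> by simp
      fix \<delta> :: real assume d: "\<delta> > 0"
      show "\<exists>r0>0. \<forall>r. 0 < r \<and> r < r0 \<longrightarrow> (\<exists>n. r \<le> \<delta> / 2 ^ n \<and> 2 powr (1 - s) / \<kappa> * \<delta> powr (s - 1) * sigma d s r \<le> (\<Sum>j\<le>n. 2 powr ((s - 1) * real j)))"
      proof (intro exI[of _ \<delta>] conjI allI impI d)
        fix r assume "0 < r \<and> r < \<delta>"
        then have r: "0 < r" "r < \<delta>" by auto
        obtain n where n: "r \<le> \<delta> / 2 ^ n" "\<delta> / 2 ^ Suc n < r" using ex r by blast
        have "sigma d s r = \<kappa> * r powr (1 - s)" using False by (simp add: sigma_def \<kappa>_def)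
        then have "2 powr (1 - s) / \<kappa> * \<delta> powr (s - 1) * sigma d s r = 2 powr (1 - s) * r powr (1 - s) * \<delta> powr (s - 1)"
          using \<kappa> by simp
        also have "\<dots> = (2 * r) powr (1 - s) * \<delta> powr (s - 1)" using r by (simp add: powr_mult)
        also have "\<dots> = (\<delta> / (2 * r)) powr (s - 1)"
        proof -
          have "(2 * r) powr (1 - s) = 1 / (2 * r) powr (s - 1)" using powr_minus_divide[of "2 * r" "s - 1"] by simp
          then show ?thesis using d r by (simp add: powr_divide)
        qed
        also have "\<dots> \<le> (2 ^ n) powr (s - 1)"
          using n(2) d r s1 by (intro powr_mono2) (auto simp: field_simps)
        also have "(2 ^ n) powr (s - 1) = 2 powr ((s - 1) * real n)" by (simp add: powr_realpow[symmetric] powr_powr mult.commute)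
        also have "\<dots> \<le> (\<Sum>j\<le>n. 2 powr ((s - 1) * real j))" by (rule member_le_sum) auto
        finally show "\<exists>n. r \<le> \<delta> / 2 ^ n \<and> 2 powr (1 - s) / \<kappa> * \<delta> powr (s - 1) * sigma d s r \<le> (\<Sum>j\<le>n. 2 powr ((s - 1) * real j))"
          using n(1) by blast
      qed
    qed
  qed
qed

text \<open>The energy bound gives \<open>ball_shift\<close> of order \<delta>^(d+1), and the
  mollifier is at most of order \<delta>^(-d), so the error is O(\<delta>). The constant serves all
  \<delta>, while the index from which the estimate holds depends on \<delta>.\<close>

lemma mollification_error_bound:
  fixes En :: "nat \<Rightarrow> 'a::euclidean_space set" and M :: real
  assumes mn: "\<And>n. En n \<in> sets borel" and fin: "\<And>n. emeasure lborel (En n) < \<infinity>"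
    and s: "s \<ge> 1" and r: "\<forall>n. r n > 0" "r \<longlonglongrightarrow> 0"
    and J: "\<And>n. Jt s (r n) (En n) \<le> ennreal (M * sigma DIM('a) s (r n))" and M: "M \<ge> 0"
  obtains K where "K \<ge> 0" "\<And>\<delta>. \<delta> > 0 \<Longrightarrow>
    eventually (\<lambda>n. (\<integral>\<^sup>+x. ennreal \<bar>convol (moll \<delta>) (indicator (En n)) x - indicator (En n) x\<bar> \<partial>lborel) \<le> ennreal (K * \<delta>)) sequentially"
proof -
  let ?d = "DIM('a)"
  obtain c where c: "c > 0"
    "\<And>\<delta>. \<delta> > 0 \<Longrightarrow> \<exists>r0>0. \<forall>r. 0 < r \<and> r < r0 \<longrightarrow> (\<exists>n. r \<le> \<delta> / 2 ^ n \<and> c * \<delta> powr (s - 1) * sigma ?d s r \<le> (\<Sum>j\<le>n. 2 powr ((s - 1) * real j)))"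
    using dyadic_sum_ge_sigma[OF s] by metis
  define b where "b = 16/9 * 2 ^ ?d / unit_ball_vol (real ?d)"
  have b: "b > 0" by (simp add: b_def)
  show ?thesis
  proof (rule that[of "b * (4 * M / c)"])
    show "b * (4 * M / c) \<ge> 0" using b M c by simp
    fix \<delta> :: real assume d: "\<delta> > 0"
    obtain r0 where r0: "r0 > 0" "\<And>r. 0 < r \<Longrightarrow> r < r0 \<Longrightarrow> (\<exists>n. r \<le> \<delta> / 2 ^ n \<and> c * \<delta> powr (s - 1) * sigma ?d s r \<le> (\<Sum>j\<le>n. 2 powr ((s - 1) * real j)))"
      using c(2)[OF d] by blast
    have ev1: "eventually (\<lambda>n. r n < r0) sequentially" using order_tendstoD(2)[OF r(2) r0(1)] .
    have ev2: "eventually (\<lambda>n. sigma ?d s (r n) > 0) sequentially" by (rule eventually_sigma_gt[OF s r])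
    show "eventually (\<lambda>n. (\<integral>\<^sup>+x. ennreal \<bar>convol (moll \<delta>) (indicator (En n)) x - indicator (En n) x\<bar> \<partial>lborel) \<le> ennreal (b * (4 * M / c) * \<delta>)) sequentially"
      using ev1 ev2
    proof eventually_elim
      case (elim n)
      have [measurable]: "En n \<in> sets borel" by (rule mn)
      let ?\<sigma> = "sigma ?d s (r n)"
      obtain N where N: "r n \<le> \<delta> / 2 ^ N" "c * \<delta> powr (s - 1) * ?\<sigma> \<le> (\<Sum>j\<le>N. 2 powr ((s - 1) * real j))"
        using r0(2)[of "r n"] elim r(1) by auto
      \<comment> \<open>The powers of \<delta> combine to \<delta>^(-d-1), whatever s is;
        \<open>sigma\<close> cancels against the one in the energy bound.\<close>
      define q where "q = \<delta> powr (- real ?d - s) * (c * \<delta> powr (s - 1) * ?\<sigma>)"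
      have q: "q > 0" using c d elim by (simp add: q_def)
      have "ball_shift (En n) \<delta> * ennreal q \<le> ball_shift (En n) \<delta> * ennreal (\<delta> powr (- real ?d - s) * (\<Sum>j\<le>N. 2 powr ((s - 1) * real j)))"
        unfolding q_def by (intro mult_left_mono ennreal_leI N) auto
      also have "\<dots> \<le> 4 * Jt s (r n) (En n)" by (rule ball_shift_le_Jt[OF mn s d _ N(1)]) (use r in auto)
      also have "\<dots> \<le> 4 * ennreal (M * ?\<sigma>)" by (intro mult_left_mono J) simp
      also have "\<dots> = ennreal (4 * (M * ?\<sigma>))" using M elim by (simp add: ennreal_mult)
      finally have "ball_shift (En n) \<delta> * ennreal q / ennreal q \<le> ennreal (4 * (M * ?\<sigma>)) / ennreal q"
        by (rule divide_right_mono_ennreal)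
      moreover have "ball_shift (En n) \<delta> * ennreal q / ennreal q = ball_shift (En n) \<delta>"
        using q by (intro mult_divide_eq_ennreal) auto
      ultimately have "ball_shift (En n) \<delta> \<le> ennreal (4 * (M * ?\<sigma>)) / ennreal q" by simp
      also have "\<dots> = ennreal (4 * (M * ?\<sigma>) / q)" using M elim q by (intro divide_ennreal) auto
      also have "4 * (M * ?\<sigma>) / q = 4 * M / c * \<delta> ^ Suc ?d"
      proof -
        have "\<delta> powr (- real ?d - s) * \<delta> powr (s - 1) * \<delta> ^ Suc ?d = 1"
          using d by (simp add: powr_realpow[symmetric] powr_add[symmetric] del: power_Suc)
        then have "4 * M / c * \<delta> ^ Suc ?d * q = 4 * (M * ?\<sigma>)" using c by (simp add: q_def mult_ac)
        then show ?thesis using q by (metis nonzero_mult_div_cancel_right less_irrefl)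
      qed
      finally have S: "ball_shift (En n) \<delta> \<le> ennreal (4 * M / c * \<delta> ^ Suc ?d)" .
      have "(\<integral>\<^sup>+x. ennreal \<bar>convol (moll \<delta>) (indicator (En n)) x - indicator (En n) x\<bar> \<partial>lborel) \<le> (\<integral>\<^sup>+w. ennreal (moll \<delta> w) * shift_diff (En n) w \<partial>lborel)"
        by (rule nn_integral_convol_dist_le[OF d mn fin])
      also have "\<dots> \<le> (\<integral>\<^sup>+w. ennreal (b / \<delta> ^ ?d) * (indicator (ball 0 \<delta>) w * shift_diff (En n) w) \<partial>lborel)"
      proof (rule nn_integral_mono)
        fix w :: 'a
        have "moll \<delta> w \<le> b / \<delta> ^ ?d" using moll_le[OF d, of w] by (simp add: b_def)
        then show "ennreal (moll \<delta> w) * shift_diff (En n) w \<le> ennreal (b / \<delta> ^ ?d) * (indicator (ball 0 \<delta>) w * shift_diff (En n) w)"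
          using moll_eq_0[OF d, of w] by (cases "norm w < \<delta>") (auto intro!: mult_right_mono ennreal_leI)
      qed
      also have "\<dots> = ennreal (b / \<delta> ^ ?d) * ball_shift (En n) \<delta>"
        unfolding ball_shift_def by (rule nn_integral_cmult) measurable
      also have "\<dots> \<le> ennreal (b / \<delta> ^ ?d) * ennreal (4 * M / c * \<delta> ^ Suc ?d)" by (rule mult_left_mono[OF S]) simp
      also have "\<dots> = ennreal (b / \<delta> ^ ?d * (4 * M / c * \<delta> ^ Suc ?d))"
        using b d M c by (intro ennreal_mult[symmetric]) auto
      also have "b / \<delta> ^ ?d * (4 * M / c * \<delta> ^ Suc ?d) = b * (4 * M / c) * \<delta>"
        using d by simp
      finally show ?case .
    qed
  qed
qed

section \<open>Precompactness of mollified indicators and completeness of sets in L1\<close>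

lemma abs_convol_moll_le_1:
  assumes d: "\<delta> > 0" and [measurable]: "E \<in> sets borel" and E: "emeasure lborel E < \<infinity>"
  shows "\<bar>convol (moll \<delta>) (indicator E) (x::'a::euclidean_space)\<bar> \<le> 1"
proof -
  have m: "Cc (moll \<delta> :: 'a \<Rightarrow> real)" by (rule moll_Cc(1)[OF d])
  have [measurable]: "(moll \<delta> :: 'a \<Rightarrow> real) \<in> borel_measurable borel" by (rule Cc_measurable[OF m])
  have "integrable lborel (indicator E :: 'a \<Rightarrow> real)" using E by simp
  then have i: "integrable lborel (\<lambda>y. indicator E y *\<^sub>R moll \<delta> (x - y))" by (rule convol_integrable[OF m])
  have "ennreal \<bar>convol (moll \<delta>) (indicator E) x\<bar> \<le> (\<integral>\<^sup>+y. ennreal (norm (indicator E y *\<^sub>R moll \<delta> (x - y))) \<partial>lborel)"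
    using integral_norm_bound_ennreal[OF i] by (simp add: convol_def)
  also have "\<dots> \<le> (\<integral>\<^sup>+y. ennreal (moll \<delta> (x - y)) \<partial>lborel)"
    using moll_nonneg[OF d, where 'a = 'a] by (intro nn_integral_mono) (auto simp: indicator_def)
  also have "\<dots> = 1" using nn_integral_lborel_reflect[of "\<lambda>y. ennreal (moll \<delta> y)" x] by (simp add: moll_nn_integral[OF d])
  finally show ?thesis by simp
qed

text \<open>Completeness with a set as limit. Along a subsequence whose consecutive distances are
  summable, the set-theoretic lower limit does it; being contained in the union of the given sets,
  it inherits their boundedness.\<close>

lemma L1_Cauchy_sets_subseq:
  fixes F :: "nat \<Rightarrow> 'a::euclidean_space set"
  assumes mF: "\<And>n. F n \<in> sets borel"
    and cau: "\<And>e::real. e > 0 \<Longrightarrow> \<exists>N. \<forall>m\<ge>N. \<forall>n\<ge>N. (\<integral>\<^sup>+x. ennreal \<bar>indicator (F m) x - indicator (F n) x\<bar> \<partial>lborel) \<le> ennreal e"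
  obtains g E where "strict_mono (g :: nat \<Rightarrow> nat)" "E \<in> sets borel" "E \<subseteq> (\<Union>n. F n)"
    "(\<lambda>i. \<integral>\<^sup>+x. ennreal \<bar>indicator (F (g i)) x - indicator E x\<bar> \<partial>lborel) \<longlonglongrightarrow> 0"
proof -
  define D where "D m n = (\<integral>\<^sup>+x. ennreal \<bar>indicator (F m) x - indicator (F n) x\<bar> \<partial>lborel)" for m n
  have "\<exists>N. \<forall>m\<ge>N. \<forall>n\<ge>N. D m n \<le> ennreal ((1/2) ^ i)" for i :: nat
    unfolding D_def by (rule cau) simp
  then obtain N where N: "\<And>i m n. m \<ge> N i \<Longrightarrow> n \<ge> N i \<Longrightarrow> D m n \<le> ennreal ((1/2) ^ i)" by metis
  \<comment> \<open>The partial sums make \<open>g\<close> strictly increasing and keep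
    \<open>g i\<close> above \<open>N i\<close>.\<close>
  define g where "g i = i + (\<Sum>j\<le>i. N j)" for i
  have g: "strict_mono g" unfolding strict_mono_Suc_iff by (simp add: g_def)
  have gN: "g i \<ge> N i" for i using member_le_sum[of i "{..i}" N] by (simp add: g_def)
  have gD: "D (g i) (g (Suc i)) \<le> ennreal ((1/2) ^ i)" for i
    by (rule N[OF gN]) (meson gN g le_trans less_imp_le strict_monoD lessI)
  define H where "H i = F (g i)" for i
  have [measurable]: "H i \<in> sets borel" for i by (simp add: H_def mF)
  define E where "E = (\<Union>i. \<Inter>j\<in>{i..}. H j)"
  have [measurable]: "E \<in> sets borel" unfolding E_def by measurable
  \<comment> \<open>If membership of \<open>x\<close> never changes after stage \<open>i\<close>,
    then it agrees with membership in \<open>E\<close>; otherwise some term of the series is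
    1.\<close>
  have pt: "ennreal \<bar>indicator (H i) x - indicator E x\<bar> \<le> (\<Sum>j. ennreal \<bar>indicator (H (j + i)) x - indicator (H (Suc (j + i))) x\<bar>)" for i x
  proof (cases "\<forall>j. (x \<in> H (j + i)) = (x \<in> H (Suc (j + i)))")
    case True
    have all: "(x \<in> H (j + i)) = (x \<in> H i)" for j by (induction j) (use True in auto)
    have "(x \<in> E) = (x \<in> H i)"
    proof
      assume "x \<in> E"
      then obtain k where k: "\<And>j. j \<ge> k \<Longrightarrow> x \<in> H j" by (auto simp: E_def)
      have "x \<in> H (k + i)" by (rule k) simp
      then show "x \<in> H i" using all by simp
    next
      assume "x \<in> H i"
      then have "x \<in> H j" if "j \<ge> i" for j using all[of "j - i"] that by simp
      then show "x \<in> E" by (auto simp: E_def)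
    qed
    then show ?thesis by (simp add: indicator_def)
  next
    case False
    then obtain j where "(x \<in> H (j + i)) \<noteq> (x \<in> H (Suc (j + i)))" by blast
    define f where "f j = ennreal \<bar>indicator (H (j + i)) x - indicator (H (Suc (j + i))) x\<bar>" for j
    have "ennreal \<bar>indicator (H i) x - indicator E x\<bar> \<le> 1" by (simp add: indicator_def)
    also have "1 \<le> f j" using \<open>(x \<in> H (j + i)) \<noteq> (x \<in> H (Suc (j + i)))\<close> by (auto simp: f_def indicator_def)
    also have "f j = sum f {j}" by simp
    also have "\<dots> \<le> suminf f" by (rule sum_le_suminf) auto
    finally show ?thesis by (simp add: f_def[abs_def])
  qed
  have bound: "(\<integral>\<^sup>+x. ennreal \<bar>indicator (H i) x - indicator E x\<bar> \<partial>lborel) \<le> ennreal (2 * (1/2) ^ i)" for i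
  proof -
    have "(\<integral>\<^sup>+x. ennreal \<bar>indicator (H i) x - indicator E x\<bar> \<partial>lborel) \<le> (\<integral>\<^sup>+x. (\<Sum>j. ennreal \<bar>indicator (H (j + i)) x - indicator (H (Suc (j + i))) x\<bar>) \<partial>lborel)"
      by (intro nn_integral_mono pt)
    also have "\<dots> = (\<Sum>j. \<integral>\<^sup>+x. ennreal \<bar>indicator (H (j + i)) x - indicator (H (Suc (j + i))) x\<bar> \<partial>lborel)"
      by (rule nn_integral_suminf) measurable
    also have "\<dots> \<le> (\<Sum>j. ennreal ((1/2) ^ (j + i)))"
      using gD unfolding D_def H_def by (intro suminf_le) auto
    also have "\<dots> = ennreal (\<Sum>j. (1/2) ^ (j + i))"
      by (rule suminf_ennreal2) (auto simp: power_add intro!: summable_mult2 summable_geometric)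
    also have "(\<Sum>j. (1/2::real) ^ (j + i)) = 2 * (1/2) ^ i"
      using suminf_mult2[OF summable_geometric[of "1/2::real"], of "(1/2) ^ i"] by (simp add: power_add suminf_geometric)
    finally show ?thesis .
  qed
  have "(\<lambda>i. \<integral>\<^sup>+x. ennreal \<bar>indicator (H i) x - indicator E x\<bar> \<partial>lborel) \<longlonglongrightarrow> 0"
  proof (rule tendsto_sandwich[OF _ _ tendsto_const])
    have "(\<lambda>i. ennreal (2 * (1/2) ^ i)) \<longlonglongrightarrow> ennreal (2 * 0)"
      by (intro tendsto_ennrealI tendsto_mult tendsto_const LIMSEQ_realpow_zero) auto
    then show "(\<lambda>i. ennreal (2 * (1/2) ^ i)) \<longlonglongrightarrow> 0" by simp
  qed (auto intro!: always_eventually bound)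
  moreover have "E \<subseteq> (\<Union>n. F n)" unfolding E_def H_def by blast
  ultimately show ?thesis using that[OF g, of E] by (simp add: H_def)
qed

text \<open>Equicontinuity: the mollified indicators share a modulus of continuity, that of the
  mollifier times the measure bound, so convergence spreads from a dense set to every point.\<close>

lemma convol_moll_pointwise_Cauchy:
  fixes F :: "nat \<Rightarrow> 'a::euclidean_space set"
  assumes d: "\<delta> > 0" and mF: "\<And>n. F n \<in> sets borel" and m: "\<And>n. emeasure lborel (F n) \<le> ennreal m" "m \<ge> 0"
    and dense: "\<And>X. open X \<Longrightarrow> X \<noteq> {} \<Longrightarrow> \<exists>t\<in>T. t \<in> X"
    and conv: "\<And>t. t \<in> T \<Longrightarrow> convergent (\<lambda>n. convol (moll \<delta>) (indicator (F n)) t)"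
  shows "convergent (\<lambda>n. convol (moll \<delta>) (indicator (F n)) (x::'a))"
proof -
  let ?v = "\<lambda>n. convol (moll \<delta>) (indicator (F n)) :: 'a \<Rightarrow> real"
  have i: "integrable lborel (indicator (F n) :: 'a \<Rightarrow> real)" for n
    using mF m(1)[of n] by (simp add: le_less_trans)
  have mes: "(\<integral>y. \<bar>indicator (F n) y\<bar> \<partial>lborel) \<le> m" for n
    using mF m by (simp add: measure_def enn2real_leI)
  have "Cauchy (\<lambda>n. ?v n x)"
  proof (rule metric_CauchyI)
    fix e :: real assume e: "e > 0"
    have "e / (3 * (m + 1)) > 0" using e m by simp
    then obtain \<rho> where \<rho>: "\<rho> > 0" "\<And>x y. norm (y - x) < \<rho> \<Longrightarrow> norm (moll \<delta> y - moll \<delta> (x::'a)) < e / (3 * (m + 1))"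
      using Cc_uniformly_continuous[OF moll_Cc(1)[OF d]] by metis
    obtain t where t: "t \<in> T" "t \<in> ball x \<rho>" using dense[of "ball x \<rho>"] \<rho>(1) by auto
    have near: "\<bar>?v n t - ?v n x\<bar> < e / 3" for n
    proof -
      have "norm (?v n (x + (t - x)) - ?v n x) \<le> e / (3 * (m + 1)) * (\<integral>y. \<bar>indicator (F n) y\<bar> \<partial>lborel)"
      proof (rule convol_minus_translate[OF moll_Cc(1)[OF d] i])
        show "norm (moll \<delta> (y + (t - x)) - moll \<delta> y) \<le> e / (3 * (m + 1))" for y
          using \<rho>(2)[of "y + (t - x)" y] t by (simp add: dist_norm norm_minus_commute less_imp_le)
      qed
      also have "\<dots> \<le> e / (3 * (m + 1)) * m" using mes[of n] e m by (intro mult_left_mono) auto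
      also have "\<dots> < e / 3" using e m by (simp add: field_simps)
      finally show ?thesis by simp
    qed
    have "Cauchy (\<lambda>n. ?v n t)" using conv[OF t(1)] by (rule convergent_Cauchy)
    then obtain N where N: "\<And>a b. a \<ge> N \<Longrightarrow> b \<ge> N \<Longrightarrow> dist (?v a t) (?v b t) < e / 3"
      using e by (meson metric_CauchyD divide_pos_pos zero_less_numeral)
    have "dist (?v a x) (?v b x) < e" if "a \<ge> N" "b \<ge> N" for a b
      using near[of a] near[of b] N[OF that] unfolding dist_real_def by linarith
    then show "\<exists>N. \<forall>a\<ge>N. \<forall>b\<ge>N. dist (?v a x) (?v b x) < e" by blast
  qed
  then show ?thesis by (simp add: Cauchy_convergent_iff)
qed

text \<open>Dominated convergence: the functions are bounded by 1 and vanish outside a common ball,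
  with radius enlarged by \<delta> to account for the mollification.\<close>

lemma convol_moll_L1_Cauchy:
  fixes F :: "nat \<Rightarrow> 'a::euclidean_space set"
  assumes d: "\<delta> > 0" and mF: "\<And>n. F n \<in> sets borel" and sub: "\<And>n. F n \<subseteq> cball 0 R"
    and conv: "\<And>x. convergent (\<lambda>n. convol (moll \<delta>) (indicator (F n)) (x::'a))" and e: "e > 0"
  shows "\<exists>N. \<forall>m\<ge>N. \<forall>n\<ge>N. (\<integral>\<^sup>+x. ennreal \<bar>convol (moll \<delta>) (indicator (F m)) x - convol (moll \<delta>) (indicator (F n)) x\<bar> \<partial>lborel) \<le> ennreal e"
proof -
  let ?v = "\<lambda>n. convol (moll \<delta>) (indicator (F n)) :: 'a \<Rightarrow> real"
  have fb: "emeasure lborel (cball (0::'a) t) < \<infinity>" for t using emeasure_bounded_finite[of "cball (0::'a) t"] by simp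
  have fin: "emeasure lborel (F n) < \<infinity>" for n
    using emeasure_mono[OF sub[of n], of lborel] fb[of R] by (simp add: le_less_trans)
  have i: "integrable lborel (indicator (F n) :: 'a \<Rightarrow> real)" for n using mF fin by simp
  have [measurable]: "?v n \<in> borel_measurable borel" for n by (rule convol_measurable[OF moll_Cc(1)[OF d] i])
  define v where "v x = lim (\<lambda>n. ?v n x)" for x
  have lim: "(\<lambda>n. ?v n x) \<longlonglongrightarrow> v x" for x using conv[of x] by (simp add: v_def convergent_LIMSEQ_iff)
  have [measurable]: "v \<in> borel_measurable borel" by (rule borel_measurable_LIMSEQ_real[OF lim]) measurable
  have vb: "\<bar>?v n x\<bar> \<le> 1" for n x by (rule abs_convol_moll_le_1[OF d mF fin])
  have v0: "?v n x = 0" if "norm x \<ge> R + \<delta>" for n x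
    by (rule convol_eq_0[where R = \<delta> and L = R]) (use that moll_eq_0[OF d] sub[of n] in \<open>force simp: indicator_def\<close>)+
  have vb': "\<bar>v x\<bar> \<le> 1" for x by (rule LIMSEQ_le_const2[OF tendsto_rabs[OF lim]]) (use vb in blast)
  have v0': "v x = 0" if "norm x \<ge> R + \<delta>" for x using lim[of x] v0[OF that] by (simp add: LIMSEQ_const_iff)
  have "(\<lambda>n. \<integral>\<^sup>+x. ennreal \<bar>?v n x - v x\<bar> \<partial>lborel) \<longlonglongrightarrow> (\<integral>\<^sup>+(x::'a). 0 \<partial>lborel)"
  proof (rule nn_integral_dominated_convergence[where w = "\<lambda>x. 2 * indicator (cball 0 (R + \<delta>)) x"])
    show "AE x in lborel. ennreal \<bar>?v n x - v x\<bar> \<le> 2 * indicator (cball 0 (R + \<delta>)) x" for n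
    proof (rule AE_I2)
      fix x
      have "\<bar>?v n x - v x\<bar> \<le> 2" using vb[of n x] vb'[of x] by linarith
      then have "ennreal \<bar>?v n x - v x\<bar> \<le> ennreal 2" by (rule ennreal_leI)
      then show "ennreal \<bar>?v n x - v x\<bar> \<le> 2 * indicator (cball 0 (R + \<delta>)) x"
        using v0[of x n] v0'[of x] by (cases "norm x \<le> R + \<delta>") auto
    qed
    show "(\<integral>\<^sup>+(x::'a). 2 * indicator (cball 0 (R + \<delta>)) x \<partial>lborel) < \<infinity>"
      using fb[of "R + \<delta>"] by (simp add: nn_integral_cmult ennreal_mult_less_top)
    show "AE x in lborel. (\<lambda>n. ennreal \<bar>?v n x - v x\<bar>) \<longlonglongrightarrow> 0"
    proof (rule AE_I2)
      fix x
      have "(\<lambda>n. \<bar>?v n x - v x\<bar>) \<longlonglongrightarrow> \<bar>v x - v x\<bar>" by (intro tendsto_intros lim)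
      then have "(\<lambda>n. ennreal \<bar>?v n x - v x\<bar>) \<longlonglongrightarrow> ennreal \<bar>v x - v x\<bar>" by (rule tendsto_ennrealI)
      then show "(\<lambda>n. ennreal \<bar>?v n x - v x\<bar>) \<longlonglongrightarrow> 0" by simp
    qed
  qed measurable
  then have "(\<lambda>n. \<integral>\<^sup>+x. ennreal \<bar>?v n x - v x\<bar> \<partial>lborel) \<longlonglongrightarrow> 0" by simp
  then have "eventually (\<lambda>n. (\<integral>\<^sup>+x. ennreal \<bar>?v n x - v x\<bar> \<partial>lborel) < ennreal (e / 2)) sequentially"
    using e by (intro order_tendstoD) auto
  then obtain N where N: "\<And>n. n \<ge> N \<Longrightarrow> (\<integral>\<^sup>+x. ennreal \<bar>?v n x - v x\<bar> \<partial>lborel) < ennreal (e / 2)"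
    by (auto simp: eventually_sequentially)
  have "(\<integral>\<^sup>+x. ennreal \<bar>?v m x - ?v n x\<bar> \<partial>lborel) \<le> ennreal e" if "m \<ge> N" "n \<ge> N" for m n
  proof -
    have "(\<integral>\<^sup>+x. ennreal \<bar>?v m x - ?v n x\<bar> \<partial>lborel) \<le> (\<integral>\<^sup>+x. ennreal \<bar>?v m x - v x\<bar> + ennreal \<bar>?v n x - v x\<bar> \<partial>lborel)"
    proof (rule nn_integral_mono)
      fix x
      have "\<bar>?v m x - ?v n x\<bar> \<le> \<bar>?v m x - v x\<bar> + \<bar>?v n x - v x\<bar>" by linarith
      from ennreal_leI[OF this] show "ennreal \<bar>?v m x - ?v n x\<bar> \<le> ennreal \<bar>?v m x - v x\<bar> + ennreal \<bar>?v n x - v x\<bar>"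
        by (simp add: ennreal_plus)
    qed
    also have "\<dots> = (\<integral>\<^sup>+x. ennreal \<bar>?v m x - v x\<bar> \<partial>lborel) + (\<integral>\<^sup>+x. ennreal \<bar>?v n x - v x\<bar> \<partial>lborel)"
      by (rule nn_integral_add) measurable
    also have "\<dots> \<le> ennreal (e / 2) + ennreal (e / 2)" using N[OF that(1)] N[OF that(2)] by (intro add_mono) auto
    also have "\<dots> = ennreal e" using e by (subst ennreal_plus[symmetric]) auto
    finally show ?thesis .
  qed
  then show ?thesis by blast
qed

text \<open>One subsequence serves all mollification scales. Two indicators are then compared
  through their mollifications at a scale where the uniform error is below e/3; their mollifications
  are L1-Cauchy at that scale.\<close>

lemma L1_compactness:
  fixes En :: "nat \<Rightarrow> 'a::euclidean_space set" and M R :: real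
  assumes mn: "\<And>n. En n \<in> sets borel" and sub: "\<And>n. En n \<subseteq> cball 0 R"
    and s: "s \<ge> 1" and r: "\<forall>n. r n > 0" "r \<longlonglongrightarrow> 0"
    and J: "\<And>n. Jt s (r n) (En n) \<le> ennreal (M * sigma DIM('a) s (r n))" and M: "M \<ge> 0"
  obtains f E where "strict_mono (f :: nat \<Rightarrow> nat)" "E \<in> sets borel" "E \<subseteq> cball 0 R"
    "(\<lambda>i. \<integral>\<^sup>+x. ennreal \<bar>indicator (En (f i)) x - indicator E x\<bar> \<partial>lborel) \<longlonglongrightarrow> 0"
proof -
  have fb: "emeasure lborel (cball (0::'a) R) < \<infinity>" using emeasure_bounded_finite[of "cball (0::'a) R"] by simp
  define m where "m = measure lborel (cball (0::'a) R)"
  have m: "emeasure lborel (En n) \<le> ennreal m" "m \<ge> 0" for n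
    using emeasure_mono[OF sub[of n], of lborel] fb by (auto simp: m_def emeasure_eq_ennreal_measure less_top)
  have fin: "emeasure lborel (En n) < \<infinity>" for n using m(1)[of n] by (simp add: le_less_trans)
  obtain K where K: "K \<ge> 0" "\<And>\<delta>. \<delta> > 0 \<Longrightarrow>
    eventually (\<lambda>n. (\<integral>\<^sup>+x. ennreal \<bar>convol (moll \<delta>) (indicator (En n)) x - indicator (En n) x\<bar> \<partial>lborel) \<le> ennreal (K * \<delta>)) sequentially"
    using mollification_error_bound[OF mn fin s r J M] by blast
  obtain T :: "'a set" where T: "countable T" "\<And>X. open X \<Longrightarrow> X \<noteq> {} \<Longrightarrow> \<exists>t\<in>T. t \<in> X"
    using countable_dense_exists by metis
  define \<Delta> where "\<Delta> j = 1 / real (Suc j)" for j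
  have \<Delta>: "\<Delta> j > 0" for j by (simp add: \<Delta>_def)
  \<comment> \<open>Pairs of a dense point and a scale form a countable index set, so a single
    diagonal extraction treats all points and scales at once.\<close>
  obtain k where k: "strict_mono (k :: nat \<Rightarrow> nat)"
    "\<And>p. p \<in> T \<times> (UNIV :: nat set) \<Longrightarrow> \<exists>l. (\<lambda>n. (case p of (t, j) \<Rightarrow> convol (moll (\<Delta> j)) (indicator (En (k n))) t)) \<longlonglongrightarrow> l"
  proof (rule function_convergent_subsequence[where S = "T \<times> (UNIV :: nat set)" and M = 1
      and f = "\<lambda>n (t, j). convol (moll (\<Delta> j)) (indicator (En n)) t"])
    show "countable (T \<times> (UNIV :: nat set))" using T(1) by simp
    show "norm (case x of (t, j) \<Rightarrow> convol (moll (\<Delta> j)) (indicator (En n)) t) \<le> 1" for n x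
      using abs_convol_moll_le_1[OF \<Delta> mn fin] by (auto split: prod.split)
  qed (use that in auto)
  let ?F = "\<lambda>n. En (k n)"
  have k': "k n \<ge> n" for n using k(1) by (rule strict_mono_imp_increasing)
  have conv: "convergent (\<lambda>n. convol (moll (\<Delta> j)) (indicator (?F n)) x)" for j x
  proof (rule convol_moll_pointwise_Cauchy[OF \<Delta> mn m T(2)])
    show "convergent (\<lambda>n. convol (moll (\<Delta> j)) (indicator (?F n)) t)" if "t \<in> T" for t
      using k(2)[of "(t, j)"] that by (auto simp: convergent_def)
  qed
  have cau: "\<exists>N. \<forall>a\<ge>N. \<forall>b\<ge>N. (\<integral>\<^sup>+x. ennreal \<bar>indicator (?F a) x - indicator (?F b) x\<bar> \<partial>lborel) \<le> ennreal e" if e: "e > 0" for e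
  proof -
    obtain j where j: "3 * (K + 1) / e < real (Suc j)" using reals_Archimedean2 by (meson less_trans of_nat_less_iff lessI)
    have Kj: "K * \<Delta> j \<le> e / 3"
    proof -
      have "3 * (K + 1) < e * real (Suc j)" using j e by (simp add: field_simps)
      then have "3 * K \<le> e * real (Suc j)" by simp
      then show ?thesis unfolding \<Delta>_def by (simp add: field_simps)
    qed
    let ?v = "\<lambda>n. convol (moll (\<Delta> j)) (indicator (?F n)) :: 'a \<Rightarrow> real"
    obtain N1 where N1: "\<And>n. n \<ge> N1 \<Longrightarrow> (\<integral>\<^sup>+x. ennreal \<bar>convol (moll (\<Delta> j)) (indicator (En n)) x - indicator (En n) x\<bar> \<partial>lborel) \<le> ennreal (K * \<Delta> j)"
      using K(2)[OF \<Delta>[of j]] by (auto simp: eventually_sequentially)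
    have err: "(\<integral>\<^sup>+x. ennreal \<bar>?v n x - indicator (?F n) x\<bar> \<partial>lborel) \<le> ennreal (e / 3)" if "n \<ge> N1" for n
      using N1[of "k n"] k'[of n] that ennreal_leI[OF Kj] by (meson order_trans)
    have "e / 3 > 0" using e by simp
    then obtain N2 where N2: "\<And>a b. a \<ge> N2 \<Longrightarrow> b \<ge> N2 \<Longrightarrow> (\<integral>\<^sup>+x. ennreal \<bar>?v a x - ?v b x\<bar> \<partial>lborel) \<le> ennreal (e / 3)"
      using convol_moll_L1_Cauchy[OF \<Delta> mn sub conv, of "e / 3"] by blast
    have "(\<integral>\<^sup>+x. ennreal \<bar>indicator (?F a) x - indicator (?F b) x\<bar> \<partial>lborel) \<le> ennreal e" if "a \<ge> max N1 N2" "b \<ge> max N1 N2" for a b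
    proof -
      have iF: "integrable lborel (indicator (?F n) :: 'a \<Rightarrow> real)" for n using mn fin by simp
      have [measurable]: "?v n \<in> borel_measurable borel" for n by (rule convol_measurable[OF moll_Cc(1)[OF \<Delta>] iF])
      have [measurable]: "?F n \<in> sets borel" for n by (rule mn)
      have "(\<integral>\<^sup>+x. ennreal \<bar>indicator (?F a) x - indicator (?F b) x\<bar> \<partial>lborel)
        \<le> (\<integral>\<^sup>+x. ennreal \<bar>?v a x - ?v b x\<bar> + (ennreal \<bar>?v a x - indicator (?F a) x\<bar> + ennreal \<bar>?v b x - indicator (?F b) x\<bar>) \<partial>lborel)"
      proof (rule nn_integral_mono)
        fix x
        have "\<bar>indicator (?F a) x - indicator (?F b) x\<bar> \<le> \<bar>?v a x - ?v b x\<bar> + (\<bar>?v a x - indicator (?F a) x\<bar> + \<bar>?v b x - indicator (?F b) x\<bar>)" by linarith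
        from ennreal_leI[OF this] show "ennreal \<bar>indicator (?F a) x - indicator (?F b) x\<bar> \<le> ennreal \<bar>?v a x - ?v b x\<bar> + (ennreal \<bar>?v a x - indicator (?F a) x\<bar> + ennreal \<bar>?v b x - indicator (?F b) x\<bar>)"
          by (simp add: ennreal_plus)
      qed
      also have "\<dots> = (\<integral>\<^sup>+x. ennreal \<bar>?v a x - ?v b x\<bar> \<partial>lborel) + ((\<integral>\<^sup>+x. ennreal \<bar>?v a x - indicator (?F a) x\<bar> \<partial>lborel) + (\<integral>\<^sup>+x. ennreal \<bar>?v b x - indicator (?F b) x\<bar> \<partial>lborel))"
        by (simp add: nn_integral_add)
      also have "\<dots> \<le> ennreal (e / 3) + (ennreal (e / 3) + ennreal (e / 3))"
        using that by (intro add_mono N2 err) auto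
      also have "\<dots> = ennreal e" using e by (simp flip: ennreal_plus)
      finally show ?thesis .
    qed
    then show ?thesis by blast
  qed
  obtain g E where gE: "strict_mono (g :: nat \<Rightarrow> nat)" "E \<in> sets borel" "E \<subseteq> (\<Union>n. ?F n)"
    "(\<lambda>i. \<integral>\<^sup>+x. ennreal \<bar>indicator (?F (g i)) x - indicator E x\<bar> \<partial>lborel) \<longlonglongrightarrow> 0"
    using L1_Cauchy_sets_subseq[OF mn cau] by blast
  show ?thesis
  proof (rule that[of "k \<circ> g" E])
    show "strict_mono (k \<circ> g)" using k(1) gE(1) by (rule strict_mono_o)
    show "E \<subseteq> cball 0 R" using gE(3) sub by blast
  qed (use gE in auto)
qed

subsection \<open>Passing to Lebesgue measurable sets\<close>

text \<open>The Borel part of a decomposition up to a null set. The inclusion is kept so that, in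
  the compactness statement, the replacement stays in the given bounded region.\<close>

lemma lebesgue_borel_core:
  assumes "A \<in> sets lebesgue"
  obtains B where "B \<in> sets borel" "B \<subseteq> A" "AE x in lborel. x \<in> A \<longleftrightarrow> x \<in> B"
proof -
  obtain S N N' where "A = S \<union> N" "N \<subseteq> N'" "N' \<in> null_sets lborel" "S \<in> sets lborel"
    using sets_completionE[OF assms] by blast
  then show ?thesis using AE_not_in[of N' lborel] by (intro that[of S]) (auto elim!: eventually_mono)
qed

lemma emeasure_lebesgue_AE_eq:
  assumes "A \<in> sets lebesgue" "B \<in> sets borel" "AE x in lborel. x \<in> A \<longleftrightarrow> x \<in> B"
  shows "emeasure lebesgue A = emeasure lborel B"
proof -
  have "emeasure lebesgue A = (\<integral>\<^sup>+x. indicator A x \<partial>lebesgue)" using assms by simp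
  also have "\<dots> = (\<integral>\<^sup>+x. indicator A x \<partial>lborel)" by (rule nn_integral_completion)
  also have "\<dots> = (\<integral>\<^sup>+x. indicator B x \<partial>lborel)"
    by (rule nn_integral_cong_AE) (use assms(3) in \<open>auto elim!: eventually_mono simp: indicator_def\<close>)
  finally show ?thesis using assms by simp
qed

lemma Jt_AE_eq:
  assumes "AE x in lborel. x \<in> A \<longleftrightarrow> x \<in> B"
  shows "Jt s r A = Jt s r B"
proof -
  have "(\<integral>\<^sup>+y. indicator (- A) y * ennreal (kern DIM('a) s r (dist x y)) \<partial>lborel) = (\<integral>\<^sup>+y. indicator (- B) y * ennreal (kern DIM('a) s r (dist x y)) \<partial>lborel)" for x :: 'a
    by (rule nn_integral_cong_AE) (use assms in \<open>auto elim!: eventually_mono simp: indicator_def\<close>)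
  then show ?thesis unfolding Jt_def nn_integral_completion
    by (simp, intro nn_integral_cong_AE) (use assms in \<open>auto elim!: eventually_mono simp: indicator_def\<close>)
qed

lemma Per_AE_eq:
  assumes A: "A \<in> sets lebesgue" and B: "B \<in> sets borel" and AB: "AE x in lborel. x \<in> A \<longleftrightarrow> x \<in> B"
  shows "Per A = Per B"
  unfolding Per_def
proof (intro SUP_cong refl arg_cong[where f = ennreal] integral_cong_AE)
  fix \<phi> :: "'a \<Rightarrow> 'a" assume "\<phi> \<in> test_fields"
  then have "divergence \<phi> \<in> borel_measurable lborel"
    by (simp add: borel_measurable_continuous_onI test_field_divergence_continuous)
  then have m: "divergence \<phi> \<in> borel_measurable lebesgue" by (rule measurable_completion)
  have "B \<in> sets lebesgue" using B by simp
  show "(\<lambda>x. indicator A x * divergence \<phi> x) \<in> borel_measurable lebesgue"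
    by (intro borel_measurable_times borel_measurable_indicator A m)
  show "(\<lambda>x. indicator B x * divergence \<phi> x) \<in> borel_measurable lebesgue"
    by (intro borel_measurable_times borel_measurable_indicator \<open>B \<in> sets lebesgue\<close> m)
  show "AE x in lebesgue. indicator A x * divergence \<phi> x = indicator B x * divergence \<phi> x"
    using AE_completion[OF AB] by eventually_elim (simp add: indicator_def)
qed

lemma chi_L1_conv_AE_iff:
  assumes "\<And>n. AE x in lborel. x \<in> An n \<longleftrightarrow> x \<in> Bn n" "AE x in lborel. x \<in> A \<longleftrightarrow> x \<in> B"
  shows "chi_L1_conv An A \<longleftrightarrow> (\<lambda>n. \<integral>\<^sup>+x. ennreal \<bar>indicator (Bn n) x - indicator B x\<bar> \<partial>lborel) \<longlonglongrightarrow> 0"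
proof -
  have "(\<integral>\<^sup>+x. ennreal \<bar>indicator (An n) x - indicator A x\<bar> \<partial>lborel) = (\<integral>\<^sup>+x. ennreal \<bar>indicator (Bn n) x - indicator B x\<bar> \<partial>lborel)" for n
    using assms(1)[of n] assms(2) by (intro nn_integral_cong_AE, eventually_elim) (simp add: indicator_def)
  then show ?thesis unfolding chi_L1_conv_def nn_integral_completion by simp
qed

section \<open>The limit for a fixed set, and the three statements\<close>

lemma Jt_limit:
  fixes E :: "'a::euclidean_space set"
  assumes E: "E \<in> sets borel" "emeasure lborel E < \<infinity>"
    and s: "s \<ge> 1" and r: "\<forall>n. r n > 0" "r \<longlonglongrightarrow> 0"
  shows "(\<lambda>n. Jt s (r n) E / ennreal (sigma DIM('a) s (r n))) \<longlonglongrightarrow> ennreal (unit_ball_vol (real (DIM('a) - 1))) * Per E"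
proof (rule order_tendstoI)
  let ?X = "\<lambda>n. Jt s (r n) E / ennreal (sigma DIM('a) s (r n))"
  define w where "w = unit_ball_vol (real (DIM('a) - 1))"
  have w: "w > 0" by (simp add: w_def)
  have "ennreal w * Per E \<le> liminf ?X"
    unfolding w_def by (rule Per_liminf[OF E(1) E(1) E(2) E(2) _ s r]) simp
  then show "eventually (\<lambda>n. a < ?X n) sequentially" if "a < ennreal (unit_ball_vol (real (DIM('a) - 1))) * Per E" for a
    using that unfolding le_Liminf_iff w_def by blast
  fix a assume a: "ennreal (unit_ball_vol (real (DIM('a) - 1))) * Per E < a"
  \<comment> \<open>No \<open>a\<close> lies above infinity, so here the perimeter must be finite. A
    set of infinite perimeter is covered by the lower estimate alone.\<close>
  then have "Per E \<noteq> top" using w unfolding w_def[symmetric] by (auto simp: ennreal_mult_top)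
  then obtain p where p: "Per E = ennreal p" "p \<ge> 0" by (cases "Per E") auto
  define c where "c = radial_const DIM('a) s 1"
  define k where "k = unit_ball_vol (real DIM('a)) * real DIM('a) / s"
  define K where "K = 2 * measure lborel E * k"
  have k: "k \<ge> 0" using s by (simp add: k_def)
  then have K: "K \<ge> 0" by (simp add: K_def)
  have KE: "2 * emeasure lborel E * ennreal (unit_ball_vol (real DIM('a)) * real DIM('a) / s) = ennreal K"
    using E(2) k unfolding k_def[symmetric] by (simp add: K_def emeasure_eq_ennreal_measure less_top ennreal_mult)
  have inv: "(\<lambda>n. inverse (sigma DIM('a) s (r n))) \<longlonglongrightarrow> 0"
  proof (rule tendsto_inverse_0_at_top)
    show "filterlim (\<lambda>n. sigma DIM('a) s (r n)) at_top sequentially"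
      unfolding filterlim_at_top_dense using eventually_sigma_gt[OF s r] by blast
  qed
  \<comment> \<open>This is the bound of \<open>Jt_upper\<close> divided by twice
    \<open>sigma\<close>: the perimeter term is isolated, and all bounded terms are multiplied by
    1/\<open>sigma\<close>.\<close>
  have "(\<lambda>n. w * p + (w * p * c + K / 2) * inverse (sigma DIM('a) s (r n))) \<longlonglongrightarrow> w * p + (w * p * c + K / 2) * 0"
    by (intro tendsto_intros inv)
  then have "(\<lambda>n. ennreal (w * p + (w * p * c + K / 2) * inverse (sigma DIM('a) s (r n)))) \<longlonglongrightarrow> ennreal (w * p)"
    by (intro tendsto_ennrealI) simp
  moreover have "ennreal (w * p) < a" using a w p by (simp add: w_def ennreal_mult)
  ultimately have "eventually (\<lambda>n. ennreal (w * p + (w * p * c + K / 2) * inverse (sigma DIM('a) s (r n))) < a) sequentially"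
    by (rule order_tendstoD(2))
  moreover have "eventually (\<lambda>n. sigma DIM('a) s (r n) > \<bar>c\<bar>) sequentially" by (rule eventually_sigma_gt[OF s r])
  moreover have "eventually (\<lambda>n. r n < 1) sequentially" using order_tendstoD(2)[OF r(2), of 1] by simp
  ultimately show "eventually (\<lambda>n. ?X n < a) sequentially"
  proof eventually_elim
    case (elim n)
    let ?\<sigma> = "sigma DIM('a) s (r n)" and ?J = "Jt s (r n) E"
    have \<sigma>: "?\<sigma> > 0" "?\<sigma> + c > 0" using elim(2) by linarith+
    have "2 * ?J \<le> ennreal (2 * w) * ennreal p * ennreal (?\<sigma> + c) + ennreal K"
      using Jt_upper[OF E, of "r n" s] r(1) elim(3) s unfolding KE p w_def c_def by simp
    also have "\<dots> = ennreal (2 * w * p * (?\<sigma> + c) + K)" using w p \<sigma> K by (simp add: ennreal_mult)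
    finally have J2: "2 * ?J \<le> ennreal (2 * w * p * (?\<sigma> + c) + K)" .
    have "?J \<noteq> top"
    proof
      assume "?J = top"
      then have "2 * ?J = top" by (simp add: ennreal_mult_top)
      then show False using J2 by (simp add: top_unique)
    qed
    then obtain j where j: "?J = ennreal j" "j \<ge> 0" by (cases ?J) auto
    have "ennreal (2 * j) \<le> ennreal (2 * w * p * (?\<sigma> + c) + K)" using J2 j by (simp add: ennreal_mult)
    then have "2 * j \<le> 2 * w * p * (?\<sigma> + c) + K" using w p \<sigma> K by (subst (asm) ennreal_le_iff) auto
    then have "j / ?\<sigma> \<le> (w * p * (?\<sigma> + c) + K / 2) / ?\<sigma>" using \<sigma> by (intro divide_right_mono) auto
    also have "\<dots> = w * p + (w * p * c + K / 2) * inverse ?\<sigma>" using \<sigma> by (simp add: field_simps)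
    finally have "ennreal (j / ?\<sigma>) \<le> ennreal (w * p + (w * p * c + K / 2) * inverse ?\<sigma>)" by (rule ennreal_leI)
    moreover have "?X n = ennreal (j / ?\<sigma>)" using j \<sigma> by (simp add: divide_ennreal)
    ultimately show ?case using elim(1) by simp
  qed
qed

theorem theorem1p5:
  fixes r :: "nat \<Rightarrow> real" and s :: real
  assumes dim: "DIM('a::euclidean_space) \<ge> 2"
    and s1: "s \<ge> 1"
    and rpos: "\<forall>n. r n > 0"
    and rlim: "r \<longlonglongrightarrow> 0"
  shows
   "(\<forall>(U::'a set) (En::nat \<Rightarrow> 'a set) (M::real).
        open U \<and> bounded U \<and> (\<forall>n. En n \<in> sets lebesgue \<and> En n \<subseteq> U)
        \<and> (\<forall>n. Jt s (r n) (En n) \<le> ennreal (M * sigma DIM('a) s (r n)))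
      \<longrightarrow> (\<exists>f E. strict_mono f \<and> E \<in> sets lebesgue \<and> emeasure lebesgue E < \<infinity>
               \<and> Per E < \<infinity> \<and> chi_L1_conv (En \<circ> f) E))
    \<and> (\<forall>(E::'a set) (En::nat \<Rightarrow> 'a set).
        E \<in> sets lebesgue \<and> emeasure lebesgue E < \<infinity>
        \<and> (\<forall>n. En n \<in> sets lebesgue \<and> emeasure lebesgue (En n) < \<infinity>)
        \<and> chi_L1_conv En E
      \<longrightarrow> ennreal (unit_ball_vol (real (DIM('a) - 1))) * Per E
            \<le> liminf (\<lambda>n. Jt s (r n) (En n) / ennreal (sigma DIM('a) s (r n))))
    \<and> (\<forall>(E::'a set). E \<in> sets lebesgue \<and> emeasure lebesgue E < \<infinity>
      \<longrightarrow> (\<exists>En::nat \<Rightarrow> 'a set.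
            (\<forall>n. En n \<in> sets lebesgue \<and> emeasure lebesgue (En n) < \<infinity>)
            \<and> chi_L1_conv En E
            \<and> (\<lambda>n. Jt s (r n) (En n) / ennreal (sigma DIM('a) s (r n)))
                 \<longlonglongrightarrow> ennreal (unit_ball_vol (real (DIM('a) - 1))) * Per E))"
proof (intro conjI allI impI)
  fix U :: "'a set" and En :: "nat \<Rightarrow> 'a set" and M :: real
  assume "open U \<and> bounded U \<and> (\<forall>n. En n \<in> sets lebesgue \<and> En n \<subseteq> U)
        \<and> (\<forall>n. Jt s (r n) (En n) \<le> ennreal (M * sigma DIM('a) s (r n)))"
  then have bU: "bounded U" and En: "\<And>n. En n \<in> sets lebesgue" "\<And>n. En n \<subseteq> U"
    and J: "\<And>n. Jt s (r n) (En n) \<le> ennreal (M * sigma DIM('a) s (r n))" by auto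
  obtain R where R: "U \<subseteq> cball 0 R" using bU unfolding bounded_iff by (metis mem_cball_0 subsetI)
  have "\<forall>n. \<exists>B. B \<in> sets borel \<and> B \<subseteq> En n \<and> (AE x in lborel. x \<in> En n \<longleftrightarrow> x \<in> B)"
    using lebesgue_borel_core[OF En(1)] by metis
  then obtain Bn where Bn: "\<And>n. Bn n \<in> sets borel" "\<And>n. Bn n \<subseteq> En n" "\<And>n. AE x in lborel. x \<in> En n \<longleftrightarrow> x \<in> Bn n" by metis
  define w where "w = unit_ball_vol (real (DIM('a) - 1))"
  have w: "w > 0" by (simp add: w_def)
  \<comment> \<open>A negative \<open>M\<close> is allowed in the statement, whereas the compactness
    lemma expects a nonnegative bound; \<open>ennreal\<close> truncates negative reals to 0
    anyway.\<close>
  define M' where "M' = max 0 M"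
  have M'0: "M' \<ge> 0" by (simp add: M'_def)
  have BnR: "Bn n \<subseteq> cball 0 R" for n using Bn(2) En(2) R by blast
  have sig: "sigma DIM('a) s (r n) \<ge> 0" for n
    using s1 by (auto simp: sigma_def)
  have J': "Jt s (r n) (Bn n) \<le> ennreal (M' * sigma DIM('a) s (r n))" for n
  proof -
    have "Jt s (r n) (Bn n) \<le> ennreal (M * sigma DIM('a) s (r n))" using J[of n] Jt_AE_eq[OF Bn(3)] by simp
    also have "\<dots> \<le> ennreal (M' * sigma DIM('a) s (r n))"
      by (intro ennreal_leI mult_right_mono sig) (simp add: M'_def)
    finally show ?thesis .
  qed
  obtain f E where fE: "strict_mono (f :: nat \<Rightarrow> nat)" "E \<in> sets borel" "E \<subseteq> cball 0 R"
    "(\<lambda>i. \<integral>\<^sup>+x. ennreal \<bar>indicator (Bn (f i)) x - indicator E x\<bar> \<partial>lborel) \<longlonglongrightarrow> 0"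
    using L1_compactness[OF Bn(1) BnR s1 rpos rlim J' M'0] by blast
  have fb: "emeasure lborel (cball (0::'a) R) < \<infinity>" using emeasure_bounded_finite[of "cball (0::'a) R"] by simp
  have finE: "emeasure lborel E < \<infinity>" using emeasure_mono[OF fE(3), of lborel] fb by (simp add: le_less_trans)
  have finB: "emeasure lborel (Bn n) < \<infinity>" for n
    using emeasure_mono[of "Bn n" "cball 0 R" lborel] Bn(2)[of n] En(2)[of n] R fb by (auto intro: le_less_trans)
  have rf: "\<forall>n. r (f n) > 0" "(\<lambda>n. r (f n)) \<longlonglongrightarrow> 0"
    using rpos LIMSEQ_subseq_LIMSEQ[OF rlim fE(1)] by (auto simp: o_def)
  \<comment> \<open>Finite perimeter of the limit follows from the lower bound along the extracted
    subsequence, where the energy divided by \<open>sigma\<close> is eventually at most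
    \<open>M'\<close>.\<close>
  have "ennreal (unit_ball_vol (real (DIM('a) - 1))) * Per E \<le> liminf (\<lambda>n. Jt s (r (f n)) (Bn (f n)) / ennreal (sigma DIM('a) s (r (f n))))"
    by (rule Per_liminf[OF fE(2) Bn(1) finE finB fE(4) s1 rf])
  also have "\<dots> \<le> limsup (\<lambda>n. Jt s (r (f n)) (Bn (f n)) / ennreal (sigma DIM('a) s (r (f n))))"
    by (rule Liminf_le_Limsup) simp
  also have "\<dots> \<le> ennreal M'"
  proof (rule Limsup_bounded)
    show "eventually (\<lambda>n. Jt s (r (f n)) (Bn (f n)) / ennreal (sigma DIM('a) s (r (f n))) \<le> ennreal M') sequentially"
      using eventually_sigma_gt[OF s1 rf, where d = "DIM('a)" and B = 0]
    proof eventually_elim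
      case (elim n)
      have "Jt s (r (f n)) (Bn (f n)) / ennreal (sigma DIM('a) s (r (f n))) \<le> ennreal (M' * sigma DIM('a) s (r (f n))) / ennreal (sigma DIM('a) s (r (f n)))"
        by (rule divide_right_mono_ennreal[OF J'])
      also have "\<dots> = ennreal M'" using elim by (subst divide_ennreal) (auto simp: M'_def)
      finally show ?case .
    qed
  qed
  finally have "ennreal (unit_ball_vol (real (DIM('a) - 1))) * Per E < top" by (simp add: le_less_trans)
  then have "Per E \<noteq> top" using w unfolding w_def[symmetric] by (auto simp: ennreal_mult_top)
  then have PerE: "Per E < \<infinity>" by (simp add: less_top)
  show "\<exists>f E. strict_mono f \<and> E \<in> sets lebesgue \<and> emeasure lebesgue E < \<infinity> \<and> Per E < \<infinity> \<and> chi_L1_conv (En \<circ> f) E"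
  proof (intro exI[of _ f] exI[of _ E] conjI)
    show "E \<in> sets lebesgue" using fE(2) by simp
    show "emeasure lebesgue E < \<infinity>" using finE fE(2) by simp
    show "chi_L1_conv (En \<circ> f) E"
      using chi_L1_conv_AE_iff[of "En \<circ> f" "Bn \<circ> f" E E] Bn(3) fE(4) by simp
  qed (use fE PerE in auto)
next
  fix E :: "'a set" and En :: "nat \<Rightarrow> 'a set"
  assume "E \<in> sets lebesgue \<and> emeasure lebesgue E < \<infinity>
        \<and> (\<forall>n. En n \<in> sets lebesgue \<and> emeasure lebesgue (En n) < \<infinity>) \<and> chi_L1_conv En E"
  then have E: "E \<in> sets lebesgue" "emeasure lebesgue E < \<infinity>" and En: "\<And>n. En n \<in> sets lebesgue" "\<And>n. emeasure lebesgue (En n) < \<infinity>"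
    and conv: "chi_L1_conv En E" by blast+
  obtain B where B: "B \<in> sets borel" "AE x in lborel. x \<in> E \<longleftrightarrow> x \<in> B" using lebesgue_borel_core[OF E(1)] by metis
  have "\<forall>n. \<exists>B. B \<in> sets borel \<and> (AE x in lborel. x \<in> En n \<longleftrightarrow> x \<in> B)"
    using lebesgue_borel_core[OF En(1)] by metis
  then obtain Bn where Bn: "\<And>n. Bn n \<in> sets borel" "\<And>n. AE x in lborel. x \<in> En n \<longleftrightarrow> x \<in> Bn n" by metis
  have "ennreal (unit_ball_vol (real (DIM('a) - 1))) * Per B \<le> liminf (\<lambda>n. Jt s (r n) (Bn n) / ennreal (sigma DIM('a) s (r n)))"
  proof (rule Per_liminf[OF B(1) Bn(1) _ _ _ s1 rpos rlim])
    show "emeasure lborel B < \<infinity>" using E emeasure_lebesgue_AE_eq[OF E(1) B] by simp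
    show "emeasure lborel (Bn n) < \<infinity>" for n using En(2)[of n] emeasure_lebesgue_AE_eq[OF En(1) Bn, of n] by simp
    show "(\<lambda>n. \<integral>\<^sup>+x. ennreal \<bar>indicator (Bn n) x - indicator B x\<bar> \<partial>lborel) \<longlonglongrightarrow> 0"
      using conv chi_L1_conv_AE_iff[OF Bn(2) B(2)] by simp
  qed
  then show "ennreal (unit_ball_vol (real (DIM('a) - 1))) * Per E \<le> liminf (\<lambda>n. Jt s (r n) (En n) / ennreal (sigma DIM('a) s (r n)))"
    by (simp add: Per_AE_eq[OF E(1) B] Jt_AE_eq[OF Bn(2)])
next
  fix E :: "'a set"
  assume "E \<in> sets lebesgue \<and> emeasure lebesgue E < \<infinity>"
  then have E: "E \<in> sets lebesgue" "emeasure lebesgue E < \<infinity>" by auto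
  obtain B where B: "B \<in> sets borel" "AE x in lborel. x \<in> E \<longleftrightarrow> x \<in> B" using lebesgue_borel_core[OF E(1)] by metis
  have finB: "emeasure lborel B < \<infinity>" using E emeasure_lebesgue_AE_eq[OF E(1) B] by simp
  show "\<exists>En::nat \<Rightarrow> 'a set. (\<forall>n. En n \<in> sets lebesgue \<and> emeasure lebesgue (En n) < \<infinity>) \<and> chi_L1_conv En E
            \<and> (\<lambda>n. Jt s (r n) (En n) / ennreal (sigma DIM('a) s (r n))) \<longlonglongrightarrow> ennreal (unit_ball_vol (real (DIM('a) - 1))) * Per E"
  proof (intro exI[of _ "\<lambda>_. E"] conjI allI)
    show "chi_L1_conv (\<lambda>_. E) E" by (simp add: chi_L1_conv_def)
    show "(\<lambda>n. Jt s (r n) E / ennreal (sigma DIM('a) s (r n))) \<longlonglongrightarrow> ennreal (unit_ball_vol (real (DIM('a) - 1))) * Per E"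
      using Jt_limit[OF B(1) finB s1 rpos rlim] by (simp add: Per_AE_eq[OF E(1) B] Jt_AE_eq[OF B(2)])
  qed (use E in auto)
qed

end
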